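(* Let $-1\le K<1$ and set $\alpha=1-\sqrt{(1+K)/2}>0$. Let $m,n,p$ be positive integers, $X\in\mathbb{R}^{m\times p}$ a non-zero matrix with rank $q$, $\sigma>0$, and let $Y=XA+\sigma E$, where $E$ is an $m\times n$ random matrix with i.i.d. standard Gaussian entries. Assume that $A=0$ and that $\hat r$ is any minimizer over $r\in\{0,1,\ldots,\min(n,q)\}$ of $$\mathrm{Crit}_{\sigma^2}(r)=\|Y-X\widehat A_r\|^2+\mathrm{pen}_{\sigma^2}(r)\,\sigma^2,\qquad \mathrm{pen}_{\sigma^2}(r)=K\,\mathcal{S}_{q\times n}(r)^2 .$$ Then $$\mathbb{P}\left(\hat r\ \ge\ \frac{1-K}{4}\times\frac{nq-1}{(\sqrt n+\sqrt q)^2}\right)\ \ge\ 1-e^{\alpha^2/2}\,\frac{e^{-\alpha^2\max(n,q)/2}}{1-e^{-\alpha^2\max(n,q)/2}} .$$ As a consequence, with this penalty ($\mathrm{pen}_{\sigma^2}(r)=K\mathcal{S}_{q\times n}(r)^2$, $K<1$) the following risk bound cannot hold: there is no constant $c(K)>0$ depending only on $K$ such that for all $m,n,p$, all $X\neq 0$, all $A\in\mathbb{R}^{p\times n}$ and all $\sigma>0$, the estimator $\widehat A=\widehat A_{\hat r}$ satisfies $$\mathbb{E}\big[\|X\widehat A-XA\|^2\big]\ \le\ c(K)\,\min_{0\le r\le\min(n,q)}\Big\{\mathbb{E}\big[\|XA-X\widehat A_r\|^2\big]+\mathrm{pen}_{\sigma^2}(r)\,\sigma^2+\sigma^2\Bi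g\}.$$
   Context: $\|\cdot\|$ denotes the Hilbert–Schmidt (Frobenius) norm. $\sigma_1(M)\ge\sigma_2(M)\ge\cdots$ are the singular values of a matrix $M$, and $\|M\|_{(2,r)}=\big(\sum_{k=1}^r\sigma_k(M)^2\big)^{1/2}$ is its Ky-Fan $(2,r)$-norm (equal to $0$ for $r=0$). For a $q\times n$ random matrix $G_{q\times n}$ with i.i.d. standard Gaussian entries, $\mathcal{S}_{q\times n}(r)=\mathbb{E}\big[\|G_{q\times n}\|_{(2,r)}\big]$. The matrix $X$ is deterministic. For each $r$, $\widehat A_r$ denotes a minimizer of $B\mapsto\|Y-XB\|$ over the matrices $B\in\mathbb{R}^{p\times n}$ of rank at most $r$ (so $\widehat A_r$ depends on $Y$). *)

theory Defs
  imports
    "HOL-Probability.Probability"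
    "Jordan_Normal_Form.Char_Poly"
    "Jordan_Normal_Form.DL_Rank"
begin

abbreviation mat_rank :: "real mat \<Rightarrow> nat" where
  "mat_rank B \<equiv> vec_space.rank (dim_row B) B"

definition frob_norm :: "real mat \<Rightarrow> real" where
  "frob_norm B = sqrt (\<Sum>i<dim_row B. \<Sum>j<dim_col B. (B $$ (i, j))\<^sup>2)"

(* The characteristic polynomial of B^T * B splits over the reals with non-negative roots,
   so this list has length dim_col B and contains the singular values with multiplicity,
   followed by zeros when dim_row B < dim_col B. *)
definition singular_values :: "real mat \<Rightarrow> real list" where
  "singular_values B =
     rev (sorted_list_of_multiset (image_mset sqrt (proots (char_poly (transpose_mat B * B)))))"

(* Indexed from 1, and 0 beyond the number of columns. *)
definition sing_val :: "real mat \<Rightarrow> nat \<Rightarrow> real" where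
  "sing_val B k =
     (if 1 \<le> k \<and> k \<le> length (singular_values B) then singular_values B ! (k - 1) else 0)"

definition ky_fan2 :: "nat \<Rightarrow> real mat \<Rightarrow> real" where
  "ky_fan2 r B = sqrt (\<Sum>k = 1..r. (sing_val B k)\<^sup>2)"

(* The law of a q x n array of i.i.d. standard Gaussian entries; "mat q n" turns a sample
   point into a matrix. *)
definition gauss_space :: "nat \<Rightarrow> nat \<Rightarrow> (nat \<times> nat \<Rightarrow> real) measure" where
  "gauss_space q n = PiM ({..<q} \<times> {..<n}) (\<lambda>_. density lborel std_normal_density)"

definition S_gauss :: "nat \<Rightarrow> nat \<Rightarrow> nat \<Rightarrow> real" where
  "S_gauss q n r = (\<integral>\<omega>. ky_fan2 r (mat q n \<omega>) \<partial>gauss_space q n)"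

definition gaussian_matrix :: "'w measure \<Rightarrow> nat \<Rightarrow> nat \<Rightarrow> ('w \<Rightarrow> real mat) \<Rightarrow> bool" where
  "gaussian_matrix M m n E \<longleftrightarrow>
     (\<forall>\<omega>\<in>space M. E \<omega> \<in> carrier_mat m n) \<and>
     prob_space.indep_vars M (\<lambda>_. borel) (\<lambda>ij \<omega>. E \<omega> $$ ij) ({..<m} \<times> {..<n}) \<and>
     (\<forall>ij\<in>{..<m} \<times> {..<n}. distributed M lborel (\<lambda>\<omega>. E \<omega> $$ ij) std_normal_density)"

definition random_matrix :: "'w measure \<Rightarrow> nat \<Rightarrow> nat \<Rightarrow> ('w \<Rightarrow> real mat) \<Rightarrow> bool" where
  "random_matrix M p n F \<longleftrightarrow>
     (\<forall>\<omega>\<in>space M. F \<omega> \<in> carrier_mat p n) \<and>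
     (\<forall>i<p. \<forall>j<n. (\<lambda>\<omega>. F \<omega> $$ (i, j)) \<in> borel_measurable M)"

definition low_rank_fit :: "real mat \<Rightarrow> real mat \<Rightarrow> nat \<Rightarrow> real mat \<Rightarrow> bool" where
  "low_rank_fit X Y r B \<longleftrightarrow>
     is_arg_min (\<lambda>B. frob_norm (Y - X * B))
       (\<lambda>B. B \<in> carrier_mat (dim_col X) (dim_col Y) \<and> mat_rank B \<le> r) B"

definition pen :: "real \<Rightarrow> nat \<Rightarrow> nat \<Rightarrow> nat \<Rightarrow> real" where
  "pen K q n r = K * (S_gauss q n r)\<^sup>2"

definition crit ::
    "real \<Rightarrow> real \<Rightarrow> real mat \<Rightarrow> real mat \<Rightarrow> (nat \<Rightarrow> real mat) \<Rightarrow> nat \<Rightarrow> real" where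
  "crit K \<sigma> X Y Ahat r =
     (frob_norm (Y - X * Ahat r))\<^sup>2 + pen K (mat_rank X) (dim_col Y) r * \<sigma>\<^sup>2"

(* The minimizers Ahat r \<omega> and rhat \<omega> need not be unique; this says that they are some
   choice of minimizers at every sample point. *)
definition rank_selection ::
    "real \<Rightarrow> real \<Rightarrow> real mat \<Rightarrow> 'w measure \<Rightarrow> ('w \<Rightarrow> real mat) \<Rightarrow>
     (nat \<Rightarrow> 'w \<Rightarrow> real mat) \<Rightarrow> ('w \<Rightarrow> nat) \<Rightarrow> nat \<Rightarrow> bool" where
  "rank_selection K \<sigma> X M Y Ahat rhat R \<longleftrightarrow>
     (\<forall>\<omega>\<in>space M. \<forall>r\<le>R. low_rank_fit X (Y \<omega>) r (Ahat r \<omega>)) \<and>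
     rhat \<in> measurable M (count_space UNIV) \<and>
     (\<forall>\<omega>\<in>space M.
        is_arg_min (crit K \<sigma> X (Y \<omega>) (\<lambda>r. Ahat r \<omega>)) (\<lambda>r. r \<le> R) (rhat \<omega>))"

(* The expectations are Bochner integrals; they are meaningful when the estimators are
   random matrices. *)
definition risk_bound ::
    "real \<Rightarrow> real \<Rightarrow> real \<Rightarrow> real mat \<Rightarrow> real mat \<Rightarrow> 'w measure \<Rightarrow>
     (nat \<Rightarrow> 'w \<Rightarrow> real mat) \<Rightarrow> ('w \<Rightarrow> nat) \<Rightarrow> nat \<Rightarrow> bool" where
  "risk_bound c K \<sigma> X A M Ahat rhat R \<longleftrightarrow>
     (\<integral>\<omega>. (frob_norm (X * Ahat (rhat \<omega>) \<omega> - X * A))\<^sup>2 \<partial>M)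
       \<le> c * (MIN r\<in>{0..R}.
               (\<integral>\<omega>. (frob_norm (X * A - X * Ahat r \<omega>))\<^sup>2 \<partial>M)
                 + pen K (mat_rank X) (dim_col A) r * \<sigma>\<^sup>2 + \<sigma>\<^sup>2)"

end

theory Submission
  imports Defs
begin

text \<open>
  In coordinates of an orthonormal basis of the column space of X, fitting at rank r is an
  Eckart--Young problem, so Crit(r) = |Y|^2 - sigma^2 (N_r^2 - K S_r^2), where N_r is the Ky Fan
  (2,r)-norm of a q x n standard Gaussian matrix and S_r its mean. Each N_r is a 1-Lipschitz function
  of that matrix. Hence, outside an event whose probability is bounded by a geometric series,
  N_r is at most S_r + alpha sqrt(r max(n,q) - 1) for all r < R := min(n,q), and N_R is at least
  S_R - alpha sqrt(nq - 1). Then small ranks lose against R, because S_R^2 is at least nq - 1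
  (Gaussian variance bound) whereas S_r^2 is at most r max(n,q) + sqrt(r nq (R + 1)) (Frobenius
  norm of the centred Gram matrix). For K < 0 the monotonicity of N_r in r already suffices.

  The risk bound fails for the identity design of size k with n = 1. The choice r = 0 bounds its
  right-hand side by c, while the loss is the squared norm of a Gaussian vector of dimension k
  unless the selected rank is 0, which forces this squared norm to be at most max(K,0) k.
\<close>

section \<open>Orthonormal families\<close>

text \<open>The tail bound is needed with the sharp exponent - t^2 / 2. For rank r the deviation
  satisfies t^2 = \<alpha>^2 (r max(n,q) - 1), so that the tail is exp(\<alpha>^2 / 2) x^r with x =
  exp(- \<alpha>^2 max(n,q) / 2), a term of the stated series. The sharp tail comes from the
  Prekopa-Leindler inequality on the line through a transport inequality that tensorises; the same
  exponential moment bound, expanded near 0, gives the variance bound. The value of \<alpha> is the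
  one with (1 - \<alpha>)^2 - K = (1 - K) / 2: on the good event the full rank keeps the gain (1 -
  K)(nq - 1) / 2. For K >= 0, \<alpha> is at most 3/10 (1 - K), and a positive rank below the
  threshold forces n and q to be at least 5; this leaves enough room for the crude bound on S_r.
  Singular values are given as roots of a characteristic polynomial, a form unsuited to Lipschitz
  estimates. The bridge is Ky Fan's principle: N_r^2 is the maximum of the sum of |B v_j|^2 over
  orthonormal families of r vectors.\<close>

definition ip :: "nat \<Rightarrow> (nat \<Rightarrow> real) \<Rightarrow> (nat \<Rightarrow> real) \<Rightarrow> real" where
  "ip n u v = (\<Sum>i<n. u i * v i)"

lemma ip_commute: "ip n u v = ip n v u"
  by (simp add: ip_def mult.commute)

lemma ip_add_left: "ip n (\<lambda>l. u l + v l) w = ip n u w + ip n v w"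
  by (simp add: ip_def sum.distrib algebra_simps)

lemma ip_diff_left: "ip n (\<lambda>l. u l - v l) w = ip n u w - ip n v w"
  by (simp add: ip_def sum_subtractf algebra_simps)

lemma ip_scale_left: "ip n (\<lambda>l. c * u l) w = c * ip n u w"
  by (simp add: ip_def sum_distrib_left algebra_simps)

lemma ip_sum_left: "ip n (\<lambda>l. \<Sum>j\<in>J. f j l) w = (\<Sum>j\<in>J. ip n (f j) w)"
  unfolding ip_def by (simp add: sum_distrib_right) (rule sum.swap)

lemma ip_add_right: "ip n w (\<lambda>l. u l + v l) = ip n w u + ip n w v"
  by (simp add: ip_def sum.distrib algebra_simps)

lemma ip_diff_right: "ip n w (\<lambda>l. u l - v l) = ip n w u - ip n w v"
  by (simp add: ip_def sum_subtractf algebra_simps)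

lemma ip_scale_right: "ip n w (\<lambda>l. c * u l) = c * ip n w u"
  by (simp add: ip_def sum_distrib_left algebra_simps)

lemma ip_sum_right: "ip n w (\<lambda>l. \<Sum>j\<in>J. f j l) = (\<Sum>j\<in>J. ip n w (f j))"
  unfolding ip_def by (simp add: sum_distrib_left) (rule sum.swap)

lemmas ip_linear = ip_add_left ip_diff_left ip_scale_left ip_sum_left
  ip_add_right ip_diff_right ip_scale_right ip_sum_right

lemma ip_cong: "\<lbrakk>\<And>l. l < n \<Longrightarrow> u l = u' l; \<And>l. l < n \<Longrightarrow> v l = v' l\<rbrakk> \<Longrightarrow> ip n u v = ip n u' v'"
  by (simp add: ip_def)

lemma ip_self: "ip n u u = (\<Sum>i<n. (u i)\<^sup>2)"
  by (simp add: ip_def power2_eq_square)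

lemma ip_self_nonneg [simp]: "0 \<le> ip n u u"
  by (simp add: ip_self sum_nonneg)

lemma ip_self_eq_0: "ip n u u = 0 \<longleftrightarrow> (\<forall>l<n. u l = 0)"
  unfolding ip_self by (subst sum_nonneg_eq_0_iff) auto

lemma ip_delta_right: "i < n \<Longrightarrow> ip n u (\<lambda>l. of_bool (l = i)) = u i"
  by (simp add: ip_def of_bool_def if_distrib[where f="\<lambda>x. u _ * x"] cong: if_cong)

lemma ip_delta_left: "i < n \<Longrightarrow> ip n (\<lambda>l. of_bool (l = i)) u = u i"
  by (subst ip_commute) (rule ip_delta_right)

text \<open>Vectors are total functions of which only the first \<open>n\<close> coordinates count,
  and families are total functions of which only the first \<open>k\<close> members count. A family
  then grows by the update \<open>v(k := w)\<close> without any change of type.\<close>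

definition orthonormal :: "nat \<Rightarrow> nat \<Rightarrow> (nat \<Rightarrow> nat \<Rightarrow> real) \<Rightarrow> bool" where
  "orthonormal n k v \<longleftrightarrow> (\<forall>i<k. \<forall>j<k. ip n (v i) (v j) = of_bool (i = j))"

lemma orthonormalD: "\<lbrakk>orthonormal n k v; i < k; j < k\<rbrakk> \<Longrightarrow> ip n (v i) (v j) = of_bool (i = j)"
  by (simp add: orthonormal_def)

lemma orthonormal_mono: "\<lbrakk>orthonormal n k v; r \<le> k\<rbrakk> \<Longrightarrow> orthonormal n r v"
  by (simp add: orthonormal_def)

definition proj :: "nat \<Rightarrow> nat \<Rightarrow> (nat \<Rightarrow> nat \<Rightarrow> real) \<Rightarrow> (nat \<Rightarrow> real) \<Rightarrow> nat \<Rightarrow> real" where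
  "proj n k v a = (\<lambda>l. \<Sum>j<k. ip n (v j) a * v j l)"

text \<open>On the first n coordinates, z lies in the span of v 0, ..., v (k - 1).\<close>

definition fixed_by :: "nat \<Rightarrow> nat \<Rightarrow> (nat \<Rightarrow> nat \<Rightarrow> real) \<Rightarrow> (nat \<Rightarrow> real) \<Rightarrow> bool" where
  "fixed_by n k v z \<longleftrightarrow> (\<forall>l<n. proj n k v z l = z l)"

lemma ip_comb:
  assumes "orthonormal n k v" "i < k"
  shows "ip n (v i) (\<lambda>l. \<Sum>j<k. c j * v j l) = c i"
proof -
  have "ip n (v i) (\<lambda>l. \<Sum>j<k. c j * v j l) = (\<Sum>j<k. c j * ip n (v i) (v j))"
    by (simp add: ip_linear)
  also have "\<dots> = (\<Sum>j<k. if j = i then c i else 0)"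
    using assms by (intro sum.cong) (auto simp: orthonormalD)
  finally show ?thesis using assms by simp
qed

lemma ip_proj: "\<lbrakk>orthonormal n k v; i < k\<rbrakk> \<Longrightarrow> ip n (v i) (proj n k v a) = ip n (v i) a"
  unfolding proj_def by (rule ip_comb)

text \<open>Parseval's identity, polarised; membership in the span is needed for one of the two
  arguments only.\<close>

lemma ip_fixed:
  assumes "fixed_by n k v z"
  shows "ip n a z = (\<Sum>j<k. ip n (v j) a * ip n (v j) z)"
proof -
  have "ip n a z = ip n a (proj n k v z)"
    using assms by (intro ip_cong) (auto simp: fixed_by_def)
  also have "\<dots> = (\<Sum>j<k. ip n (v j) z * ip n a (v j))"
    by (simp add: proj_def ip_linear)
  finally show ?thesis by (simp add: ip_commute mult.commute)
qed

lemma fixed_by_comb: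
  assumes "orthonormal n k v"
  shows "fixed_by n k v (\<lambda>l. \<Sum>j<k. c j * v j l)"
  using ip_comb[OF assms, of _ c] by (simp add: fixed_by_def proj_def)

lemma fixed_by_proj: "orthonormal n k v \<Longrightarrow> fixed_by n k v (proj n k v a)"
  using fixed_by_comb[of n k v "\<lambda>j. ip n (v j) a"] by (simp add: proj_def)

lemma fixed_by_cong: "(\<And>l. l < n \<Longrightarrow> a l = b l) \<Longrightarrow> fixed_by n k v a \<longleftrightarrow> fixed_by n k v b"
  unfolding fixed_by_def proj_def by (simp add: ip_cong[of n _ _ a b])

lemma fixed_by_sum:
  assumes "\<And>j. j \<in> J \<Longrightarrow> fixed_by n k v (x j)"
  shows "fixed_by n k v (\<lambda>l. \<Sum>j\<in>J. c j * x j l)"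
proof -
  have "proj n k v (\<lambda>l. \<Sum>j\<in>J. c j * x j l) l = (\<Sum>j\<in>J. c j * proj n k v (x j) l)" for l
    unfolding proj_def ip_linear sum_distrib_right sum_distrib_left
    by (subst sum.swap) (simp add: mult.assoc)
  then show ?thesis using assms by (simp add: fixed_by_def)
qed

text \<open>Pythagoras: the first two terms are the squared distance of \<open>a\<close> to the
  span, the last one is the squared distance within the span. The last term is kept explicit because
  a minimiser will later be identified by its vanishing.\<close>

lemma ip_residual:
  assumes v: "orthonormal n k v" and z: "fixed_by n k v z"
  shows "ip n (\<lambda>l. a l - z l) (\<lambda>l. a l - z l) =
    ip n a a - (\<Sum>j<k. (ip n (v j) a)\<^sup>2) + (\<Sum>j<k. (ip n (v j) a - ip n (v j) z)\<^sup>2)"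
proof -
  have "ip n (\<lambda>l. a l - z l) (\<lambda>l. a l - z l) = ip n a a - 2 * ip n a z + ip n z z"
    by (simp add: ip_linear ip_commute)
  also have "\<dots> = ip n a a + (\<Sum>j<k. (ip n (v j) z)\<^sup>2 - 2 * (ip n (v j) a * ip n (v j) z))"
    unfolding ip_fixed[OF z, of a] ip_fixed[OF z, of z]
    by (simp add: sum_subtractf sum_distrib_left power2_eq_square)
  also have "\<dots> = ip n a a + (\<Sum>j<k. (ip n (v j) a - ip n (v j) z)\<^sup>2 - (ip n (v j) a)\<^sup>2)"
    by (simp add: power2_diff algebra_simps)
  finally show ?thesis by (simp add: sum_subtractf)
qed

lemma bessel:
  assumes v: "orthonormal n k v"
  shows "(\<Sum>j<k. (ip n (v j) a)\<^sup>2) \<le> ip n a a"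
proof -
  have "0 \<le> ip n (\<lambda>l. a l - proj n k v a l) (\<lambda>l. a l - proj n k v a l)" by simp
  also have "\<dots> = ip n a a - (\<Sum>j<k. (ip n (v j) a)\<^sup>2)"
    by (subst ip_residual[OF v fixed_by_proj[OF v]]) (simp add: ip_proj[OF v])
  finally show ?thesis by simp
qed

lemma orthonormal_sum_squares:
  "orthonormal n k v \<Longrightarrow> (\<Sum>i<n. \<Sum>j<k. (v j i)\<^sup>2) = real k"
  by (subst sum.swap) (simp add: ip_self[symmetric] orthonormalD)

text \<open>Dimension by counting squares: the entries of the family have total square sum
  \<open>k\<close>, while Bessel's inequality for each coordinate vector bounds the contribution of
  each of the \<open>n\<close> coordinates by 1.\<close>

lemma orthonormal_le:
  assumes v: "orthonormal n k v"
  shows "k \<le> n"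
proof -
  have "(\<Sum>j<k. (v j i)\<^sup>2) \<le> 1" if "i < n" for i
    using bessel[OF v, of "\<lambda>l. of_bool (l = i)"] that by (simp add: ip_delta_right)
  then have "(\<Sum>i<n. \<Sum>j<k. (v j i)\<^sup>2) \<le> (\<Sum>i<n. 1)" by (intro sum_mono) auto
  then show ?thesis using orthonormal_sum_squares[OF v] by simp
qed

lemma orthonormal_upd:
  assumes v: "orthonormal n k v" and w: "ip n w w = 1" "\<And>j. j < k \<Longrightarrow> ip n (v j) w = 0"
  shows "orthonormal n (Suc k) (v(k := w))"
    and "fixed_by n k v b \<Longrightarrow> fixed_by n (Suc k) (v(k := w)) b"
proof -
  show "orthonormal n (Suc k) (v(k := w))"
    using v w w(2)[unfolded ip_commute[of n _ w]] unfolding orthonormal_def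
    by (auto simp: less_Suc_eq)
  assume b: "fixed_by n k v b"
  have "ip n w b = 0" using w by (subst ip_fixed[OF b]) simp
  then have "proj n (Suc k) (v(k := w)) b = proj n k v b"
    by (simp add: proj_def fun_eq_iff)
  then show "fixed_by n (Suc k) (v(k := w)) b" using b by (simp add: fixed_by_def)
qed

text \<open>One Gram-Schmidt step: \<open>w\<close> is the normalised residual of \<open>a\<close>.
  The new span keeps every vector of the old one and gains \<open>a\<close>.\<close>

lemma orthonormal_extend:
  fixes s
  assumes v: "orthonormal n k v" and a: "\<not> fixed_by n k v a"
  defines "u \<equiv> \<lambda>l. a l - proj n k v a l"
  defines "s \<equiv> sqrt (ip n u u)"
  defines "w \<equiv> \<lambda>l. inverse s * u l"
  shows "s > 0" and "orthonormal n (Suc k) (v(k := w))"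
    and "\<And>b. fixed_by n k v b \<Longrightarrow> fixed_by n (Suc k) (v(k := w)) b"
    and "fixed_by n (Suc k) (v(k := w)) a"
proof -
  have "ip n u u \<noteq> 0" using a by (auto simp: ip_self_eq_0 u_def fixed_by_def)
  then have "ip n u u > 0" using ip_self_nonneg[of n u] by linarith
  then show s: "s > 0" by (simp add: s_def)
  have ss: "s * s = ip n u u" by (simp add: s_def)
  have vu: "ip n (v j) u = 0" if "j < k" for j
    using that by (simp add: u_def ip_linear ip_proj[OF v])
  have "ip n w w = inverse s * (inverse s * ip n u u)" unfolding w_def ip_linear ..
  then have ww: "ip n w w = 1" using s by (simp add: ss[symmetric] field_simps)
  have vw: "ip n (v j) w = 0" if "j < k" for j
    using that vu by (simp add: w_def ip_linear)
  note * = orthonormal_upd[OF v ww vw]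
  show on: "orthonormal n (Suc k) (v(k := w))" using * by blast
  show "\<And>b. fixed_by n k v b \<Longrightarrow> fixed_by n (Suc k) (v(k := w)) b" using * by blast
  have s': "s * (inverse s * t) = t" for t using s by (simp add: field_simps)
  have "a l = (\<Sum>j<Suc k. (if j = k then s else ip n (v j) a) * (v(k := w)) j l)" for l
    by (simp add: w_def s') (simp add: u_def proj_def)
  then have "a = (\<lambda>l. \<Sum>j<Suc k. (if j = k then s else ip n (v j) a) * (v(k := w)) j l)" by blast
  then show "fixed_by n (Suc k) (v(k := w)) a"
    using fixed_by_comb[OF on, of "\<lambda>j. if j = k then s else ip n (v j) a"] by simp
qed

text \<open>If every vector were fixed, the projection would have all \<open>n\<close> diagonal
  entries equal to 1, but its trace is \<open>k\<close>.\<close>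

lemma ex_not_fixed:
  assumes v: "orthonormal n k v" and "k < n"
  shows "\<exists>a. \<not> fixed_by n k v a"
proof (rule ccontr)
  assume "\<nexists>a. \<not> fixed_by n k v a"
  then have *: "proj n k v (\<lambda>l. of_bool (l = i)) i = 1" if "i < n" for i
    using that by (auto simp: fixed_by_def)
  have "(\<Sum>j<k. (v j i)\<^sup>2) = 1" if "i < n" for i
    using *[OF that] that by (simp add: proj_def ip_delta_right power2_eq_square)
  then have "(\<Sum>i<n. \<Sum>j<k. (v j i)\<^sup>2) = real n" by simp
  then show False using orthonormal_sum_squares[OF v] assms by simp
qed

lemma orthonormal_complete:
  assumes "orthonormal n k v" "k \<le> r" "r \<le> n"
  shows "\<exists>v'. orthonormal n r v' \<and> (\<forall>b. fixed_by n k v b \<longrightarrow> fixed_by n r v' b)"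
  using assms(2,3)
proof (induction r rule: dec_induct)
  case base
  then show ?case using assms by blast
next
  case (step r)
  then obtain v' where v': "orthonormal n r v'" "\<And>b. fixed_by n k v b \<Longrightarrow> fixed_by n r v' b"
    by auto
  obtain a where a: "\<not> fixed_by n r v' a" using ex_not_fixed[OF v'(1)] step by auto
  show ?case using orthonormal_extend(2,3)[OF v'(1) a] v'(2) by blast
qed

text \<open>Span of an arbitrary, possibly dependent family; \<open>fixed_by\<close> expresses
  membership only for orthonormal families.\<close>

definition in_span :: "nat \<Rightarrow> nat \<Rightarrow> (nat \<Rightarrow> nat \<Rightarrow> real) \<Rightarrow> (nat \<Rightarrow> real) \<Rightarrow> bool" where
  "in_span n p x a \<longleftrightarrow> (\<exists>c. \<forall>l<n. a l = (\<Sum>j<p. c j * x j l))"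

lemma in_span_comb:
  assumes "\<And>i. i < k \<Longrightarrow> in_span n p x (v i)" "\<And>l. l < n \<Longrightarrow> a l = (\<Sum>i<k. d i * v i l)"
  shows "in_span n p x a"
proof -
  obtain c where c: "\<And>i l. i < k \<Longrightarrow> l < n \<Longrightarrow> v i l = (\<Sum>j<p. c i j * x j l)"
    using assms(1) unfolding in_span_def by metis
  have "a l = (\<Sum>j<p. (\<Sum>i<k. d i * c i j) * x j l)" if "l < n" for l
  proof -
    have "a l = (\<Sum>i<k. d i * v i l)" using assms(2) that .
    also have "\<dots> = (\<Sum>i<k. \<Sum>j<p. d i * c i j * x j l)"
      using that c by (intro sum.cong refl) (simp add: sum_distrib_left mult.assoc)
    also have "\<dots> = (\<Sum>j<p. (\<Sum>i<k. d i * c i j) * x j l)"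
      by (subst sum.swap) (simp add: sum_distrib_right)
    finally show ?thesis .
  qed
  then show ?thesis
    unfolding in_span_def by (intro exI[of _ "\<lambda>j. \<Sum>i<k. d i * c i j"]) simp
qed

lemma in_span_base: "j < p \<Longrightarrow> in_span n p x (x j)"
  unfolding in_span_def by (rule exI[of _ "\<lambda>i. of_bool (i = j)"]) simp

lemma in_span_Suc: "in_span n p x a \<Longrightarrow> in_span n (Suc p) x a"
proof -
  assume "in_span n p x a"
  then obtain c where "\<forall>l<n. a l = (\<Sum>j<p. c j * x j l)" by (auto simp: in_span_def)
  then show ?thesis unfolding in_span_def by (intro exI[of _ "\<lambda>j. if j = p then 0 else c j"]) simp
qed

text \<open>Vectors that already lie in the current span are skipped, so dependent families are
  allowed and \<open>k\<close> may be smaller than \<open>p\<close>.\<close>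

lemma gram_schmidt:
  "\<exists>k v. k \<le> p \<and> orthonormal n k v \<and> (\<forall>i<k. in_span n p x (v i)) \<and> (\<forall>j<p. fixed_by n k v (x j))"
proof (induction p)
  case 0
  show ?case by (intro exI[of _ 0]) (simp add: orthonormal_def)
next
  case (Suc p)
  then obtain k v where *: "k \<le> p" "orthonormal n k v" "\<And>i. i < k \<Longrightarrow> in_span n p x (v i)"
    "\<And>j. j < p \<Longrightarrow> fixed_by n k v (x j)" by blast
  show ?case
  proof (cases "fixed_by n k v (x p)")
    case True
    then show ?thesis using * by (intro exI[of _ k] exI[of _ v]) (auto simp: less_Suc_eq in_span_Suc)
  next
    case False
    let ?u = "\<lambda>l. x p l - proj n k v (x p) l"
    let ?s = "sqrt (ip n ?u ?u)"
    let ?w = "\<lambda>l. inverse ?s * ?u l"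
    note ext = orthonormal_extend[OF *(2) False]
    \<comment> \<open>The new basis vector is a combination of the old ones and \<open>x p\<close>,
      so \<open>x p\<close> is placed at position \<open>k\<close> for the use of
      \<open>in_span_comb\<close>.\<close>
    let ?y = "v(k := x p)"
    have y: "in_span n (Suc p) x (?y i)" if "i < Suc k" for i
      using that *(3) by (auto simp: less_Suc_eq in_span_Suc intro: in_span_base)
    have "in_span n (Suc p) x ?w"
    proof (rule in_span_comb[OF y])
      fix l
      show "?w l = (\<Sum>i<Suc k. (if i = k then inverse ?s else - inverse ?s * ip n (v i) (x p)) * ?y i l)"
        by (simp add: proj_def sum_distrib_left sum_negf right_diff_distrib mult.assoc)
    qed
    then have "\<forall>i<Suc k. in_span n (Suc p) x ((v(k := ?w)) i)"
      using *(3) by (auto simp: less_Suc_eq in_span_Suc)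
    moreover have "\<forall>j<Suc p. fixed_by n (Suc k) (v(k := ?w)) (x j)"
      using ext(3,4) *(4) by (auto simp: less_Suc_eq)
    ultimately show ?thesis using *(1) ext(2)
      by (intro exI[of _ "Suc k"] exI[of _ "v(k := ?w)"] conjI) (simp_all only: Suc_le_mono)
  qed
qed

lemma fixed_by_in_span:
  assumes "\<And>j. j < p \<Longrightarrow> fixed_by n k v (x j)" "in_span n p x a"
  shows "fixed_by n k v a"
proof -
  obtain c where c: "\<And>l. l < n \<Longrightarrow> a l = (\<Sum>j<p. c j * x j l)"
    using assms(2) by (auto simp: in_span_def)
  show ?thesis using fixed_by_sum[of "{..<p}" n k v x c] assms(1) fixed_by_cong[OF c] by simp
qed

text \<open>A double count: with an orthonormal basis \<open>f\<close> of the span of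
  \<open>x\<close>, Parseval for each \<open>e i\<close> gives \<open>k\<close> as the sum of all
  squared inner products of \<open>e i\<close> and \<open>f j\<close>, and Bessel for each
  \<open>f j\<close> bounds the same sum by the size of \<open>f\<close>.\<close>

lemma orthonormal_card_le:
  assumes e: "orthonormal n k e" and s: "\<And>i. i < k \<Longrightarrow> in_span n p x (e i)"
  shows "k \<le> p"
proof -
  obtain r f where f: "r \<le> p" "orthonormal n r f" "\<And>j. j < p \<Longrightarrow> fixed_by n r f (x j)"
    using gram_schmidt[of p n x] by blast
  have "real k = (\<Sum>i<k. \<Sum>j<r. (ip n (f j) (e i))\<^sup>2)"
  proof -
    have "1 = (\<Sum>j<r. (ip n (f j) (e i))\<^sup>2)" if "i < k" for i
      using ip_fixed[OF fixed_by_in_span[OF f(3) s[OF that]], of "e i"] orthonormalD[OF e that that]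
      by (simp add: power2_eq_square)
    then show ?thesis by simp
  qed
  also have "\<dots> = (\<Sum>j<r. \<Sum>i<k. (ip n (e i) (f j))\<^sup>2)"
    by (subst sum.swap) (simp add: ip_commute)
  also have "\<dots> \<le> (\<Sum>j<r. ip n (f j) (f j))"
    by (intro sum_mono bessel[OF e])
  also have "\<dots> = real r" using f(2) by (simp add: orthonormalD)
  finally show ?thesis using f(1) by simp
qed

section \<open>Ky Fan norms and orthonormal families\<close>

text \<open>The inner product of B a and B c for the q x n matrix B with rows b 0, ..., b (q - 1).\<close>

definition form :: "nat \<Rightarrow> nat \<Rightarrow> (nat \<Rightarrow> nat \<Rightarrow> real) \<Rightarrow> (nat \<Rightarrow> real) \<Rightarrow> (nat \<Rightarrow> real) \<Rightarrow> real" where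
  "form q n b a c = ip q (\<lambda>i. ip n (b i) a) (\<lambda>i. ip n (b i) c)"

lemma form_commute: "form q n b a c = form q n b c a"
  unfolding form_def by (rule ip_commute)

lemma form_nonneg [simp]: "0 \<le> form q n b a a"
  by (simp add: form_def)

lemma form_add_left: "form q n b (\<lambda>l. x l + y l) c = form q n b x c + form q n b y c"
  and form_scale_left: "form q n b (\<lambda>l. t * x l) c = t * form q n b x c"
  and form_add_right: "form q n b c (\<lambda>l. x l + y l) = form q n b c x + form q n b c y"
  and form_scale_right: "form q n b c (\<lambda>l. t * x l) = t * form q n b c x"
  and form_sum_left: "form q n b (\<lambda>l. \<Sum>j\<in>J. f j l) c = (\<Sum>j\<in>J. form q n b (f j) c)"
  unfolding form_def by (simp_all add: ip_linear)

lemmas form_linear = form_add_left form_scale_left form_add_right form_scale_right form_sum_left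

lemma form_cong:
  "\<lbrakk>\<And>l. l < n \<Longrightarrow> a l = a' l; \<And>l. l < n \<Longrightarrow> c l = c' l\<rbrakk> \<Longrightarrow> form q n b a c = form q n b a' c'"
  unfolding form_def by (simp add: ip_cong[of n _ _ a a'] ip_cong[of n _ _ c c'])

section \<open>Spectral theorem by successive maximisation of the Rayleigh quotient\<close>

lemma continuous_on_ip [continuous_intros]:
  fixes f g :: "'a::topological_space \<Rightarrow> nat \<Rightarrow> real"
  assumes "continuous_on S f" "continuous_on S g"
  shows "continuous_on S (\<lambda>x. ip n (f x) (g x))"
  unfolding ip_def
  by (intro continuous_intros continuous_on_product_then_coordinatewise[OF assms(1)]
      continuous_on_product_then_coordinatewise[OF assms(2)])

lemma continuous_on_form:
  fixes b :: "nat \<Rightarrow> nat \<Rightarrow> real"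
  shows "continuous_on S (\<lambda>a. form q n b a a)"
  unfolding form_def ip_def[of q] by (intro continuous_intros continuous_on_id)

text \<open>Vectors live in an infinite product, so the coordinates from \<open>n\<close> on are
  pinned to 0; otherwise the set would be unbounded there. Compactness is then Tychonoff's
  theorem.\<close>

lemma compact_truncated_cube:
  "compact {a :: nat \<Rightarrow> real. \<forall>l. a l \<in> (if l < n then {-1..1} else {0})}"
proof -
  have "compactin (product_topology (\<lambda>_. euclidean) UNIV)
      (PiE UNIV (\<lambda>l. if l < n then {-1..1} else {0::real}))"
    by (subst compactin_PiE) auto
  moreover have "PiE UNIV (\<lambda>l. if l < n then {-1..1} else {0::real}) =
      {a. \<forall>l. a l \<in> (if l < n then {-1..1} else {0})}"
    by (auto simp: PiE_def Pi_def)
  ultimately show ?thesis unfolding euclidean_product_topology compactin_euclidean_iff by (simp only:)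
qed

text \<open>A continuous function attains its supremum on the compact unit sphere of the orthogonal
  complement of \<open>u\<close>; homogeneity carries the bound over to all vectors of the
  complement.\<close>

lemma rayleigh_maximiser:
  assumes u: "orthonormal n k u" and kn: "k < n"
  obtains w where "ip n w w = 1" "\<And>j. j < k \<Longrightarrow> ip n (u j) w = 0"
    "\<And>a. (\<And>j. j < k \<Longrightarrow> ip n (u j) a = 0) \<Longrightarrow> form q n b a a \<le> form q n b w w * ip n a a"
proof -
  define C where "C = {a :: nat \<Rightarrow> real. \<forall>l. a l \<in> (if l < n then {-1..1} else {0})}"
  define K where "K = C \<inter> ({a. ip n a a = 1} \<inter> (\<Inter>j<k. {a. ip n (u j) a = 0}))"
  \<comment> \<open>Setting the coordinates from \<open>n\<close> on to 0 changes no value of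
    \<open>ip n\<close> or \<open>form\<close>, but moves unit vectors into the compact set.\<close>
  define tr where "tr = (\<lambda>(a :: nat \<Rightarrow> real) l. if l < n then a l else 0)"
  have ip_tr: "ip n x (tr y) = ip n x y" "ip n (tr y) x = ip n y x" for x y
    by (auto intro!: ip_cong simp: tr_def)
  have form_tr: "form q n b (tr y) (tr y) = form q n b y y" for y
    by (auto intro!: form_cong simp: tr_def)
  have trK: "tr a \<in> K" if a: "ip n a a = 1" "\<And>j. j < k \<Longrightarrow> ip n (u j) a = 0" for a
  proof -
    have "\<bar>a l\<bar> \<le> 1" if "l < n" for l
    proof -
      have "(a l)\<^sup>2 \<le> (\<Sum>i<n. (a i)\<^sup>2)" using that by (intro member_le_sum) auto
      then have "(a l)\<^sup>2 \<le> 1" using a(1) by (simp add: ip_self)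
      then show ?thesis by (simp add: abs_square_le_1)
    qed
    then have "tr a \<in> C" by (auto simp: C_def tr_def abs_le_iff)
    then show ?thesis using a by (simp add: K_def ip_tr)
  qed
  have "closed ({a. ip n a a = 1} \<inter> (\<Inter>j<k. {a. ip n (u j) a = 0}))"
    by (intro closed_Int closed_INT ballI closed_Collect_eq continuous_intros continuous_on_id)
  then have compact: "compact K"
    unfolding K_def C_def by (intro compact_Int_closed compact_truncated_cube)
  \<comment> \<open>As \<open>k < n\<close>, a Gram-Schmidt step is possible, and the vector it
    produces shows that the sphere of the complement is not empty.\<close>
  obtain a where a: "\<not> fixed_by n k u a" using ex_not_fixed[OF u kn] by blast
  let ?w = "\<lambda>l. inverse (sqrt (ip n (\<lambda>l. a l - proj n k u a l) (\<lambda>l. a l - proj n k u a l))) *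
      (a l - proj n k u a l)"
  have on: "orthonormal n (Suc k) (u(k := ?w))" by (rule orthonormal_extend(2)[OF u a])
  have "ip n ?w ?w = 1" using orthonormalD[OF on, of k k] by simp
  moreover have "ip n (u j) ?w = 0" if "j < k" for j
    using orthonormalD[OF on, of j k] that by simp
  ultimately have "tr ?w \<in> K" by (intro trK)
  then have "K \<noteq> {}" by (rule ex_in_conv[THEN iffD1, OF exI])
  from continuous_attains_sup[OF compact this continuous_on_form[of K q n b]]
  obtain w where w: "w \<in> K" "\<And>a. a \<in> K \<Longrightarrow> form q n b a a \<le> form q n b w w"
    by blast
  show thesis
  proof
    show "ip n w w = 1" using w(1) by (simp add: K_def)
    show "\<And>j. j < k \<Longrightarrow> ip n (u j) w = 0" using w(1) by (simp add: K_def)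
    fix a assume a: "\<And>j. j < k \<Longrightarrow> ip n (u j) a = 0"
    show "form q n b a a \<le> form q n b w w * ip n a a"
    proof (cases "ip n a a = 0")
      case True
      then have "form q n b a a = form q n b (\<lambda>l. 0 * a l) (\<lambda>l. 0 * a l)"
        by (intro form_cong) (simp_all add: ip_self_eq_0)
      also have "\<dots> = 0 * (0 * form q n b a a)" unfolding form_scale_left form_scale_right ..
      finally show ?thesis using True by simp
    next
      case False
      define s where "s = sqrt (ip n a a)"
      have s: "s > 0" "s * s = ip n a a"
        using False ip_self_nonneg[of n a] by (auto simp: s_def order.order_iff_strict)
      define c where "c = (\<lambda>l. inverse s * a l)"
      have "ip n c c = inverse s * (inverse s * ip n a a)" unfolding c_def ip_linear ..
      then have "ip n c c = 1" using s(1) by (simp add: s(2)[symmetric] field_simps)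
      moreover have "ip n (u j) c = 0" if "j < k" for j
        unfolding c_def ip_linear using a that by simp
      ultimately have "tr c \<in> K" by (intro trK)
      then have "form q n b c c \<le> form q n b w w" using w(2) form_tr by metis
      moreover have "form q n b c c = inverse s * (inverse s * form q n b a a)"
        unfolding c_def form_linear ..
      ultimately have "inverse s * (inverse s * form q n b a a) \<le> form q n b w w" by simp
      then show ?thesis using s(1) by (simp add: s(2)[symmetric] field_simps)
    qed
  qed
qed

lemma linear_coefficient_zero:
  fixes A C :: real
  assumes "\<And>t. 2 * t * A + t\<^sup>2 * C \<le> 0"
  shows "A = 0"
proof (rule ccontr)
  assume "A \<noteq> 0"
  \<comment> \<open>A multiple of \<open>A\<close> small enough for the linear term to dominate,
    whatever the sign of \<open>C\<close>.\<close>
  define t where "t = A / (1 + \<bar>C\<bar>)"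
  have A: "A = t * (1 + \<bar>C\<bar>)" by (simp add: t_def add_nonneg_eq_0_iff)
  have "t \<noteq> 0" using \<open>A \<noteq> 0\<close> by (simp add: t_def)
  have "2 * t * A + t\<^sup>2 * C = t\<^sup>2 * (2 + 2 * \<bar>C\<bar> + C)"
    by (subst A) (simp add: algebra_simps power2_eq_square)
  moreover have "t\<^sup>2 * (2 + 2 * \<bar>C\<bar> + C) > 0"
    using \<open>t \<noteq> 0\<close> by (intro mult_pos_pos) auto
  ultimately show False using assms[of t] by linarith
qed

text \<open>First-order condition at the maximum: moving \<open>w\<close> by \<open>t\<close> times
  a vector \<open>c\<close> of the complement gives a quadratic in \<open>t\<close> that is never
  positive, so its linear coefficient vanishes. The component of \<open>a\<close> along the earlier
  eigenvectors contributes 0 to both sides.\<close>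

lemma rayleigh_eigenvector:
  assumes u: "orthonormal n k u"
    and eig: "\<And>j a. j < k \<Longrightarrow> form q n b a (u j) = lam j * ip n a (u j)"
    and w: "ip n w w = 1" "\<And>j. j < k \<Longrightarrow> ip n (u j) w = 0"
    and max: "\<And>a. (\<And>j. j < k \<Longrightarrow> ip n (u j) a = 0) \<Longrightarrow>
      form q n b a a \<le> form q n b w w * ip n a a"
  shows "form q n b a w = form q n b w w * ip n a w"
proof -
  define \<mu> where "\<mu> = form q n b w w"
  define c where "c = (\<lambda>l. a l - proj n k u a l)"
  have c0: "ip n (u j) c = 0" if "j < k" for j
    using that by (simp add: c_def ip_linear ip_proj[OF u])
  have "2 * t * (form q n b c w - \<mu> * ip n c w) + t\<^sup>2 * (form q n b c c - \<mu> * ip n c c) \<le> 0" for t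
  proof -
    let ?x = "\<lambda>l. w l + t * c l"
    have "form q n b ?x ?x \<le> \<mu> * ip n ?x ?x"
      unfolding \<mu>_def by (rule max) (simp add: ip_linear w c0)
    moreover have "form q n b ?x ?x = \<mu> + 2 * t * form q n b c w + t\<^sup>2 * form q n b c c"
      by (simp add: form_linear \<mu>_def form_commute[of q n b w c] power2_eq_square algebra_simps)
    moreover have "ip n ?x ?x = 1 + 2 * t * ip n c w + t\<^sup>2 * ip n c c"
      by (simp add: ip_linear w(1) ip_commute[of n w c] power2_eq_square algebra_simps)
    ultimately show ?thesis by (simp add: algebra_simps)
  qed
  then have *: "form q n b c w = \<mu> * ip n c w"
    using linear_coefficient_zero by (metis eq_iff_diff_eq_0)
  have a: "a = (\<lambda>l. c l + (\<Sum>j<k. ip n (u j) a * u j l))" by (simp add: c_def proj_def)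
  have "form q n b (u j) w = 0" if "j < k" for j
    using eig[OF that, of w] w(2)[OF that] by (simp add: form_commute ip_commute)
  then have "form q n b a w = form q n b c w"
    by (subst a) (simp add: form_linear)
  moreover have "ip n a w = ip n c w"
    by (subst a) (simp add: ip_linear w)
  ultimately show ?thesis using * by (simp add: \<mu>_def)
qed

text \<open>Induction on the number of eigenvectors found. The hypothesis also records that
  \<open>lam i\<close> is maximal on the complement of the preceding vectors; as \<open>u j\<close>
  competes in the maximum defining \<open>lam i\<close> for \<open>i \<le> j\<close>, the
  eigenvalues come out in decreasing order.\<close>

theorem spectral_decomposition:
  obtains u lam where "orthonormal n n u"
    "\<And>i a. i < n \<Longrightarrow> form q n b a (u i) = lam i * ip n a (u i)"
    "\<And>i j. i \<le> j \<Longrightarrow> j < n \<Longrightarrow> lam j \<le> lam i" "\<And>i. 0 \<le> (lam i :: real)"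
proof -
  have "\<exists>u lam. orthonormal n k u \<and>
      (\<forall>i<k. (\<forall>a. form q n b a (u i) = lam i * ip n a (u i)) \<and>
             (\<forall>a. (\<forall>j<i. ip n (u j) a = 0) \<longrightarrow> form q n b a a \<le> lam i * ip n a a))" if "k \<le> n" for k
    using that
  proof (induction k)
    case 0
    then show ?case by (simp add: orthonormal_def)
  next
    case (Suc k)
    then have "k \<le> n" by simp
    from Suc.IH[OF this] obtain u lam where u: "orthonormal n k u"
      "\<And>i a. i < k \<Longrightarrow> form q n b a (u i) = lam i * ip n a (u i)"
      "\<And>i a. i < k \<Longrightarrow> (\<And>j. j < i \<Longrightarrow> ip n (u j) a = 0) \<Longrightarrow> form q n b a a \<le> lam i * ip n a a"
      by blast
    obtain w where w: "ip n w w = 1" "\<And>j. j < k \<Longrightarrow> ip n (u j) w = 0"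
      "\<And>a. (\<And>j. j < k \<Longrightarrow> ip n (u j) a = 0) \<Longrightarrow> form q n b a a \<le> form q n b w w * ip n a a"
      using rayleigh_maximiser[OF u(1), of q b] Suc.prems by auto
    have e: "form q n b a w = form q n b w w * ip n a w" for a
      by (rule rayleigh_eigenvector[OF u(1) u(2) w])
    show ?case
    proof (intro exI conjI allI impI)
      show "orthonormal n (Suc k) (u(k := w))" by (rule orthonormal_upd(1)[OF u(1) w(1,2)])
      fix i assume i: "i < Suc k"
      fix a
      show "form q n b a ((u(k := w)) i) = (lam(k := form q n b w w)) i * ip n a ((u(k := w)) i)"
        using i u(2)[of i a] e[of a] by (cases "i = k") simp_all
      assume "\<forall>j<i. ip n ((u(k := w)) j) a = 0"
      then have "ip n (u j) a = 0" if "j < i" for j using that i by (auto split: if_splits)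
      then show "form q n b a a \<le> (lam(k := form q n b w w)) i * ip n a a"
        using i u(3)[of i a] w(3)[of a] by (cases "i = k") simp_all
    qed
  qed
  from this[OF order_refl] obtain u lam where u: "orthonormal n n u"
      "\<And>i a. i < n \<Longrightarrow> form q n b a (u i) = lam i * ip n a (u i)"
      "\<And>i a. i < n \<Longrightarrow> (\<And>j. j < i \<Longrightarrow> ip n (u j) a = 0) \<Longrightarrow> form q n b a a \<le> lam i * ip n a a"
    by blast
  have lam: "form q n b (u i) (u i) = lam i" if "i < n" for i
    using u(2)[OF that, of "u i"] orthonormalD[OF u(1) that that] by simp
  \<comment> \<open>The eigenvalues are set to 0 from index \<open>n\<close> on, so that they are
    non-negative at every index.\<close>
  show thesis
  proof (rule that[of u "\<lambda>i. if i < n then lam i else 0"])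
    show "orthonormal n n u" by (rule u(1))
    show "form q n b a (u i) = (if i < n then lam i else 0) * ip n a (u i)" if "i < n" for i a
      using u(2) that by simp
    show "0 \<le> (if i < n then lam i else 0)" for i
      using lam[of i] form_nonneg[of q n b "u i"] by (cases "i < n") (simp_all del: form_nonneg)
    fix i j assume ij: "i \<le> j" "j < n"
    have "form q n b (u j) (u j) \<le> lam i * ip n (u j) (u j)"
      using ij by (intro u(3)) (auto simp: orthonormalD[OF u(1)])
    then show "(if j < n then lam j else 0) \<le> (if i < n then lam i else 0)"
      using ij orthonormalD[OF u(1), of j j] lam[of j] by simp
  qed
qed

text \<open>A vector that is not fixed would extend the family to \<open>n + 1\<close> orthonormal
  vectors in dimension \<open>n\<close>.\<close>

lemma fixed_by_basis: "orthonormal n n u \<Longrightarrow> fixed_by n n u a"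
  using orthonormal_extend(2)[of n n u a] orthonormal_le[of n "Suc n"] by fastforce

lemma form_spectral:
  assumes u: "orthonormal n n u" and eig: "\<And>i a. i < n \<Longrightarrow> form q n b a (u i) = lam i * ip n a (u i)"
  shows "form q n b a a = (\<Sum>k<n. lam k * (ip n (u k) a)\<^sup>2)"
proof -
  have "form q n b a a = form q n b (proj n n u a) a"
    using fixed_by_basis[OF u, of a] by (intro form_cong) (auto simp: fixed_by_def)
  also have "\<dots> = (\<Sum>k<n. ip n (u k) a * form q n b a (u k))"
    by (simp add: proj_def form_linear form_commute[of q n b a])
  also have "\<dots> = (\<Sum>k<n. lam k * (ip n (u k) a)\<^sup>2)"
    by (intro sum.cong) (auto simp: eig ip_commute[of n a] power2_eq_square)
  finally show ?thesis .
qed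

text \<open>Ky Fan's maximum principle. The weight \<open>c k\<close>, the squared length of the
  projection of \<open>u k\<close> onto the span of \<open>v\<close>, lies between 0 and 1, and the
  weights sum to \<open>r\<close>. Measured from the pivot \<open>lam (r - 1)\<close>, each index
  loses when the weights \<open>c\<close> replace the indicator of the first \<open>r\<close>
  indices.\<close>

lemma sum_form_le_top:
  assumes u: "orthonormal n n u" and eig: "\<And>i a. i < n \<Longrightarrow> form q n b a (u i) = lam i * ip n a (u i)"
    and dec: "\<And>i j. i \<le> j \<Longrightarrow> j < n \<Longrightarrow> lam j \<le> lam i"
    and v: "orthonormal n r v"
  shows "(\<Sum>j<r. form q n b (v j) (v j)) \<le> (\<Sum>k<r. lam k)"
proof (cases "r = 0")
  case False
  have rn: "r \<le> n" by (rule orthonormal_le[OF v])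
  define c where "c k = (\<Sum>j<r. (ip n (v j) (u k))\<^sup>2)" for k
  have c1: "c k \<le> 1" if "k < n" for k
    using bessel[OF v, of "u k"] orthonormalD[OF u that that] by (simp add: c_def)
  have c0: "c k \<ge> 0" for k by (simp add: c_def sum_nonneg)
  have "(\<Sum>k<n. c k) = (\<Sum>j<r. \<Sum>k<n. (ip n (u k) (v j))\<^sup>2)"
    unfolding c_def by (subst sum.swap) (simp add: ip_commute)
  also have "\<dots> = (\<Sum>j<r. ip n (v j) (v j))"
    by (intro sum.cong refl) (simp add: ip_fixed[OF fixed_by_basis[OF u], of "v _" "v _"] power2_eq_square)
  finally have csum: "(\<Sum>k<n. c k) = real r" using orthonormalD[OF v] by simp
  have "(\<Sum>j<r. form q n b (v j) (v j)) = (\<Sum>k<n. lam k * c k)"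
    by (subst form_spectral[OF u eig], simp, subst sum.swap)
      (simp add: c_def sum_distrib_left ip_commute)
  moreover have "(\<Sum>k<n. lam k * of_bool (k < r)) = (\<Sum>k<r. lam k)"
    using rn by (intro sum.mono_neutral_cong_right) auto
  moreover have "(\<Sum>k<n. of_bool (k < r) :: real) = real r"
    using rn by (subst sum.mono_neutral_cong_right[of _ "{..<r}" _ "\<lambda>_. 1"]) auto
  moreover have "(\<Sum>k<n. (lam k - lam (r - 1)) * (c k - of_bool (k < r))) \<le> 0"
  proof (rule sum_nonpos)
    fix k assume k: "k \<in> {..<n}"
    show "(lam k - lam (r - 1)) * (c k - of_bool (k < r)) \<le> 0"
    proof (cases "k < r")
      case True
      then show ?thesis using dec[of k "r - 1"] rn c1[of k] by (simp add: mult_nonneg_nonpos)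
    next
      case k': False
      then show ?thesis using dec[of "r - 1" k] k c0[of k] by (simp add: mult_nonpos_nonneg)
    qed
  qed
  moreover have "(\<Sum>k<n. (lam k - lam (r - 1)) * (c k - of_bool (k < r))) =
      (\<Sum>k<n. lam k * c k) - (\<Sum>k<n. lam k * of_bool (k < r))
        - lam (r - 1) * ((\<Sum>k<n. c k) - (\<Sum>k<n. of_bool (k < r)))"
    by (simp only: sum_subtractf[symmetric] sum_distrib_left) (simp only: algebra_simps)
  ultimately show ?thesis by (simp only: csum) simp
qed simp

section \<open>Singular values as eigenvalues of the Gram matrix, and the variational form of the Ky
  Fan norm\<close>

definition fmat :: "nat \<Rightarrow> nat \<Rightarrow> (nat \<Rightarrow> nat \<Rightarrow> real) \<Rightarrow> real mat" where
  "fmat q n b = mat q n (\<lambda>(i, l). b i l)"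

lemma fmat_carrier [simp]: "fmat q n b \<in> carrier_mat q n"
  and fmat_index [simp]: "i < q \<Longrightarrow> l < n \<Longrightarrow> fmat q n b $$ (i, l) = b i l"
  and dim_row_fmat [simp]: "dim_row (fmat q n b) = q"
  and dim_col_fmat [simp]: "dim_col (fmat q n b) = n"
  by (simp_all add: fmat_def)

lemma fmat_mult: "fmat m k a * fmat k n b = fmat m n (\<lambda>i j. \<Sum>l<k. a i l * b l j)"
  by (rule eq_matI) (auto simp: scalar_prod_def atLeast0LessThan)

lemma fmat_transpose: "transpose_mat (fmat m n a) = fmat n m (\<lambda>i j. a j i)"
  by (rule eq_matI) auto

lemma fmat_eqI: "(\<And>i j. i < m \<Longrightarrow> j < n \<Longrightarrow> a i j = b i j) \<Longrightarrow> fmat m n a = fmat m n b"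
  by (rule eq_matI) auto

lemma fmat_cases: "B \<in> carrier_mat q n \<Longrightarrow> B = fmat q n (\<lambda>i l. B $$ (i, l))"
  by (rule eq_matI) auto

lemma one_fmat: "1\<^sub>m n = fmat n n (\<lambda>i j. of_bool (i = j))"
  by (rule eq_matI) auto

lemma proots_linear_factors: "proots (\<Prod>a\<leftarrow>xs. [:- a, 1:]) = mset (xs :: 'a::idom list)"
proof (induction xs)
  case (Cons a xs)
  have "(\<Prod>a\<leftarrow>xs. [:- a, 1:]) \<noteq> (0 :: 'a poly)"
    by (auto simp: prod_list_zero_iff)
  then show ?case using Cons by (simp add: proots_mult del: mult_pCons_left)
qed simp

text \<open>The eigenbasis diagonalises the Gram matrix, and the characteristic polynomial is
  invariant under similarity.\<close>

lemma char_poly_gram: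
  assumes u: "orthonormal n n u"
    and eig: "\<And>i a. i < n \<Longrightarrow> form q n b a (u i) = lam i * ip n a (u i)"
  shows "char_poly (transpose_mat (fmat q n b) * fmat q n b) = (\<Prod>a\<leftarrow>map lam [0..<n]. [:- a, 1:])"
proof -
  define G where "G = transpose_mat (fmat q n b) * fmat q n b"
  define D where "D = fmat n n (\<lambda>i j. if i = j then lam i else 0)"
  define U where "U = fmat n n (\<lambda>l i. u i l)"
  have car: "G \<in> carrier_mat n n" "D \<in> carrier_mat n n" "U \<in> carrier_mat n n"
    "transpose_mat U \<in> carrier_mat n n"
    by (simp_all add: G_def D_def U_def fmat_transpose fmat_mult)
  have "transpose_mat U * U = 1\<^sub>m n"
    unfolding U_def fmat_transpose fmat_mult one_fmat
    by (rule fmat_eqI) (use u in \<open>simp add: orthonormal_def ip_def\<close>)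
  then have UU: "transpose_mat U * U = 1\<^sub>m n" "U * transpose_mat U = 1\<^sub>m n"
    using mat_mult_left_right_inverse[OF car(4,3)] by simp_all
  \<comment> \<open>Coordinate \<open>l\<close> of the Gram matrix applied to \<open>u i\<close> is
    \<open>form\<close> evaluated at the \<open>l\<close>-th unit vector and \<open>u i\<close>, so
    the weak eigenvector equation yields the one for matrices.\<close>
  have "(\<Sum>l'<n. (\<Sum>a<q. b a l * b a l') * u i l') = u i l * lam i" if "i < n" "l < n" for i l
  proof -
    have "(\<Sum>l'<n. (\<Sum>a<q. b a l * b a l') * u i l') = (\<Sum>a<q. b a l * ip n (b a) (u i))"
      unfolding ip_def sum_distrib_left sum_distrib_right
      by (subst sum.swap) (simp add: mult.assoc)
    also have "\<dots> = form q n b (\<lambda>l'. of_bool (l' = l)) (u i)"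
      using that by (simp add: form_def ip_delta_right ip_def[of q])
    also have "\<dots> = u i l * lam i" using that by (simp add: eig ip_delta_left)
    finally show ?thesis .
  qed
  then have "G * U = U * D"
    unfolding G_def U_def D_def fmat_transpose fmat_mult
    by (intro fmat_eqI) (simp add: if_distrib cong: if_cong)
  have "G = G * (U * transpose_mat U)" using car UU by simp
  also have "\<dots> = G * U * transpose_mat U" using car by (simp add: assoc_mult_mat[of _ n n _ n _ n])
  also have "\<dots> = U * D * transpose_mat U" by (simp add: \<open>G * U = U * D\<close>)
  finally have "similar_mat_wit G D U (transpose_mat U)"
    using car UU by (simp add: similar_mat_wit_def Let_def)
  then have "char_poly G = char_poly D"
    by (intro char_poly_similar) (auto simp: similar_mat_def)
  also have "\<dots> = (\<Prod>a\<leftarrow>diag_mat D. [:- a, 1:])"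
    using car(2) by (rule char_poly_upper_triangular) (auto simp: D_def upper_triangular_def)
  also have "diag_mat D = map lam [0..<n]"
    by (simp add: diag_mat_def D_def)
  finally show ?thesis by (simp add: G_def)
qed

lemma rev_sorted_list_of_mset: "sorted (rev xs) \<Longrightarrow> rev (sorted_list_of_multiset (mset xs)) = xs"
  by (metis mset_rev rev_rev_ident sorted_list_of_multiset_mset sorted_sort_id)

lemma singular_values_eq:
  assumes u: "orthonormal n n u"
    and eig: "\<And>i a. i < n \<Longrightarrow> form q n b a (u i) = lam i * ip n a (u i)"
    and dec: "\<And>i j. i \<le> j \<Longrightarrow> j < n \<Longrightarrow> lam j \<le> lam i"
  shows "singular_values (fmat q n b) = map (\<lambda>i. sqrt (lam i)) [0..<n]"
proof -
  have "sorted (rev (map (\<lambda>i. sqrt (lam i)) [0..<n]))"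
    by (auto simp: sorted_iff_nth_mono rev_nth intro!: dec)
  moreover have "image_mset sqrt (proots (char_poly (transpose_mat (fmat q n b) * fmat q n b))) =
      mset (map (\<lambda>i. sqrt (lam i)) [0..<n])"
    by (simp only: char_poly_gram[OF u eig] proots_linear_factors) (simp add: o_def multiset.map_comp)
  ultimately show ?thesis
    unfolding singular_values_def by (simp only: rev_sorted_list_of_mset)
qed

lemma ky_fan2_sq_eq:
  assumes u: "orthonormal n n u"
    and eig: "\<And>i a. i < n \<Longrightarrow> form q n b a (u i) = lam i * ip n a (u i)"
    and dec: "\<And>i j. i \<le> j \<Longrightarrow> j < n \<Longrightarrow> lam j \<le> lam i" and nn: "\<And>i. 0 \<le> lam i"
    and r: "r \<le> n"
  shows "(ky_fan2 r (fmat q n b))\<^sup>2 = (\<Sum>k<r. lam k)"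
proof -
  have "(\<Sum>k = 1..r. (sing_val (fmat q n b) k)\<^sup>2) = (\<Sum>k = 1..r. lam (k - 1))"
    using r nn by (intro sum.cong) (auto simp: sing_val_def singular_values_eq[OF u eig dec])
  also have "\<dots> = (\<Sum>k<r. lam k)"
    by (rule sum.reindex_bij_witness[of _ Suc "\<lambda>k. k - 1"]) auto
  finally show ?thesis using nn by (simp add: ky_fan2_def sum_nonneg)
qed

lemma ky_fan2_nonneg [simp]: "0 \<le> ky_fan2 r B"
  by (simp add: ky_fan2_def sum_nonneg)

lemma ky_fan2_0 [simp]: "ky_fan2 0 B = 0"
  by (simp add: ky_fan2_def)

text \<open>Together with \<open>ky_fan2_ge\<close> this says that the squared norm is a maximum
  over orthonormal families. The scaling rule, the Lipschitz bound and the comparisons with the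
  Frobenius norm follow from these two facts, without further use of eigenvalues.\<close>

lemma ky_fan2_attained:
  assumes "r \<le> n"
  obtains v where "orthonormal n r v"
    "(ky_fan2 r (fmat q n b))\<^sup>2 = (\<Sum>j<r. form q n b (v j) (v j))"
proof -
  obtain u lam where u: "orthonormal n n u"
    "\<And>i a. i < n \<Longrightarrow> form q n b a (u i) = lam i * ip n a (u i)"
    "\<And>i j. i \<le> j \<Longrightarrow> j < n \<Longrightarrow> lam j \<le> lam i" "\<And>i. 0 \<le> (lam i :: real)"
    using spectral_decomposition[where n = n and q = q and b = b] by blast
  show thesis
  proof (rule that)
    show "orthonormal n r u" by (rule orthonormal_mono[OF u(1) assms])
    have "form q n b (u j) (u j) = lam j" if "j < r" for j
      using u(2)[of j "u j"] orthonormalD[OF u(1), of j j] that assms by simp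
    then show "(ky_fan2 r (fmat q n b))\<^sup>2 = (\<Sum>j<r. form q n b (u j) (u j))"
      using ky_fan2_sq_eq[OF u assms] by simp
  qed
qed

lemma ky_fan2_ge:
  assumes v: "orthonormal n r v"
  shows "(\<Sum>j<r. form q n b (v j) (v j)) \<le> (ky_fan2 r (fmat q n b))\<^sup>2"
proof -
  obtain u lam where u: "orthonormal n n u"
    "\<And>i a. i < n \<Longrightarrow> form q n b a (u i) = lam i * ip n a (u i)"
    "\<And>i j. i \<le> j \<Longrightarrow> j < n \<Longrightarrow> lam j \<le> lam i" "\<And>i. 0 \<le> (lam i :: real)"
    using spectral_decomposition[where n = n and q = q and b = b] by blast
  show ?thesis
    using sum_form_le_top[OF u(1,2,3) v] ky_fan2_sq_eq[OF u orthonormal_le[OF v]] by simp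
qed

lemma ky_fan2_mono:
  assumes "r \<le> s"
  shows "ky_fan2 r B \<le> ky_fan2 s B"
  unfolding ky_fan2_def using assms by (intro real_sqrt_le_mono sum_mono2) auto

section \<open>Reduced-rank regression\<close>

lemma in_span_of_vec_span:
  fixes e :: "nat \<Rightarrow> nat \<Rightarrow> real"
  assumes "\<And>l. l < m \<Longrightarrow> a $ l = (\<Sum>i<k. c i * e i l)" "a \<in> carrier_vec m"
  shows "a \<in> LinearCombinations.module.span class_ring (module_vec TYPE(real) m) ((\<lambda>i. vec m (e i)) ` {..<k})"
proof -
  interpret vec_space "TYPE(real)" m .
  let ?E = "(\<lambda>i. vec m (e i)) ` {..<k}"
  have E: "?E \<subseteq> carrier_vec m" by auto
  have "vec m (\<lambda>l. \<Sum>i<j. c i * e i l) \<in> span ?E" if "j \<le> k" for j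
    using that
  proof (induction j)
    case 0
    have "vec m (\<lambda>l. \<Sum>i<0::nat. c i * e i l) = 0\<^sub>v m" by (rule eq_vecI) auto
    moreover have "0\<^sub>v m \<in> span ?E"
      by (rule in_spanI[of _ "\<lambda>_. 0" "{}"]) (auto simp: lincomb_def)
    ultimately show ?case by simp
  next
    case (Suc j)
    have "vec m (e j) \<in> span ?E" using Suc.prems in_own_span[OF E] by (auto simp: subset_iff)
    then have "c j \<cdot>\<^sub>v vec m (e j) \<in> span ?E" by (rule smult_in_span[OF E])
    with Suc have "vec m (\<lambda>l. \<Sum>i<j. c i * e i l) + c j \<cdot>\<^sub>v vec m (e j) \<in> span ?E"
      using span_add1[OF E] by simp
    also have "vec m (\<lambda>l. \<Sum>i<j. c i * e i l) + c j \<cdot>\<^sub>v vec m (e j) = vec m (\<lambda>l. \<Sum>i<Suc j. c i * e i l)"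
      by (rule eq_vecI) auto
    finally show ?case .
  qed
  moreover have "a = vec m (\<lambda>l. \<Sum>i<k. c i * e i l)" by (rule eq_vecI) (use assms in auto)
  ultimately show ?thesis by simp
qed

text \<open>The rank is the size of a maximal independent set \<open>S\<close> of columns. Steinitz
  exchange against the vectors \<open>e i\<close> gives \<open>card S \<le> k\<close>. Conversely
  every column depends on \<open>S\<close>, hence so does every \<open>e i\<close>, and
  \<open>orthonormal_card_le\<close> gives the other inequality.\<close>

lemma rank_eq_orthonormal_dim:
  assumes e: "orthonormal m k e" and sp: "\<And>i. i < k \<Longrightarrow> in_span m p (\<lambda>j i. x i j) (e i)"
    and fx: "\<And>j. j < p \<Longrightarrow> fixed_by m k e (\<lambda>i. x i j)"
  shows "mat_rank (fmat m p x) = k"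
proof -
  interpret vec_space "TYPE(real)" m .
  let ?X = "fmat m p x"
  let ?col = "\<lambda>j. vec m (\<lambda>i. x i j)"
  have cols: "set (cols ?X) = ?col ` {..<p}"
  proof -
    have "col ?X j = ?col j" if "j < p" for j using that by (intro eq_vecI) auto
    then show ?thesis by (auto simp: cols_def image_iff)
  qed
  obtain S where S: "maximal S (\<lambda>T. T \<subseteq> set (cols ?X) \<and> lin_indpt T)" "finite S"
    using maximal_exists_superset[of "set (cols ?X)" "\<lambda>T. T \<subseteq> set (cols ?X) \<and> lin_indpt T" "{}"]
      finite_lin_indpt2[of "{}"] by auto
  have rk: "rank ?X = card S" by (rule rank_card_indpt[where nc = p, OF _ S(1)]) simp
  have SX: "S \<subseteq> set (cols ?X)" "lin_indpt S" using S(1) by (auto simp: maximal_def)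
  then have Sc: "S \<subseteq> carrier_vec m" using cols by auto
  have "card S \<le> k"
  proof -
    let ?E = "(\<lambda>i. vec m (e i)) ` {..<k}"
    have "S \<subseteq> span ?E"
    proof
      fix s assume "s \<in> S"
      then obtain j where j: "j < p" "s = ?col j" using SX cols by auto
      show "s \<in> span ?E"
        using fx[OF j(1)] by (intro in_span_of_vec_span[where c = "\<lambda>a. ip m (e a) (\<lambda>i. x i j)"])
          (auto simp: j(2) fixed_by_def proj_def)
    qed
    moreover have "?E \<subseteq> carrier_vec m" by auto
    ultimately obtain C :: "real vec set" where "int (card C) \<le> int (card ?E) - int (card S)"
      using replacement[of S ?E] S(2) SX(2) by auto
    moreover have "card ?E \<le> k" using card_image_le[of "{..<k}" "\<lambda>i. vec m (e i)"] by simp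
    ultimately show ?thesis by linarith
  qed
  moreover have "k \<le> card S"
  proof -
    obtain f where f: "bij_betw f {..<card S} S"
      using ex_bij_betw_nat_finite[OF S(2)] by (auto simp: atLeast0LessThan)
    have "in_span m (card S) (\<lambda>j i. f j $ i) (\<lambda>i. x i j)" if j: "j < p" for j
    proof -
      have "?col j \<in> span S"
      proof (cases "?col j \<in> S")
        case True
        then show ?thesis using in_own_span Sc by auto
      next
        case False
        have "\<not> lin_indpt (S \<union> {?col j})"
        proof
          assume "lin_indpt (S \<union> {?col j})"
          then have "S \<union> {?col j} = S"
            using S(1) SX(1) j cols unfolding maximal_def by (metis (no_types, lifting)
              Un_upper1 image_eqI insert_subset lessThan_iff Un_insert_right sup_bot_right)
          then show False using False by auto
        qed
        then show ?thesis
          using lin_dep_iff_in_span[of S "?col j"] Sc SX(2) False by auto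
      qed
      then obtain a where a: "lincomb a S = ?col j" using finite_in_span[OF S(2)] Sc by auto
      have "x l j = (\<Sum>i<card S. a (f i) * f i $ l)" if l: "l < m" for l
      proof -
        have "x l j = lincomb a S $ l" using a l by simp
        also have "\<dots> = (\<Sum>s\<in>S. a s * s $ l)" by (rule lincomb_index[OF l Sc])
        also have "\<dots> = (\<Sum>i<card S. a (f i) * f i $ l)"
          by (rule sum.reindex_bij_betw[OF f, symmetric])
        finally show ?thesis .
      qed
      then show ?thesis unfolding in_span_def by (intro exI[of _ "\<lambda>i. a (f i)"]) simp
    qed
    then have "in_span m (card S) (\<lambda>j i. f j $ i) (e i)" if "i < k" for i
      using sp[OF that] in_span_comb[of p m "card S" _ "\<lambda>j i. x i j" "e i"]
      by (auto simp: in_span_def[of m p])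
    then show ?thesis by (rule orthonormal_card_le[OF e])
  qed
  ultimately show ?thesis using rk by simp
qed

lemma column_basis:
  obtains e where "orthonormal m (mat_rank (fmat m p x)) e"
    "\<And>i. i < mat_rank (fmat m p x) \<Longrightarrow> in_span m p (\<lambda>j i. x i j) (e i)"
    "\<And>j. j < p \<Longrightarrow> fixed_by m (mat_rank (fmat m p x)) e (\<lambda>i. x i j)"
proof -
  obtain k e where e: "orthonormal m k e" "\<And>i. i < k \<Longrightarrow> in_span m p (\<lambda>j i. x i j) (e i)"
    "\<And>j. j < p \<Longrightarrow> fixed_by m k e (\<lambda>i. x i j)"
    using gram_schmidt[of p m "\<lambda>j i. x i j"] by blast
  then show thesis using that[of e] rank_eq_orthonormal_dim[OF e] by simp
qed

section \<open>Ky Fan norms compared with the Frobenius norm\<close>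

lemma frob_norm_fmat: "frob_norm (fmat q n b) = sqrt (\<Sum>i<q. \<Sum>l<n. (b i l)\<^sup>2)"
  by (simp add: frob_norm_def)

lemma frob_norm_sq: "(frob_norm (fmat q n b))\<^sup>2 = (\<Sum>i<q. ip n (b i) (b i))"
  by (simp add: frob_norm_fmat sum_nonneg ip_self)

lemma frob_norm_nonneg [simp]: "0 \<le> frob_norm B"
  by (simp add: frob_norm_def sum_nonneg)

lemma sum_form_eq: "(\<Sum>j<r. form q n b (v j) (v j)) = (\<Sum>i<q. \<Sum>j<r. (ip n (v j) (b i))\<^sup>2)"
  unfolding form_def ip_self by (subst sum.swap) (simp add: ip_commute)

lemma ky_fan2_le_frob:
  assumes "r \<le> n"
  shows "ky_fan2 r (fmat q n b) \<le> frob_norm (fmat q n b)"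
proof -
  obtain v where v: "orthonormal n r v"
    "(ky_fan2 r (fmat q n b))\<^sup>2 = (\<Sum>j<r. form q n b (v j) (v j))"
    using ky_fan2_attained[OF assms] by blast
  have "(ky_fan2 r (fmat q n b))\<^sup>2 \<le> (frob_norm (fmat q n b))\<^sup>2"
    unfolding v(2) sum_form_eq frob_norm_sq by (intro sum_mono bessel[OF v(1)])
  then show ?thesis by (rule power2_le_imp_le) simp
qed

text \<open>The variational bound for families on the left. The \<open>r\<close> rows
  \<open>c j\<close>, that is \<open>u j\<close> times the matrix, lie in the span of some
  orthonormal \<open>v'\<close> with exactly \<open>r\<close> members. Parseval in \<open>v'\<close>
  rewrites their square sum through the inner products of \<open>u j\<close> with the images of
  \<open>v' k\<close>, and Bessel in \<open>u\<close> bounds it by the form on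
  \<open>v'\<close>.\<close>

lemma ky_fan2_ge_left:
  assumes u: "orthonormal q r u" and r: "r \<le> n"
  shows "(\<Sum>j<r. \<Sum>l<n. (\<Sum>i<q. u j i * b i l)\<^sup>2) \<le> (ky_fan2 r (fmat q n b))\<^sup>2"
proof -
  define c where "c j l = (\<Sum>i<q. u j i * b i l)" for j l
  obtain k v where kv: "k \<le> r" "orthonormal n k v" "\<And>j. j < r \<Longrightarrow> fixed_by n k v (c j)"
    using gram_schmidt[of r n c] by blast
  obtain v' where v': "orthonormal n r v'" "\<And>b. fixed_by n k v b \<Longrightarrow> fixed_by n r v' b"
    using orthonormal_complete[OF kv(2,1) r] by blast
  have fx: "fixed_by n r v' (c j)" if "j < r" for j using kv(3) v'(2) that by blast
  have ipc: "ip n (v' k) (c j) = ip q (u j) (\<lambda>i. ip n (b i) (v' k))" for j k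
    unfolding c_def by (simp add: ip_linear ip_commute[of n "v' k"]) (simp add: ip_def[of q])
  have "(\<Sum>j<r. \<Sum>l<n. (c j l)\<^sup>2) = (\<Sum>j<r. \<Sum>k<r. (ip q (u j) (\<lambda>i. ip n (b i) (v' k)))\<^sup>2)"
  proof (rule sum.cong[OF refl])
    fix j assume "j \<in> {..<r}"
    then have "ip n (c j) (c j) = (\<Sum>k<r. (ip n (v' k) (c j))\<^sup>2)"
      using ip_fixed[OF fx, of j "c j"] by (simp add: power2_eq_square)
    then show "(\<Sum>l<n. (c j l)\<^sup>2) = (\<Sum>k<r. (ip q (u j) (\<lambda>i. ip n (b i) (v' k)))\<^sup>2)"
      by (simp only: ip_self ipc)
  qed
  also have "\<dots> \<le> (\<Sum>k<r. form q n b (v' k) (v' k))"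
    unfolding form_def by (subst sum.swap) (intro sum_mono bessel[OF u])
  also have "\<dots> \<le> (ky_fan2 r (fmat q n b))\<^sup>2" by (rule ky_fan2_ge[OF v'(1)])
  finally show ?thesis by (simp add: c_def)
qed

lemma orthonormal_delta: "r \<le> n \<Longrightarrow> orthonormal n r (\<lambda>j l. of_bool (l = j))"
  by (auto simp: orthonormal_def ip_delta_right)

lemma ky_fan2_ge_columns:
  assumes "r \<le> n"
  shows "(\<Sum>i<q. \<Sum>l<r. (b i l)\<^sup>2) \<le> (ky_fan2 r (fmat q n b))\<^sup>2"
  using ky_fan2_ge[OF orthonormal_delta[OF assms], of q b] assms
  by (simp add: sum_form_eq ip_delta_left)

lemma ky_fan2_ge_rows:
  assumes "r \<le> n" "r \<le> q"
  shows "(\<Sum>i<r. \<Sum>l<n. (b i l)\<^sup>2) \<le> (ky_fan2 r (fmat q n b))\<^sup>2"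
  using ky_fan2_ge_left[OF orthonormal_delta[OF assms(2)] assms(1), of b] assms(2)
  by (simp add: ip_def[symmetric] ip_delta_left)

text \<open>The lower bound uses unit vectors on the shorter side of the matrix: columns if
  \<open>n \<le> q\<close>, rows otherwise.\<close>

lemma ky_fan2_full: "ky_fan2 (min n q) (fmat q n b) = frob_norm (fmat q n b)"
proof (rule antisym)
  show "ky_fan2 (min n q) (fmat q n b) \<le> frob_norm (fmat q n b)"
    by (rule ky_fan2_le_frob) simp
  have "(frob_norm (fmat q n b))\<^sup>2 \<le> (ky_fan2 (min n q) (fmat q n b))\<^sup>2"
    using ky_fan2_ge_columns[of "min n q" n b q] ky_fan2_ge_rows[of "min n q" n q b]
    by (cases "n \<le> q") (simp_all add: frob_norm_sq ip_self min_def)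
  then show "frob_norm (fmat q n b) \<le> ky_fan2 (min n q) (fmat q n b)"
    by (rule power2_le_imp_le) simp
qed

text \<open>With the family \<open>v\<close> fixed as the optimal one for \<open>b\<close>, the norm
  of \<open>b\<close> is the Euclidean norm of an array linear in \<open>b\<close>, so the triangle
  inequality applies. For \<open>c\<close> and for the difference \<open>v\<close> is a mere
  competitor, which is the right direction.\<close>

lemma ky_fan2_lipschitz:
  assumes r: "r \<le> n"
  shows "ky_fan2 r (fmat q n b) \<le> ky_fan2 r (fmat q n c) + frob_norm (fmat q n (\<lambda>i l. b i l - c i l))"
proof -
  let ?N = "\<lambda>b. ky_fan2 r (fmat q n b)"
  let ?d = "\<lambda>i l. b i l - c i l"
  obtain v where v: "orthonormal n r v" "(?N b)\<^sup>2 = (\<Sum>j<r. form q n b (v j) (v j))"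
    using ky_fan2_attained[OF r] by blast
  let ?I = "{..<q} \<times> {..<r}"
  let ?f = "\<lambda>b (i, j). ip n (v j) (b i)"
  have L2: "(L2_set (?f b) ?I)\<^sup>2 = (\<Sum>j<r. form q n b (v j) (v j))" for b
    unfolding L2_set_def sum_form_eq
    by (subst real_sqrt_pow2) (auto intro!: sum_nonneg simp: sum.cartesian_product split_def)
  have le: "L2_set (?f b) ?I \<le> ?N b" for b
  proof (rule power2_le_imp_le)
    show "(L2_set (?f b) ?I)\<^sup>2 \<le> (?N b)\<^sup>2" unfolding L2 by (rule ky_fan2_ge[OF v(1)])
  qed simp
  have "?N b = L2_set (?f b) ?I"
    by (rule power2_eq_imp_eq) (simp_all only: v(2) L2 L2_set_nonneg ky_fan2_nonneg)
  also have "?f b = (\<lambda>x. ?f c x + ?f ?d x)" by (auto simp: ip_linear)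
  also have "L2_set (\<lambda>x. ?f c x + ?f ?d x) ?I \<le> L2_set (?f c) ?I + L2_set (?f ?d) ?I"
    by (rule L2_set_triangle_ineq)
  also have "\<dots> \<le> ?N c + ?N ?d" using le[of c] le[of ?d] by linarith
  also have "?N ?d \<le> frob_norm (fmat q n ?d)" by (rule ky_fan2_le_frob[OF r])
  finally show ?thesis by simp
qed

lemma ky_fan2_scale:
  assumes r: "r \<le> n"
  shows "(ky_fan2 r (fmat q n (\<lambda>i l. s * b i l)))\<^sup>2 = s\<^sup>2 * (ky_fan2 r (fmat q n b))\<^sup>2"
proof (rule antisym)
  have f: "form q n (\<lambda>i l. s * b i l) a a = s\<^sup>2 * form q n b a a" for a
    by (simp add: form_def ip_linear power2_eq_square)
  obtain v where v: "orthonormal n r v"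
    "(ky_fan2 r (fmat q n (\<lambda>i l. s * b i l)))\<^sup>2 = (\<Sum>j<r. form q n (\<lambda>i l. s * b i l) (v j) (v j))"
    using ky_fan2_attained[OF r] by blast
  show "(ky_fan2 r (fmat q n (\<lambda>i l. s * b i l)))\<^sup>2 \<le> s\<^sup>2 * (ky_fan2 r (fmat q n b))\<^sup>2"
    unfolding v(2) f sum_distrib_left[symmetric]
    by (intro mult_left_mono ky_fan2_ge[OF v(1)]) simp
  obtain v where v: "orthonormal n r v" "(ky_fan2 r (fmat q n b))\<^sup>2 = (\<Sum>j<r. form q n b (v j) (v j))"
    using ky_fan2_attained[OF r] by blast
  show "s\<^sup>2 * (ky_fan2 r (fmat q n b))\<^sup>2 \<le> (ky_fan2 r (fmat q n (\<lambda>i l. s * b i l)))\<^sup>2"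
    unfolding v(2) sum_distrib_left f[symmetric] by (rule ky_fan2_ge[OF v(1)])
qed

section \<open>The Eckart-Young problem in orthonormal coordinates\<close>

lemma row_basis:
  fixes B :: "nat \<Rightarrow> nat \<Rightarrow> real"
  assumes rk: "mat_rank (fmat p n B) \<le> r" and r: "r \<le> n"
  obtains v where "orthonormal n r v" "\<And>j. j < p \<Longrightarrow> fixed_by n r v (B j)"
proof -
  let ?k = "mat_rank (fmat p n B)"
  obtain e where e: "orthonormal p ?k e" "\<And>l. l < n \<Longrightarrow> fixed_by p ?k e (\<lambda>j. B j l)"
    using column_basis[of p n B] by metis
  \<comment> \<open>The coordinates of the columns in \<open>e\<close> form \<open>?k\<close> row
    vectors whose combinations give every row of \<open>B\<close>; hence the row space has dimension
    at most the column rank.\<close>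
  define R where "R i l = ip p (e i) (\<lambda>j. B j l)" for i l
  obtain k' v where v: "k' \<le> ?k" "orthonormal n k' v" "\<And>j. j < ?k \<Longrightarrow> fixed_by n k' v (R j)"
    using gram_schmidt[of ?k n R] by blast
  obtain v' where v': "orthonormal n r v'" "\<And>b. fixed_by n k' v b \<Longrightarrow> fixed_by n r v' b"
    using orthonormal_complete[OF v(2), of r] v(1) rk r by auto
  have "fixed_by n r v' (B j)" if j: "j < p" for j
  proof -
    have "fixed_by n r v' (\<lambda>l. \<Sum>i<?k. e i j * R i l)"
      by (rule fixed_by_sum) (use v(3) v'(2) in auto)
    moreover have "(\<Sum>i<?k. e i j * R i l) = B j l" if "l < n" for l
      using e(2)[OF that] j by (simp add: fixed_by_def proj_def R_def mult.commute)
    ultimately show ?thesis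
      by (subst fixed_by_cong[of n "B j" "\<lambda>l. \<Sum>i<?k. e i j * R i l"]) simp_all
  qed
  then show thesis using that v'(1) by blast
qed

text \<open>Pythagoras twice: first in each column with the basis \<open>e\<close>, then in each row
  of coordinates with the family \<open>v\<close>. For \<open>z\<close> of the form design times
  coefficients, \<open>e\<close> spans the columns of the design and \<open>v\<close> the rows of
  the coefficients.\<close>

lemma residual_identity:
  fixes y z :: "nat \<Rightarrow> nat \<Rightarrow> real"
  assumes e: "orthonormal m k e" and v: "orthonormal n r v"
    and cols: "\<And>l. l < n \<Longrightarrow> fixed_by m k e (\<lambda>i. z i l)"
    and rows: "\<And>i. i < m \<Longrightarrow> fixed_by n r v (z i)"
  defines "C \<equiv> \<lambda>a l. \<Sum>i<m. e a i * y i l" and "Z \<equiv> \<lambda>a l. \<Sum>i<m. e a i * z i l"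
  shows "(\<Sum>i<m. \<Sum>l<n. (y i l - z i l)\<^sup>2) = (\<Sum>i<m. \<Sum>l<n. (y i l)\<^sup>2)
      - (\<Sum>j<r. form k n C (v j) (v j)) + (\<Sum>a<k. \<Sum>j<r. (ip n (v j) (C a) - ip n (v j) (Z a))\<^sup>2)"
    and "(\<Sum>i<m. \<Sum>l<n. (z i l)\<^sup>2) = (\<Sum>a<k. \<Sum>j<r. (ip n (v j) (Z a))\<^sup>2)"
proof -
  have C: "ip m (e a) (\<lambda>i. y i l) = C a l" and Z: "ip m (e a) (\<lambda>i. z i l) = Z a l" for a l
    by (simp_all add: C_def Z_def ip_def)
  have fZ: "fixed_by n r v (Z a)" for a
    unfolding Z_def by (rule fixed_by_sum) (use rows in auto)
  have col: "(\<Sum>i<m. (y i l - z i l)\<^sup>2) =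
      (\<Sum>i<m. (y i l)\<^sup>2) - (\<Sum>a<k. (C a l)\<^sup>2) + (\<Sum>a<k. (C a l - Z a l)\<^sup>2)" if "l < n" for l
    using ip_residual[OF e cols[OF that], of "\<lambda>i. y i l"] by (simp only: C Z ip_self)
  have row: "(\<Sum>l<n. (C a l - Z a l)\<^sup>2) = (\<Sum>l<n. (C a l)\<^sup>2) - (\<Sum>j<r. (ip n (v j) (C a))\<^sup>2)
      + (\<Sum>j<r. (ip n (v j) (C a) - ip n (v j) (Z a))\<^sup>2)" for a
    using ip_residual[OF v fZ, of "C a"] by (simp only: ip_self)
  have "(\<Sum>i<m. \<Sum>l<n. (y i l - z i l)\<^sup>2) = (\<Sum>l<n. \<Sum>i<m. (y i l - z i l)\<^sup>2)"
    by (rule sum.swap)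
  also have "\<dots> = (\<Sum>l<n. \<Sum>i<m. (y i l)\<^sup>2) - (\<Sum>l<n. \<Sum>a<k. (C a l)\<^sup>2) + (\<Sum>l<n. \<Sum>a<k. (C a l - Z a l)\<^sup>2)"
    by (simp add: col sum.distrib sum_subtractf)
  also have "(\<Sum>l<n. \<Sum>a<k. (C a l - Z a l)\<^sup>2) = (\<Sum>a<k. \<Sum>l<n. (C a l - Z a l)\<^sup>2)"
    by (rule sum.swap)
  also have "\<dots> = (\<Sum>a<k. \<Sum>l<n. (C a l)\<^sup>2) - (\<Sum>a<k. \<Sum>j<r. (ip n (v j) (C a))\<^sup>2)
      + (\<Sum>a<k. \<Sum>j<r. (ip n (v j) (C a) - ip n (v j) (Z a))\<^sup>2)"
    by (simp add: row sum.distrib sum_subtractf)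
  also have "(\<Sum>l<n. \<Sum>a<k. (C a l)\<^sup>2) = (\<Sum>a<k. \<Sum>l<n. (C a l)\<^sup>2)" by (rule sum.swap)
  also have "(\<Sum>l<n. \<Sum>i<m. (y i l)\<^sup>2) = (\<Sum>i<m. \<Sum>l<n. (y i l)\<^sup>2)" by (rule sum.swap)
  finally show "(\<Sum>i<m. \<Sum>l<n. (y i l - z i l)\<^sup>2) = (\<Sum>i<m. \<Sum>l<n. (y i l)\<^sup>2)
      - (\<Sum>j<r. form k n C (v j) (v j)) + (\<Sum>a<k. \<Sum>j<r. (ip n (v j) (C a) - ip n (v j) (Z a))\<^sup>2)"
    by (simp add: sum_form_eq)
  have "(\<Sum>i<m. \<Sum>l<n. (z i l)\<^sup>2) = (\<Sum>l<n. \<Sum>i<m. (z i l)\<^sup>2)" by (rule sum.swap)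
  also have "\<dots> = (\<Sum>l<n. \<Sum>a<k. (Z a l)\<^sup>2)"
  proof (rule sum.cong[OF refl])
    fix l assume "l \<in> {..<n}"
    then have "ip m (\<lambda>i. z i l) (\<lambda>i. z i l) = (\<Sum>a<k. (ip m (e a) (\<lambda>i. z i l))\<^sup>2)"
      using ip_fixed[OF cols, of l "\<lambda>i. z i l"] by (simp add: power2_eq_square)
    then show "(\<Sum>i<m. (z i l)\<^sup>2) = (\<Sum>a<k. (Z a l)\<^sup>2)" by (simp only: ip_self Z)
  qed
  also have "\<dots> = (\<Sum>a<k. \<Sum>l<n. (Z a l)\<^sup>2)" by (rule sum.swap)
  also have "\<dots> = (\<Sum>a<k. \<Sum>j<r. (ip n (v j) (Z a))\<^sup>2)"
  proof (rule sum.cong[OF refl])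
    fix a
    have "ip n (Z a) (Z a) = (\<Sum>j<r. (ip n (v j) (Z a))\<^sup>2)"
      using ip_fixed[OF fZ, of "Z a" a] by (simp add: power2_eq_square)
    then show "(\<Sum>l<n. (Z a l)\<^sup>2) = (\<Sum>j<r. (ip n (v j) (Z a))\<^sup>2)" by (simp only: ip_self)
  qed
  finally show "(\<Sum>i<m. \<Sum>l<n. (z i l)\<^sup>2) = (\<Sum>a<k. \<Sum>j<r. (ip n (v j) (Z a))\<^sup>2)" .
qed

lemma frob_norm_residual_sq:
  "(frob_norm (fmat m n y - fmat m p x * fmat p n B))\<^sup>2 =
    (\<Sum>i<m. \<Sum>l<n. (y i l - (\<Sum>j<p. x i j * B j l))\<^sup>2)"
proof -
  have "fmat m n y - fmat m p x * fmat p n B = fmat m n (\<lambda>i l. y i l - (\<Sum>j<p. x i j * B j l))"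
    unfolding fmat_mult by (rule eq_matI) auto
  then show ?thesis by (simp add: frob_norm_sq ip_self)
qed

text \<open>The reduced-rank regression problem is the Eckart--Young problem for the coordinates
  of the response in an orthonormal basis of the column space of the design.\<close>

lemma low_rank_fit_upper:
  fixes x y :: "nat \<Rightarrow> nat \<Rightarrow> real"
  assumes e: "orthonormal m k e" and sp: "\<And>i. i < k \<Longrightarrow> in_span m p (\<lambda>j i. x i j) (e i)"
    and r: "r \<le> n"
  defines "C \<equiv> \<lambda>a l. \<Sum>i<m. e a i * y i l"
  shows "\<exists>B. mat_rank (fmat p n B) \<le> r \<and>
    (frob_norm (fmat m n y - fmat m p x * fmat p n B))\<^sup>2 =
      (\<Sum>i<m. \<Sum>l<n. (y i l)\<^sup>2) - (ky_fan2 r (fmat k n C))\<^sup>2"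
proof -
  obtain v where v: "orthonormal n r v"
    "(ky_fan2 r (fmat k n C))\<^sup>2 = (\<Sum>j<r. form k n C (v j) (v j))"
    using ky_fan2_attained[OF r] by blast
  \<comment> \<open>These coefficients express the basis of the column space through the design, so
    that a matrix prescribed in the coordinates \<open>e\<close> can be written as the design times
    some \<open>B\<close>.\<close>
  obtain w where w: "\<And>a i. a < k \<Longrightarrow> i < m \<Longrightarrow> e a i = (\<Sum>j<p. w a j * x i j)"
    using sp unfolding in_span_def by metis
  define P where "P a = proj n r v (C a)" for a
  define B where "B j l = (\<Sum>a<k. w a j * P a l)" for j l
  define z where "z i l = (\<Sum>j<p. x i j * B j l)" for i l
  have z: "z i l = (\<Sum>a<k. P a l * e a i)" if "i < m" for i l
  proof -
    have "z i l = (\<Sum>a<k. \<Sum>j<p. P a l * (w a j * x i j))"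
      unfolding z_def B_def sum_distrib_left by (subst sum.swap) (simp add: algebra_simps)
    also have "\<dots> = (\<Sum>a<k. P a l * e a i)"
      using that by (simp add: w sum_distrib_left)
    finally show ?thesis .
  qed
  have cols: "fixed_by m k e (\<lambda>i. z i l)" for l
    by (subst fixed_by_cong[where b = "\<lambda>i. \<Sum>a<k. P a l * e a i"])
      (simp_all add: z fixed_by_comb[OF e])
  have rows: "fixed_by n r v (z i)" if "i < m" for i
  proof -
    have "fixed_by n r v (\<lambda>l. \<Sum>a<k. e a i * P a l)"
      by (rule fixed_by_sum) (simp add: P_def fixed_by_proj[OF v(1)])
    also have "(\<lambda>l. \<Sum>a<k. e a i * P a l) = z i" using z[OF that] by (simp add: fun_eq_iff mult.commute)
    finally show ?thesis .
  qed
  have Z: "(\<Sum>i<m. e a i * z i l) = P a l" if "a < k" for a l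
  proof -
    have "(\<Sum>i<m. e a i * z i l) = ip m (e a) (\<lambda>i. \<Sum>a<k. P a l * e a i)"
      by (simp add: ip_def z)
    then show ?thesis using ip_comb[OF e that, of "\<lambda>a. P a l"] by simp
  qed
  have "(\<Sum>i<m. \<Sum>l<n. (y i l - z i l)\<^sup>2) =
      (\<Sum>i<m. \<Sum>l<n. (y i l)\<^sup>2) - (ky_fan2 r (fmat k n C))\<^sup>2"
  proof -
    have "(\<Sum>a<k. \<Sum>j<r. (ip n (v j) (C a) - ip n (v j) (\<lambda>l. \<Sum>i<m. e a i * z i l))\<^sup>2) = 0"
      by (intro sum.neutral ballI) (simp add: Z P_def[symmetric] ip_proj[OF v(1)] del: z_def, simp add: P_def ip_proj[OF v(1)])
    then show ?thesis
      using residual_identity(1)[OF e v(1) cols rows, of y] v(2) by (simp add: C_def)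
  qed
  then have res: "(frob_norm (fmat m n y - fmat m p x * fmat p n B))\<^sup>2 =
      (\<Sum>i<m. \<Sum>l<n. (y i l)\<^sup>2) - (ky_fan2 r (fmat k n C))\<^sup>2"
    by (simp add: frob_norm_residual_sq z_def)
  let ?rk = "mat_rank (fmat p n B)"
  obtain f where f: "orthonormal p ?rk f" "\<And>i. i < ?rk \<Longrightarrow> in_span p n (\<lambda>l j. B j l) (f i)"
    using column_basis[of p n B] by metis
  \<comment> \<open>\<open>B\<close> factors through dimension \<open>r\<close>: its columns are
    combinations of the vectors \<open>s b\<close>, with coefficients taken from
    \<open>v\<close>.\<close>
  define s where "s b j = (\<Sum>a<k. w a j * ip n (v b) (C a))" for b j
  have "B j l = (\<Sum>b<r. v b l * s b j)" for j l
    unfolding B_def P_def proj_def s_def sum_distrib_left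
    by (subst sum.swap) (simp add: algebra_simps)
  then have "in_span p r s (\<lambda>j. B j l)" for l
    unfolding in_span_def by (intro exI[of _ "\<lambda>b. v b l"]) simp
  then have "in_span p r s (f i)" if "i < ?rk" for i
    using f(2)[OF that] in_span_comb[of n p r s "\<lambda>l j. B j l" "f i"] by (auto simp: in_span_def[of p n])
  then have "?rk \<le> r" by (rule orthonormal_card_le[OF f(1)])
  then show ?thesis using res by blast
qed

text \<open>The residual of a minimiser is squeezed. By the residual identity it is the norm of
  \<open>y\<close> minus a form sum, plus a defect \<open>D \<ge> 0\<close>; the form sum is at most
  the squared Ky Fan norm, and a competitor reaches equality. So \<open>D = 0\<close> and the form
  sum is maximal. The first equation determines the fitted coordinates and thereby the norm of the
  fit, which is thus the same for all minimisers.\<close>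

theorem low_rank_fit_norms:
  fixes x y :: "nat \<Rightarrow> nat \<Rightarrow> real"
  assumes e: "orthonormal m k e" and sp: "\<And>i. i < k \<Longrightarrow> in_span m p (\<lambda>j i. x i j) (e i)"
    and fx: "\<And>j. j < p \<Longrightarrow> fixed_by m k e (\<lambda>i. x i j)"
    and r: "r \<le> n" and fit: "low_rank_fit (fmat m p x) (fmat m n y) r A"
  defines "C \<equiv> \<lambda>a l. \<Sum>i<m. e a i * y i l"
  shows "(frob_norm (fmat m n y - fmat m p x * A))\<^sup>2 =
      (frob_norm (fmat m n y))\<^sup>2 - (ky_fan2 r (fmat k n C))\<^sup>2"
    and "(frob_norm (fmat m p x * A))\<^sup>2 = (ky_fan2 r (fmat k n C))\<^sup>2"
proof -
  define B where "B j l = A $$ (j, l)" for j l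
  have "A \<in> carrier_mat p n" and rk: "mat_rank A \<le> r"
    using fit by (auto simp: low_rank_fit_def is_arg_min_def)
  then have A: "A = fmat p n B" unfolding B_def by (intro fmat_cases)
  obtain B' where B': "mat_rank (fmat p n B') \<le> r"
    "(frob_norm (fmat m n y - fmat m p x * fmat p n B'))\<^sup>2 =
      (\<Sum>i<m. \<Sum>l<n. (y i l)\<^sup>2) - (ky_fan2 r (fmat k n C))\<^sup>2"
    using low_rank_fit_upper[OF e sp r, of y] unfolding C_def by blast
  have "frob_norm (fmat m n y - fmat m p x * A) \<le> frob_norm (fmat m n y - fmat m p x * fmat p n B')"
    using fit B'(1) by (auto simp: low_rank_fit_def is_arg_min_linorder)
  then have up: "(frob_norm (fmat m n y - fmat m p x * A))\<^sup>2 \<le>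
      (\<Sum>i<m. \<Sum>l<n. (y i l)\<^sup>2) - (ky_fan2 r (fmat k n C))\<^sup>2"
    unfolding B'(2)[symmetric] by (intro power_mono) auto
  obtain v where v: "orthonormal n r v" "\<And>j. j < p \<Longrightarrow> fixed_by n r v (B j)"
    using row_basis[of p n B r] rk r A by metis
  define z where "z i l = (\<Sum>j<p. x i j * B j l)" for i l
  have cols: "fixed_by m k e (\<lambda>i. z i l)" for l
  proof -
    have "fixed_by m k e (\<lambda>i. \<Sum>j<p. B j l * x i j)"
      by (rule fixed_by_sum) (use fx in auto)
    then show ?thesis by (simp add: z_def mult.commute)
  qed
  have rows: "fixed_by n r v (z i)" for i
    unfolding z_def by (rule fixed_by_sum) (use v(2) in auto)
  define Z where "Z a l = (\<Sum>i<m. e a i * z i l)" for a l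
  define D where "D = (\<Sum>a<k. \<Sum>j<r. (ip n (v j) (C a) - ip n (v j) (Z a))\<^sup>2)"
  have lo: "(frob_norm (fmat m n y - fmat m p x * A))\<^sup>2 =
      (\<Sum>i<m. \<Sum>l<n. (y i l)\<^sup>2) - (\<Sum>j<r. form k n C (v j) (v j)) + D"
    unfolding A frob_norm_residual_sq z_def[symmetric]
    using residual_identity(1)[OF e v(1) cols rows, of y] by (simp add: C_def Z_def[abs_def] D_def)
  have ge: "(\<Sum>j<r. form k n C (v j) (v j)) \<le> (ky_fan2 r (fmat k n C))\<^sup>2"
    by (rule ky_fan2_ge[OF v(1)])
  have D0: "D \<ge> 0" unfolding D_def by (intro sum_nonneg) auto
  have D: "D = 0" and kf: "(\<Sum>j<r. form k n C (v j) (v j)) = (ky_fan2 r (fmat k n C))\<^sup>2"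
    using up lo ge D0 by linarith+
  show "(frob_norm (fmat m n y - fmat m p x * A))\<^sup>2 =
      (frob_norm (fmat m n y))\<^sup>2 - (ky_fan2 r (fmat k n C))\<^sup>2"
    unfolding lo D kf frob_norm_sq ip_self by simp
  have eq: "ip n (v j) (C a) = ip n (v j) (Z a)" if "a < k" "j < r" for a j
  proof -
    have "\<forall>a\<in>{..<k}. (\<Sum>j<r. (ip n (v j) (C a) - ip n (v j) (Z a))\<^sup>2) = 0"
      using D unfolding D_def by (subst (asm) sum_nonneg_eq_0_iff) (auto intro: sum_nonneg)
    then have "(\<Sum>j<r. (ip n (v j) (C a) - ip n (v j) (Z a))\<^sup>2) = 0" using that by simp
    then have "\<forall>j\<in>{..<r}. (ip n (v j) (C a) - ip n (v j) (Z a))\<^sup>2 = 0"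
      by (subst (asm) sum_nonneg_eq_0_iff) auto
    then show ?thesis using that by simp
  qed
  have "(frob_norm (fmat m p x * A))\<^sup>2 = (\<Sum>i<m. \<Sum>l<n. (z i l)\<^sup>2)"
    unfolding A fmat_mult frob_norm_sq ip_self z_def ..
  also have "\<dots> = (\<Sum>a<k. \<Sum>j<r. (ip n (v j) (Z a))\<^sup>2)"
    using residual_identity(2)[OF e v(1) cols rows] by (simp add: Z_def[abs_def])
  also have "\<dots> = (\<Sum>j<r. form k n C (v j) (v j))"
    unfolding sum_form_eq by (intro sum.cong refl) (simp add: eq)
  finally show "(frob_norm (fmat m p x * A))\<^sup>2 = (ky_fan2 r (fmat k n C))\<^sup>2"
    by (simp add: kf)
qed

section \<open>Gaussian concentration\<close>

lemma layer_cake: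
  fixes f :: "'a \<Rightarrow> real"
  assumes "sigma_finite_measure M" and [measurable]: "f \<in> borel_measurable M"
  shows "(\<integral>\<^sup>+x. ennreal (f x) \<partial>M) =
    (\<integral>\<^sup>+t. (\<integral>\<^sup>+x. (if 0 < t \<and> t < f x then 1 else 0) \<partial>M) \<partial>(lborel :: real measure))"
proof -
  interpret M: sigma_finite_measure M by fact
  interpret pair_sigma_finite M "lborel :: real measure" by standard
  have "ennreal (f x) = (\<integral>\<^sup>+t. (if 0 < t \<and> t < f x then 1 else 0) \<partial>lborel)" for x
  proof -
    have "(\<integral>\<^sup>+t. (if 0 < t \<and> t < f x then 1 else 0) \<partial>lborel) = (\<integral>\<^sup>+t. indicator {0<..<f x} t \<partial>lborel)"
      by (intro nn_integral_cong) (auto split: split_indicator)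
    also have "\<dots> = ennreal (f x)"
      by (cases "0 \<le> f x") (auto simp: ennreal_neg)
    finally show ?thesis ..
  qed
  then have "(\<integral>\<^sup>+x. ennreal (f x) \<partial>M) =
      (\<integral>\<^sup>+x. (\<integral>\<^sup>+t. (if 0 < t \<and> t < f x then 1 else 0) \<partial>lborel) \<partial>M)" by simp
  also have "\<dots> = (\<integral>\<^sup>+t. (\<integral>\<^sup>+x. (if 0 < t \<and> t < f x then 1 else 0) \<partial>M) \<partial>lborel)"
    by (rule Fubini'[symmetric]) measurable
  finally show ?thesis .
qed

text \<open>The bound passes to suprema and to infima, which gives
  \<open>l * Sup A + (1 - l) * Sup B \<le> R\<close> and its mirror image; adding them bounds the
  weighted lengths of the hulls. Each set is bounded because the other one is not empty.\<close>

lemma convex_combination_hull: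
  fixes A B :: "real set"
  assumes l: "0 < l" "l < 1" and "A \<noteq> {}" "B \<noteq> {}"
    and R: "\<And>x y. x \<in> A \<Longrightarrow> y \<in> B \<Longrightarrow> \<bar>l * x + (1 - l) * y\<bar> \<le> R"
  shows "\<exists>a1 a2 b1 b2. A \<subseteq> {a1..a2} \<and> B \<subseteq> {b1..b2} \<and> a1 \<le> a2 \<and> b1 \<le> b2 \<and>
    l * (a2 - a1) + (1 - l) * (b2 - b1) \<le> 2 * R"
proof -
  obtain x0 y0 where xy: "x0 \<in> A" "y0 \<in> B" using assms by auto
  have Ab: "x \<le> (R - (1 - l) * y) / l" "(- R - (1 - l) * y) / l \<le> x" if "x \<in> A" "y \<in> B" for x y
    using R[OF that] l by (auto simp: field_simps abs_le_iff)
  have bA: "bdd_above A" "bdd_below A"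
    using Ab xy(2) by (auto intro!: bdd_aboveI bdd_belowI)
  have Bb: "y \<le> (R - l * x) / (1 - l)" "(- R - l * x) / (1 - l) \<le> y" if "x \<in> A" "y \<in> B" for x y
    using R[OF that] l by (auto simp: field_simps abs_le_iff)
  have bB: "bdd_above B" "bdd_below B"
    using Bb xy(1) by (auto intro!: bdd_aboveI bdd_belowI)
  have SA: "Sup A \<le> (R - (1 - l) * y) / l" if "y \<in> B" for y
    using Ab that \<open>A \<noteq> {}\<close> by (intro cSup_least) auto
  have "y \<le> (R - l * Sup A) / (1 - l)" if "y \<in> B" for y
    using SA[OF that] l by (auto simp: pos_le_divide_eq pos_divide_le_eq algebra_simps)
  then have 1: "Sup B \<le> (R - l * Sup A) / (1 - l)"
    using \<open>B \<noteq> {}\<close> by (intro cSup_least) auto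
  have IA: "(- R - (1 - l) * y) / l \<le> Inf A" if "y \<in> B" for y
    using Ab that \<open>A \<noteq> {}\<close> by (intro cInf_greatest) auto
  have "(- R - l * Inf A) / (1 - l) \<le> y" if "y \<in> B" for y
    using IA[OF that] l by (auto simp: pos_le_divide_eq pos_divide_le_eq algebra_simps)
  then have 2: "(- R - l * Inf A) / (1 - l) \<le> Inf B"
    using \<open>B \<noteq> {}\<close> by (intro cInf_greatest) auto
  have "l * (Sup A - Inf A) + (1 - l) * (Sup B - Inf B) \<le> 2 * R"
    using 1 2 l by (simp add: field_simps)
  moreover have "Inf A \<le> Sup A" "Inf B \<le> Sup B"
    using assms bA bB by (auto intro: cInf_le_cSup)
  moreover have "A \<subseteq> {Inf A..Sup A}" "B \<subseteq> {Inf B..Sup B}"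
    using bA bB by (auto intro: cInf_lower cSup_upper)
  ultimately show ?thesis by blast
qed

text \<open>The one-dimensional Prekopa--Leindler inequality for functions normalised to have supremum 1.
  As all superlevel sets of h contain symmetric intervals, no Brunn--Minkowski inequality is
  needed: the superlevel sets of U and V may be replaced by their convex hulls.\<close>

lemma prekopa_leindler_normalised:
  fixes U V h :: "real \<Rightarrow> real"
  assumes l: "0 < l" "l < 1"
    and [measurable]: "U \<in> borel_measurable borel" "V \<in> borel_measurable borel" "h \<in> borel_measurable borel"
    and U: "\<And>x. U x \<le> 1" "\<And>t. t < 1 \<Longrightarrow> \<exists>x. t < U x"
    and V: "\<And>x. V x \<le> 1" "\<And>t. t < 1 \<Longrightarrow> \<exists>x. t < V x"
    and h: "\<And>t. 0 < t \<Longrightarrow> t < 1 \<Longrightarrow> \<exists>R\<ge>0. (\<forall>x. \<bar>x\<bar> < R \<longrightarrow> t < h x) \<and>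
      (\<forall>x y. t < U x \<longrightarrow> t < V y \<longrightarrow> \<bar>l * x + (1 - l) * y\<bar> \<le> R)"
  shows "ennreal l * (\<integral>\<^sup>+x. ennreal (U x) \<partial>lborel) + ennreal (1 - l) * (\<integral>\<^sup>+x. ennreal (V x) \<partial>lborel)
    \<le> (\<integral>\<^sup>+x. ennreal (h x) \<partial>lborel)"
proof -
  define L where "L f t = (\<integral>\<^sup>+x. (if 0 < t \<and> t < f x then 1 else 0) \<partial>(lborel :: real measure))"
    for f :: "real \<Rightarrow> real" and t :: real
  have [measurable]: "L f \<in> borel_measurable borel" if [measurable]: "f \<in> borel_measurable borel" for f
    unfolding L_def[abs_def] by measurable
  have Leq: "L f t = emeasure lborel {x. t < f x}" if "0 < t" and [measurable]: "f \<in> borel_measurable borel" for f t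
  proof -
    have "L f t = (\<integral>\<^sup>+x. indicator {x. t < f x} x \<partial>lborel)"
      unfolding L_def using that by (intro nn_integral_cong) (auto split: split_indicator)
    also have "\<dots> = emeasure lborel {x. t < f x}" by (intro nn_integral_indicator) simp
    finally show ?thesis .
  qed
  have "ennreal l * L U t + ennreal (1 - l) * L V t \<le> L h t" for t
  proof (cases "0 < t \<and> t < 1")
    case True
    then have t: "0 < t" "t < 1" by auto
    obtain R where R: "R \<ge> 0" "\<And>x. \<bar>x\<bar> < R \<Longrightarrow> t < h x"
      "\<And>x y. t < U x \<Longrightarrow> t < V y \<Longrightarrow> \<bar>l * x + (1 - l) * y\<bar> \<le> R" using h[OF t] by blast
    \<comment> \<open>Both superlevel sets are non-empty because both suprema are 1 and
      \<open>t < 1\<close>. This is the purpose of the normalisation.\<close>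
    obtain a1 a2 b1 b2 where *: "{x. t < U x} \<subseteq> {a1..a2}" "{x. t < V x} \<subseteq> {b1..b2}" "a1 \<le> a2" "b1 \<le> b2"
      "l * (a2 - a1) + (1 - l) * (b2 - b1) \<le> 2 * R"
      using convex_combination_hull[OF l, of "{x. t < U x}" "{x. t < V x}" R] U(2)[OF t(2)] V(2)[OF t(2)] R(3)
      by (metis (mono_tags, lifting) empty_iff mem_Collect_eq)
    have "L U t \<le> ennreal (a2 - a1)"
      using emeasure_mono[OF *(1), of lborel] *(3) t by (simp add: Leq)
    moreover have "L V t \<le> ennreal (b2 - b1)"
      using emeasure_mono[OF *(2), of lborel] *(4) t by (simp add: Leq)
    ultimately have "ennreal l * L U t + ennreal (1 - l) * L V t \<le>
        ennreal l * ennreal (a2 - a1) + ennreal (1 - l) * ennreal (b2 - b1)"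
      by (intro add_mono mult_left_mono) auto
    also have "\<dots> = ennreal (l * (a2 - a1) + (1 - l) * (b2 - b1))"
      using l *(3,4) by (simp add: ennreal_mult ennreal_plus)
    also have "\<dots> \<le> ennreal (2 * R)" using *(5) by (rule ennreal_leI)
    also have "\<dots> = emeasure lborel {-R<..<R}" using R(1) by simp
    also have "\<dots> \<le> emeasure lborel {x. t < h x}"
      by (rule emeasure_mono) (auto intro!: R(2))
    also have "\<dots> = L h t" using t by (simp add: Leq)
    finally show ?thesis .
  next
    case False
    have "L U t = 0" "L V t = 0"
      using False U(1) V(1) unfolding L_def
      by (auto intro!: nn_integral_zero' AE_I2 simp: not_less) (metis order.trans not_less)+
    then show ?thesis by simp
  qed
  then have "(\<integral>\<^sup>+t. ennreal l * L U t + ennreal (1 - l) * L V t \<partial>lborel) \<le> (\<integral>\<^sup>+t. L h t \<partial>lborel)"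
    by (intro nn_integral_mono)
  also have "(\<integral>\<^sup>+t. ennreal l * L U t + ennreal (1 - l) * L V t \<partial>lborel) =
      ennreal l * (\<integral>\<^sup>+t. L U t \<partial>lborel) + ennreal (1 - l) * (\<integral>\<^sup>+t. L V t \<partial>lborel)"
    by (subst nn_integral_add) (auto simp: nn_integral_cmult)
  finally show ?thesis
    unfolding L_def by (simp add: layer_cake[symmetric] lborel.sigma_finite_measure_axioms)
qed

text \<open>Concavity of the logarithm, used through its tangent at \<open>exp z\<close>.\<close>

lemma weighted_ln_le:
  fixes x y z :: real
  assumes "0 < l" "l < 1" "x > 0" "y > 0" "l * x + (1 - l) * y \<le> exp z"
  shows "l * ln x + (1 - l) * ln y \<le> z"
proof -
  have "ln x \<le> z + (x / exp z - 1)"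
    using ln_le_minus_one[of "x / exp z"] assms by (simp add: ln_div)
  moreover have "ln y \<le> z + (y / exp z - 1)"
    using ln_le_minus_one[of "y / exp z"] assms by (simp add: ln_div)
  ultimately have "l * ln x + (1 - l) * ln y \<le> l * (z + (x / exp z - 1)) + (1 - l) * (z + (y / exp z - 1))"
    using assms by (intro add_mono mult_left_mono) auto
  also have "\<dots> = z + ((l * x + (1 - l) * y) / exp z - 1)"
    by (simp add: field_simps)
  also have "\<dots> \<le> z" using assms by (simp add: field_simps)
  finally show ?thesis .
qed

text \<open>A dual form of the quadratic transport inequality of Talagrand: in the limit l = 0 the conclusion
  bounds the logarithm of the integral of exp g by the integral of f. Unlike the Lipschitz
  concentration that it implies, it passes to product measures without loss.\<close>

definition dual_transport :: "real \<Rightarrow> 'a measure \<Rightarrow> ('a \<Rightarrow> 'a \<Rightarrow> real) \<Rightarrow> bool" where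
  "dual_transport l M d \<longleftrightarrow> (\<forall>f g C. f \<in> borel_measurable M \<longrightarrow> g \<in> borel_measurable M \<longrightarrow>
     (\<forall>x\<in>space M. \<bar>f x\<bar> \<le> C \<and> \<bar>g x\<bar> \<le> C) \<longrightarrow>
     (\<forall>x\<in>space M. \<forall>y\<in>space M. g x \<le> f y + d x y / 2) \<longrightarrow>
     l * ln (\<integral>x. exp ((1 - l) * g x) \<partial>M) + (1 - l) * ln (\<integral>x. exp (- l * f x) \<partial>M) \<le> 0)"

text \<open>Prekopa-Leindler for the Gaussian density tilted by \<open>(1 - l) * g\<close> and by
  \<open>- l * f\<close>, with the untilted density as the third function. The hypothesis on
  \<open>g\<close> and \<open>f\<close> is absorbed exactly by l x^2 + (1 - l) y^2 - (l x + (1 - l)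
  y)^2 = l (1 - l) (x - y)^2.\<close>

lemma dual_transport_std_normal:
  assumes l: "0 < l" "l < 1"
  shows "dual_transport l std_normal_distribution (\<lambda>x y. (x - y)\<^sup>2)"
  unfolding dual_transport_def
proof (intro allI impI)
  fix f g :: "real \<Rightarrow> real" and C
  assume "f \<in> borel_measurable std_normal_distribution" "g \<in> borel_measurable std_normal_distribution"
  then have [measurable]: "f \<in> borel_measurable borel" "g \<in> borel_measurable borel" by simp_all
  assume "\<forall>x\<in>space std_normal_distribution. \<bar>f x\<bar> \<le> C \<and> \<bar>g x\<bar> \<le> C"
  then have fg: "\<bar>f x\<bar> \<le> C" "\<bar>g x\<bar> \<le> C" for x by auto
  assume "\<forall>x\<in>space std_normal_distribution. \<forall>y\<in>space std_normal_distribution. g x \<le> f y + (x - y)\<^sup>2 / 2"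
  then have gf: "g x \<le> f y + (x - y)\<^sup>2 / 2" for x y by auto
  define p where "p = ln (1 / sqrt (2 * pi))"
  have phi: "std_normal_density x = exp (p - x\<^sup>2 / 2)" for x
  proof -
    have "1 / sqrt (2 * pi) = exp p" by (simp add: p_def)
    then show ?thesis unfolding std_normal_density_def by (simp add: exp_add[symmetric])
  qed
  define u where "u x = (1 - l) * g x + p - x\<^sup>2 / 2" for x
  define v where "v x = - l * f x + p - x\<^sup>2 / 2" for x
  have [measurable]: "u \<in> borel_measurable borel" "v \<in> borel_measurable borel"
    unfolding u_def[abs_def] v_def[abs_def] by measurable
  have b: "\<bar>(1 - l) * g x\<bar> \<le> C" "\<bar>l * f x\<bar> \<le> C" for x
    using mult_mono[OF _ fg(2)[of x], of "1 - l" 1] mult_mono[OF _ fg(1)[of x], of l 1] l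
    by (auto simp: abs_mult)
  have ub: "u x \<le> C + p" and vb: "v x \<le> C + p" for x
    using b[of x] zero_le_power2[of x] unfolding u_def v_def by linarith+
  have bdd: "bdd_above (range u)" "bdd_above (range v)"
    using ub vb by (auto intro: bdd_aboveI2[of UNIV _ "C + p"])
  \<comment> \<open>Logarithms of the suprema of the two tilted densities; dividing by
    \<open>exp a\<close> and \<open>exp c\<close> brings both suprema to 1.\<close>
  define a where "a = Sup (range u)"
  define c where "c = Sup (range v)"
  have ua: "u x \<le> a" and va: "v x \<le> c" for x
    unfolding a_def c_def by (auto intro!: cSup_upper bdd_aboveI2 ub vb)
  have ex_u: "\<exists>x. s < u x" if "s < a" for s
    using that less_cSup_iff[of "range u" s] bdd unfolding a_def by auto
  have ex_v: "\<exists>x. s < v x" if "s < c" for s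
    using that less_cSup_iff[of "range v" s] bdd unfolding c_def by auto
  define z where "z = l * a + (1 - l) * c"
  have key: "l * u x + (1 - l) * v y \<le> p - (l * x + (1 - l) * y)\<^sup>2 / 2" for x y
  proof -
    have "l * (1 - l) * g x \<le> l * (1 - l) * (f y + (x - y)\<^sup>2 / 2)"
      using gf[of x y] l by (intro mult_left_mono) auto
    then have "l * (1 - l) * g x \<le> l * (1 - l) * f y + l * (1 - l) * (x - y)\<^sup>2 / 2"
      by (simp add: distrib_left)
    moreover have "l * u x + (1 - l) * v y =
        l * (1 - l) * g x - l * (1 - l) * f y + p - (l * x\<^sup>2 + (1 - l) * y\<^sup>2) / 2"
      by (simp add: u_def v_def field_simps)
    moreover have "(l * x + (1 - l) * y)\<^sup>2 = l * x\<^sup>2 + (1 - l) * y\<^sup>2 - l * (1 - l) * (x - y)\<^sup>2"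
      by (simp add: power2_eq_square algebra_simps)
    \<comment> \<open>The nonlinear terms enter as opaque letters, so that the combination of the
      three preceding facts is linear arithmetic.\<close>
    moreover have "t \<le> p - W / 2" if "G \<le> F + D / 2" "t = G - F + p - S / 2" "W = S - D"
      for G F D S W t :: real using that by linarith
    ultimately show ?thesis by blast
  qed
  have less_ln: "t < exp w \<longleftrightarrow> ln t < w" if "0 < t" for t w :: real
    using that by (metis exp_less_cancel_iff exp_ln)
  have "ennreal l * (\<integral>\<^sup>+x. ennreal (exp (u x - a)) \<partial>lborel) + ennreal (1 - l) * (\<integral>\<^sup>+x. ennreal (exp (v x - c)) \<partial>lborel)
      \<le> (\<integral>\<^sup>+x. ennreal (exp (p - x\<^sup>2 / 2 - z)) \<partial>lborel)"
  proof (rule prekopa_leindler_normalised[OF l])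
    show "\<exists>x. t < exp (u x - a)" if "t < 1" for t
    proof (cases "0 < t")
      case True
      then have "ln t + a < a" using that by simp
      then show ?thesis using ex_u[of "ln t + a"] True by (auto simp: less_ln algebra_simps)
    next
      case False
      then show ?thesis by (intro exI[of _ 0]) (metis exp_gt_zero not_less order.strict_trans1)
    qed
    show "\<exists>x. t < exp (v x - c)" if "t < 1" for t
    proof (cases "0 < t")
      case True
      then have "ln t + c < c" using that by simp
      then show ?thesis using ex_v[of "ln t + c"] True by (auto simp: less_ln algebra_simps)
    next
      case False
      then show ?thesis by (intro exI[of _ 0]) (metis exp_gt_zero not_less order.strict_trans1)
    qed
    fix t :: real assume t: "0 < t" "t < 1"
    \<comment> \<open>The superlevel set of the Gaussian function at level \<open>t\<close> is the
      open interval of radius \<open>R\<close>.\<close>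
    define R where "R = sqrt (2 * (p - z - ln t))"
    have w: "w\<^sup>2 / 2 \<le> p - z - ln t"
      if "t < exp (u x - a)" "t < exp (v y - c)" "w = l * x + (1 - l) * y" for x y w
    proof -
      have "ln t + a \<le> u x" "ln t + c \<le> v y" using that t by (auto simp: less_ln)
      then have "l * (ln t + a) + (1 - l) * (ln t + c) \<le> l * u x + (1 - l) * v y"
        using l by (intro add_mono mult_left_mono) auto
      moreover have "l * (ln t + a) + (1 - l) * (ln t + c) = ln t + z"
        by (simp add: z_def algebra_simps)
      ultimately show ?thesis using key[of x y] unfolding that(3) by linarith
    qed
    obtain x0 y0 where "ln t + a < u x0" "ln t + c < v y0"
      using ex_u[of "ln t + a"] ex_v[of "ln t + c"] t by auto
    then have "(l * x0 + (1 - l) * y0)\<^sup>2 / 2 \<le> p - z - ln t"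
      using t by (intro w[of x0 y0]) (auto simp: less_ln)
    then have R2: "0 \<le> p - z - ln t" by (smt (verit) zero_le_power2 divide_nonneg_pos)
    show "\<exists>R\<ge>0. (\<forall>x. \<bar>x\<bar> < R \<longrightarrow> t < exp (p - x\<^sup>2 / 2 - z)) \<and>
      (\<forall>x y. t < exp (u x - a) \<longrightarrow> t < exp (v y - c) \<longrightarrow> \<bar>l * x + (1 - l) * y\<bar> \<le> R)"
    proof (intro exI[of _ R] conjI allI impI)
      show "0 \<le> R" using R2 by (simp add: R_def)
      show "t < exp (p - x\<^sup>2 / 2 - z)" if "\<bar>x\<bar> < R" for x
      proof -
        have "x\<^sup>2 < 2 * (p - z - ln t)"
          using that real_sqrt_less_iff[of "x\<^sup>2" "2 * (p - z - ln t)"] by (simp add: R_def)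
        then show ?thesis using t by (simp add: less_ln)
      qed
      show "\<bar>l * x + (1 - l) * y\<bar> \<le> R" if "t < exp (u x - a)" "t < exp (v y - c)" for x y
        using w[OF that refl] unfolding R_def by (intro real_le_rsqrt) simp
    qed
  qed (use ua va in auto)
  moreover have id: "integrable lborel std_normal_density" "(\<integral>x. std_normal_density x \<partial>lborel) = 1"
    by simp_all
  have idC: "integrable lborel (\<lambda>x. exp C * std_normal_density x)" by simp
  have iu: "integrable lborel (\<lambda>x. exp (u x))" and iv: "integrable lborel (\<lambda>x. exp (v x))"
    using b by (auto intro!: Bochner_Integration.integrable_bound[OF idC]
        simp: phi u_def v_def exp_add[symmetric] abs_le_iff)
  define Iu where "Iu = (\<integral>x. exp (u x) \<partial>lborel)"
  define Iv where "Iv = (\<integral>x. exp (v x) \<partial>lborel)"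
  have nu: "(\<integral>\<^sup>+x. ennreal (exp (u x - a)) \<partial>lborel) = ennreal (Iu / exp a)"
    using iu by (subst nn_integral_eq_integral) (auto simp: exp_diff Iu_def)
  have nv: "(\<integral>\<^sup>+x. ennreal (exp (v x - c)) \<partial>lborel) = ennreal (Iv / exp c)"
    using iv by (subst nn_integral_eq_integral) (auto simp: exp_diff Iv_def)
  have nh: "(\<integral>\<^sup>+x. ennreal (exp (p - x\<^sup>2 / 2 - z)) \<partial>lborel) = ennreal (exp (- z))"
  proof -
    have "(\<integral>\<^sup>+x. ennreal (exp (p - x\<^sup>2 / 2 - z)) \<partial>lborel) = (\<integral>\<^sup>+x. ennreal (std_normal_density x * exp (- z)) \<partial>lborel)"
      by (simp add: phi exp_add[symmetric])
    also have "\<dots> = ennreal (exp (- z))"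
      using id by (subst nn_integral_eq_integral) auto
    finally show ?thesis .
  qed
  have "Iu \<ge> 0" "Iv \<ge> 0" by (auto simp: Iu_def Iv_def intro!: integral_nonneg_AE)
  ultimately have le: "l * (Iu / exp a) + (1 - l) * (Iv / exp c) \<le> exp (- z)"
    using l unfolding nu nv nh
    by (simp add: ennreal_mult[symmetric] ennreal_plus[symmetric] del: ennreal_plus)
  have I: "(\<integral>x. exp ((1 - l) * g x) \<partial>std_normal_distribution) = Iu"
    "(\<integral>x. exp (- l * f x) \<partial>std_normal_distribution) = Iv"
    unfolding Iu_def Iv_def by (subst integral_density; auto intro!: Bochner_Integration.integral_cong
       simp: phi u_def v_def exp_add[symmetric] algebra_simps)+
  have idC': "integrable lborel (\<lambda>x. exp (- C) * std_normal_density x)" by simp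
  have "exp (- C) * (\<integral>x. std_normal_density x \<partial>lborel) \<le> Iu"
    unfolding Iu_def integral_mult_right_zero[symmetric] using b
    by (intro integral_mono idC' iu) (auto simp: phi u_def exp_add[symmetric] abs_le_iff minus_le_iff)
  moreover have "exp (- C) * (\<integral>x. std_normal_density x \<partial>lborel) \<le> Iv"
    unfolding Iv_def integral_mult_right_zero[symmetric] using b
    by (intro integral_mono idC' iv) (auto simp: phi v_def exp_add[symmetric] abs_le_iff)
  ultimately have "Iu > 0" "Iv > 0"
    unfolding id(2) using exp_gt_zero[of "- C"] by linarith+
  \<comment> \<open>The weighted sum becomes a weighted sum of logarithms, in which the
    normalisations cancel because \<open>z = l * a + (1 - l) * c\<close>.\<close>
  then have "l * ln (Iu / exp a) + (1 - l) * ln (Iv / exp c) \<le> - z"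
    by (intro weighted_ln_le[OF l]) (use le in auto)
  then show "l * ln (\<integral>x. exp ((1 - l) * g x) \<partial>std_normal_distribution) +
      (1 - l) * ln (\<integral>x. exp (- l * f x) \<partial>std_normal_distribution) \<le> 0"
    using \<open>Iu > 0\<close> \<open>Iv > 0\<close> unfolding I by (simp add: ln_div z_def algebra_simps)
qed

section \<open>Tensorisation to finite products\<close>

lemma prob_space_std_normal: "prob_space std_normal_distribution"
  using prob_space_normal_density[of 1 0] by simp

definition gauss_prod :: "'i set \<Rightarrow> ('i \<Rightarrow> real) measure" where
  "gauss_prod I = PiM I (\<lambda>_. std_normal_distribution)"

lemma prob_space_gauss_prod: "prob_space (gauss_prod I)"
  unfolding gauss_prod_def by (intro prob_space_PiM prob_space_std_normal)

lemma sets_gauss_prod [measurable_cong]: "sets (gauss_prod I) = sets (PiM I (\<lambda>_. borel))"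
  unfolding gauss_prod_def by (intro sets_PiM_cong) auto

lemma space_gauss_prod: "space (gauss_prod I) = PiE I (\<lambda>_. UNIV)"
  by (simp add: gauss_prod_def space_PiM)

definition sq_dist :: "'i set \<Rightarrow> ('i \<Rightarrow> real) \<Rightarrow> ('i \<Rightarrow> real) \<Rightarrow> real" where
  "sq_dist I x y = (\<Sum>i\<in>I. (x i - y i)\<^sup>2)"

lemma product_sigma_finite_std_normal: "product_sigma_finite (\<lambda>_. std_normal_distribution)"
  by (intro product_sigma_finite.intro prob_space_imp_sigma_finite prob_space_std_normal)

lemma integral_gauss_prod_insert:
  fixes F :: "('i \<Rightarrow> real) \<Rightarrow> real"
  assumes "finite I" "i \<notin> I" "integrable (gauss_prod (insert i I)) F"
  shows "(\<integral>x. F x \<partial>gauss_prod (insert i I)) =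
    (\<integral>x. (\<integral>s. F (x(i := s)) \<partial>std_normal_distribution) \<partial>gauss_prod I)"
  using product_sigma_finite.product_integral_insert[OF product_sigma_finite_std_normal assms(1,2)] assms(3)
  by (simp add: gauss_prod_def)

lemma measurable_gauss_prod_upd:
  "(\<lambda>(x, s). x(i := s)) \<in> measurable (gauss_prod I \<Otimes>\<^sub>M std_normal_distribution) (gauss_prod (insert i I))"
  unfolding gauss_prod_def by (rule measurable_add_dim)

lemma (in prob_space) integral_exp_bounds:
  fixes h :: "'a \<Rightarrow> real"
  assumes [measurable]: "h \<in> borel_measurable M" and b: "\<And>x. x \<in> space M \<Longrightarrow> \<bar>h x\<bar> \<le> C"
  shows "integrable M (\<lambda>x. exp (h x))" and "exp (- C) \<le> (\<integral>x. exp (h x) \<partial>M)"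
    and "(\<integral>x. exp (h x) \<partial>M) \<le> exp C"
proof -
  have b': "- C \<le> h x" "h x \<le> C" if "x \<in> space M" for x using b[OF that] by (simp_all add: abs_le_iff)
  show i: "integrable M (\<lambda>x. exp (h x))"
    by (rule integrable_const_bound[of _ "exp C"]) (auto intro!: AE_I2 b')
  have "(\<integral>x. exp (- C) \<partial>M) \<le> (\<integral>x. exp (h x) \<partial>M)"
    by (intro integral_mono i integrable_const) (auto intro: b')
  then show "exp (- C) \<le> (\<integral>x. exp (h x) \<partial>M)" by (simp add: prob_space)
  have "(\<integral>x. exp (h x) \<partial>M) \<le> (\<integral>x. exp C \<partial>M)"
    by (intro integral_mono i integrable_const) (auto intro: b')
  then show "(\<integral>x. exp (h x) \<partial>M) \<le> exp C" by (simp add: prob_space)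
qed

lemma dual_transportD:
  assumes "dual_transport l M d" "f \<in> borel_measurable M" "g \<in> borel_measurable M"
    "\<And>x. x \<in> space M \<Longrightarrow> \<bar>f x\<bar> \<le> C" "\<And>x. x \<in> space M \<Longrightarrow> \<bar>g x\<bar> \<le> C"
    "\<And>x y. x \<in> space M \<Longrightarrow> y \<in> space M \<Longrightarrow> g x \<le> f y + d x y / 2"
  shows "l * ln (\<integral>x. exp ((1 - l) * g x) \<partial>M) + (1 - l) * ln (\<integral>x. exp (- l * f x) \<partial>M) \<le> 0"
  using assms unfolding dual_transport_def by blast

text \<open>Integrating out a coordinate in this exponential way keeps the bound \<open>C\<close>
  unchanged, so the boundedness condition of \<open>dual_transport\<close> survives the induction
  over coordinates.\<close>

lemma ln_integral_exp_bound:
  fixes h :: "'a \<Rightarrow> real"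
  assumes "prob_space M" "h \<in> borel_measurable M" "\<And>x. x \<in> space M \<Longrightarrow> \<bar>h x\<bar> \<le> C" "0 < k"
  shows "\<bar>ln (\<integral>x. exp (k * h x) \<partial>M) / k\<bar> \<le> C" and "0 < (\<integral>x. exp (k * h x) \<partial>M)"
proof -
  interpret prob_space M by fact
  have b: "exp (- (k * C)) \<le> (\<integral>x. exp (k * h x) \<partial>M)" "(\<integral>x. exp (k * h x) \<partial>M) \<le> exp (k * C)"
    using integral_exp_bounds(2,3)[of "\<lambda>x. k * h x" "k * C"] assms by (auto simp: abs_mult)
  show pos: "0 < (\<integral>x. exp (k * h x) \<partial>M)" by (rule less_le_trans[OF exp_gt_zero b(1)])
  have "- (k * C) \<le> ln (\<integral>x. exp (k * h x) \<partial>M)" "ln (\<integral>x. exp (k * h x) \<partial>M) \<le> k * C"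
    using b pos ln_le_cancel_iff[OF pos exp_gt_zero[of "k * C"]] by (simp_all add: ln_ge_iff)
  then show "\<bar>ln (\<integral>x. exp (k * h x) \<partial>M) / k\<bar> \<le> C"
    using assms(4) by (simp add: abs_le_iff field_simps)
qed

text \<open>Coordinate \<open>i\<close> is integrated out of \<open>g\<close> and \<open>f\<close>
  in the exponential sense, giving \<open>G\<close> and \<open>F\<close>. The one-dimensional case,
  applied to sections over fixed \<open>x\<close> and \<open>y\<close>, says that \<open>G\<close>
  and \<open>F\<close> satisfy the hypothesis for the remaining coordinates. By Fubini their
  exponential integrals are those of \<open>g\<close> and \<open>f\<close>, so nothing is
  lost.\<close>

lemma dual_transport_gauss_prod:
  assumes l: "0 < l" "l < 1" and "finite I"
  shows "dual_transport l (gauss_prod I) (sq_dist I)"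
  using \<open>finite I\<close>
proof (induction I rule: finite_induct)
  case empty
  show ?case
    unfolding dual_transport_def
  proof (intro allI impI)
    fix f g :: "('a \<Rightarrow> real) \<Rightarrow> real" and C
    assume *: "\<forall>x\<in>space (gauss_prod {}). \<forall>y\<in>space (gauss_prod {}). g x \<le> f y + sq_dist {} x y / 2"
    interpret prob_space "gauss_prod {} :: ('a \<Rightarrow> real) measure" by (rule prob_space_gauss_prod)
    let ?u = "\<lambda>k. undefined :: real"
    have sp: "space (gauss_prod {}) = {?u}" by (simp add: space_gauss_prod)
    have i: "(\<integral>x. F x \<partial>gauss_prod {}) = F ?u" for F :: "('a \<Rightarrow> real) \<Rightarrow> real"
    proof -
      have "(\<integral>x. F x \<partial>gauss_prod {}) = (\<integral>x. F ?u \<partial>(gauss_prod {} :: ('a \<Rightarrow> real) measure))"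
        by (intro Bochner_Integration.integral_cong) (auto simp: sp)
      then show ?thesis by (simp add: prob_space)
    qed
    have "g ?u \<le> f ?u" using * by (simp add: sp sq_dist_def)
    then have "l * (1 - l) * g ?u \<le> l * (1 - l) * f ?u" using l by (intro mult_left_mono) auto
    then show "l * ln (\<integral>x. exp ((1 - l) * g x) \<partial>gauss_prod {}) +
        (1 - l) * ln (\<integral>x. exp (- l * f x) \<partial>gauss_prod {}) \<le> 0"
      unfolding i by (simp add: algebra_simps)
  qed
next
  case (insert i I)
  let ?S = "std_normal_distribution" and ?P = "gauss_prod I" and ?Q = "gauss_prod (insert i I)"
  interpret S: prob_space ?S by (rule prob_space_std_normal)
  interpret Q: prob_space ?Q by (rule prob_space_gauss_prod)
  show ?case
    unfolding dual_transport_def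
  proof (intro allI impI)
    fix f g :: "('a \<Rightarrow> real) \<Rightarrow> real" and C
    assume f: "f \<in> borel_measurable ?Q" and g: "g \<in> borel_measurable ?Q"
    assume "\<forall>x\<in>space ?Q. \<bar>f x\<bar> \<le> C \<and> \<bar>g x\<bar> \<le> C"
    then have fb: "\<And>x. x \<in> space ?Q \<Longrightarrow> \<bar>f x\<bar> \<le> C" and gb: "\<And>x. x \<in> space ?Q \<Longrightarrow> \<bar>g x\<bar> \<le> C" by auto
    assume "\<forall>x\<in>space ?Q. \<forall>y\<in>space ?Q. g x \<le> f y + sq_dist (insert i I) x y / 2"
    then have gf: "\<And>x y. x \<in> space ?Q \<Longrightarrow> y \<in> space ?Q \<Longrightarrow> g x \<le> f y + sq_dist (insert i I) x y / 2" by auto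
    have upd: "x(i := s) \<in> space ?Q" if "x \<in> space ?P" for x s
      using that by (auto simp: space_gauss_prod PiE_iff extensional_def)
    have meas2: "(\<lambda>(x, s). F (x(i := s))) \<in> borel_measurable (?P \<Otimes>\<^sub>M ?S)"
      if "F \<in> borel_measurable ?Q" for F :: "('a \<Rightarrow> real) \<Rightarrow> real"
      using measurable_compose[OF measurable_gauss_prod_upd that] by (simp add: split_def)
    have meas1: "(\<lambda>s. F (x(i := s))) \<in> borel_measurable ?S"
      if "F \<in> borel_measurable ?Q" "x \<in> space ?P" for F :: "('a \<Rightarrow> real) \<Rightarrow> real" and x
      using measurable_compose[OF measurable_Pair1'[OF that(2)] meas2[OF that(1)]] by simp
    define G where "G x = ln (\<integral>s. exp ((1 - l) * g (x(i := s))) \<partial>?S) / (1 - l)" for x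
    \<comment> \<open>Written with \<open>l * (- f ...)\<close> so that
      \<open>ln_integral_exp_bound\<close>, which asks for a positive factor, applies to
      \<open>- f\<close>.\<close>
    define F where "F x = - (ln (\<integral>s. exp (l * (- f (x(i := s)))) \<partial>?S) / l)" for x
    have mint: "(\<lambda>x. \<integral>s. exp (k * F (x(i := s))) \<partial>?S) \<in> borel_measurable ?P"
      if "F \<in> borel_measurable ?Q" for F :: "('a \<Rightarrow> real) \<Rightarrow> real" and k
    proof -
      have [measurable]: "(\<lambda>p. F ((fst p)(i := snd p))) \<in> borel_measurable (?P \<Otimes>\<^sub>M ?S)"
        using meas2[OF that] by (simp add: split_def)
      have "(\<lambda>(x, s). exp (k * F (x(i := s)))) \<in> borel_measurable (?P \<Otimes>\<^sub>M ?S)"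
        unfolding split_def by measurable
      then show ?thesis by (rule S.borel_measurable_lebesgue_integral)
    qed
    have Gm: "G \<in> borel_measurable ?P" unfolding G_def[abs_def] using mint[OF g] by simp
    have nf: "(\<lambda>x. - f x) \<in> borel_measurable ?Q" using f by simp
    have Fm: "F \<in> borel_measurable ?P" unfolding F_def[abs_def] using mint[OF nf] by simp
    have Gb: "\<bar>G x\<bar> \<le> C" and Gpos: "0 < (\<integral>s. exp ((1 - l) * g (x(i := s))) \<partial>?S)" if "x \<in> space ?P" for x
      unfolding G_def using l that
      by (intro ln_integral_exp_bound[where C = C, OF prob_space_std_normal] meas1[OF g that] gb upd; simp)+
    have Fb: "\<bar>F x\<bar> \<le> C" and Fpos: "0 < (\<integral>s. exp (l * - f (x(i := s))) \<partial>?S)" if "x \<in> space ?P" for x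
    proof -
      have "\<bar>ln (\<integral>s. exp (l * - f (x(i := s))) \<partial>?S) / l\<bar> \<le> C"
        by (intro ln_integral_exp_bound(1)[OF prob_space_std_normal] meas1[OF nf that] l(1))
          (simp add: fb upd that)
      then show "\<bar>F x\<bar> \<le> C" by (simp add: F_def)
      show "0 < (\<integral>s. exp (l * - f (x(i := s))) \<partial>?S)"
        by (rule ln_integral_exp_bound(2)[OF prob_space_std_normal meas1[OF nf that] _ l(1), of C])
          (simp add: fb upd that)
    qed
    have GF: "G x \<le> F y + sq_dist I x y / 2" if x: "x \<in> space ?P" and y: "y \<in> space ?P" for x y
    proof -
      let ?D = "sq_dist I x y / 2"
      have D: "0 \<le> ?D" by (simp add: sq_dist_def sum_nonneg)
      \<comment> \<open>For fixed \<open>x\<close> and \<open>y\<close> the cost \<open>?D\<close>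
        of the other coordinates is a constant, which is added to the section of
        \<open>f\<close>.\<close>
      have "l * ln (\<integral>s. exp ((1 - l) * g (x(i := s))) \<partial>?S) +
          (1 - l) * ln (\<integral>s. exp (- l * (f (y(i := s)) + ?D)) \<partial>?S) \<le> 0"
      proof (rule dual_transportD[OF dual_transport_std_normal[OF l], of _ _ "C + ?D"])
        show "(\<lambda>s. f (y(i := s)) + ?D) \<in> borel_measurable ?S" using meas1[OF f y] by simp
        show "(\<lambda>s. g (x(i := s))) \<in> borel_measurable ?S" by (rule meas1[OF g x])
        show "\<bar>f (y(i := s)) + ?D\<bar> \<le> C + ?D" for s using fb[OF upd[OF y, of s]] D by linarith
        show "\<bar>g (x(i := s))\<bar> \<le> C + ?D" for s using gb[OF upd[OF x, of s]] D by linarith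
        fix s t
        have "sq_dist (insert i I) (x(i := s)) (y(i := t)) = (s - t)\<^sup>2 + sq_dist I x y"
          using insert.hyps by (auto simp: sq_dist_def intro!: sum.cong)
        then show "g (x(i := s)) \<le> f (y(i := t)) + ?D + (s - t)\<^sup>2 / 2"
          using gf[OF upd[OF x, of s] upd[OF y, of t]] by (simp add: add_divide_distrib)
      qed
      moreover have "(\<integral>s. exp (- l * (f (y(i := s)) + ?D)) \<partial>?S) =
          exp (- l * ?D) * (\<integral>s. exp (l * - f (y(i := s))) \<partial>?S)"
        unfolding integral_mult_right_zero[symmetric]
        by (intro Bochner_Integration.integral_cong) (simp_all add: exp_add[symmetric] algebra_simps)
      ultimately have "l * ((1 - l) * G x) + (1 - l) * (- l * ?D - l * F y) \<le> 0"
        using l Fpos[OF y] by (simp add: G_def F_def ln_mult)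
      then have "(l * (1 - l)) * G x \<le> (l * (1 - l)) * (F y + ?D)" by (simp add: algebra_simps)
      then show ?thesis using l by (subst (asm) mult_le_cancel_left_pos) auto
    qed
    have "l * ln (\<integral>x. exp ((1 - l) * G x) \<partial>?P) + (1 - l) * ln (\<integral>x. exp (- l * F x) \<partial>?P) \<le> 0"
      by (rule dual_transportD[OF insert.IH Fm Gm Fb Gb GF])
    moreover have "(\<integral>x. exp ((1 - l) * G x) \<partial>?P) = (\<integral>x. exp ((1 - l) * g x) \<partial>?Q)"
    proof -
      have "integrable ?Q (\<lambda>x. exp ((1 - l) * g x))"
        using l g gb by (intro Q.integral_exp_bounds(1)[of _ C]) (auto simp: abs_mult intro: order.trans[OF mult_left_le_one_le])
      from integral_gauss_prod_insert[OF insert.hyps(1,2) this] show ?thesis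
        using l Gpos by (auto simp: G_def intro!: Bochner_Integration.integral_cong)
    qed
    moreover have "(\<integral>x. exp (- l * F x) \<partial>?P) = (\<integral>x. exp (- l * f x) \<partial>?Q)"
    proof -
      have "integrable ?Q (\<lambda>x. exp (- l * f x))"
        using l f fb by (intro Q.integral_exp_bounds(1)[of _ C]) (auto simp: abs_mult intro: order.trans[OF mult_left_le_one_le])
      from integral_gauss_prod_insert[OF insert.hyps(1,2) this] show ?thesis
        using l Fpos by (auto simp: F_def intro!: Bochner_Integration.integral_cong)
    qed
    ultimately show "l * ln (\<integral>x. exp ((1 - l) * g x) \<partial>?Q) + (1 - l) * ln (\<integral>x. exp (- l * f x) \<partial>?Q) \<le> 0"
      by simp
  qed
qed

section \<open>Bounded Lipschitz functions: exponential moments, tail and variance\<close>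

definition lipschitz_l2 :: "'i set \<Rightarrow> (('i \<Rightarrow> real) \<Rightarrow> real) \<Rightarrow> bool" where
  "lipschitz_l2 I f \<longleftrightarrow> (\<forall>x y. \<bar>f x - f y\<bar> \<le> sqrt (sq_dist I x y))"

lemma lipschitz_l2_uminus: "lipschitz_l2 I f \<Longrightarrow> lipschitz_l2 I (\<lambda>x. - f x)"
  unfolding lipschitz_l2_def by (metis abs_minus_commute minus_diff_minus abs_minus_cancel)

text \<open>\<open>lipschitz_l2\<close> ranges over all functions on the index type, while
  \<open>sq_dist\<close> sees only \<open>I\<close>; the Lipschitz condition therefore forces
  independence of the other coordinates.\<close>

lemma lipschitz_l2_restrict:
  assumes "lipschitz_l2 I f" "\<And>i. i \<in> I \<Longrightarrow> x i = y i"
  shows "f x = f y"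
proof -
  have "sq_dist I x y = 0" unfolding sq_dist_def using assms(2) by simp
  then show ?thesis using assms(1) unfolding lipschitz_l2_def by (metis abs_le_zero_iff eq_iff_diff_eq_0 real_sqrt_zero)
qed

text \<open>\<open>f\<close> is continuous for the product topology, and over a countable index type
  the Borel sets of this topology are the product sigma-algebra. Points of
  \<open>gauss_prod I\<close> are undefined outside \<open>I\<close>; the map \<open>e\<close>,
  which puts 0 there, carries them measurably into the full product and leaves \<open>f\<close>
  unchanged.\<close>

lemma lipschitz_l2_measurable:
  fixes f :: "('i::countable \<Rightarrow> real) \<Rightarrow> real"
  assumes "finite I" and f: "lipschitz_l2 I f"
  shows "f \<in> borel_measurable (gauss_prod I)"
proof -
  have "isCont f x" for x
  proof -
    have "((\<lambda>y. sqrt (sq_dist I y x)) \<longlongrightarrow> sqrt (sq_dist I x x)) (at x)"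
    proof -
      have "((\<lambda>y. y i) \<longlongrightarrow> x i) (at x)" for i
      proof -
        have "isCont (\<lambda>y :: 'i \<Rightarrow> real. y i) x"
          using continuous_on_eq_continuous_at[OF open_UNIV, of "\<lambda>y :: 'i \<Rightarrow> real. y i"]
            continuous_on_product_coordinates[of i] by blast
        then show ?thesis by (simp add: isCont_def)
      qed
      then show ?thesis unfolding sq_dist_def by (intro tendsto_intros)
    qed
    then have "((\<lambda>y. sqrt (sq_dist I y x)) \<longlongrightarrow> 0) (at x)" by (simp add: sq_dist_def)
    then have "((\<lambda>y. f y - f x) \<longlongrightarrow> 0) (at x)"
      by (rule Lim_null_comparison[rotated]) (use f in \<open>auto simp: lipschitz_l2_def\<close>)
    then show ?thesis unfolding isCont_def by (simp add: LIM_zero_iff)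
  qed
  then have [measurable]: "f \<in> borel_measurable borel"
    by (intro borel_measurable_continuous_onI continuous_at_imp_continuous_on) auto
  define e where "e x = (\<lambda>i. if i \<in> I then x i else 0)" for x :: "'i \<Rightarrow> real"
  have "e \<in> measurable (gauss_prod I) (PiM UNIV (\<lambda>_. borel))"
  proof (rule measurable_PiM_single')
    fix i
    show "(\<lambda>x. e x i) \<in> borel_measurable (gauss_prod I)"
    proof (cases "i \<in> I")
      case True
      then have "(\<lambda>x. x i) \<in> borel_measurable (gauss_prod I)"
        by (subst measurable_cong_sets[OF sets_gauss_prod refl]) (rule measurable_component_singleton)
      then show ?thesis using True by (simp add: e_def)
    qed (simp add: e_def)
  qed simp
  then have "e \<in> borel_measurable (gauss_prod I)"
    using measurable_cong_sets[OF refl sets_PiM_equal_borel] by blast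
  then have "(\<lambda>x. f (e x)) \<in> borel_measurable (gauss_prod I)" by measurable
  moreover have "f (e x) = f x" for x
    by (rule lipschitz_l2_restrict[OF f]) (simp add: e_def)
  ultimately show ?thesis by simp
qed

text \<open>The dual inequality is applied to \<open>s * f\<close> and
  \<open>s * f - s\<^sup>2 / 2\<close>, an admissible pair because s d is at most s^2 / 2 + d^2 / 2.
  Jensen's inequality bounds the second logarithm from below by the mean. The loss, a factor 1 / (1
  - l) in the exponent, disappears as \<open>l\<close> tends to 0.\<close>

lemma bounded_lipschitz_laplace:
  fixes f :: "('i \<Rightarrow> real) \<Rightarrow> real"
  assumes I: "finite I" and fm: "f \<in> borel_measurable (gauss_prod I)" and f: "lipschitz_l2 I f"
    and C: "\<And>x. \<bar>f x\<bar> \<le> C" and t: "0 \<le> t"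
  shows "(\<integral>x. exp (t * f x) \<partial>gauss_prod I) \<le> exp (t * (\<integral>x. f x \<partial>gauss_prod I) + t\<^sup>2 / 2)"
proof -
  interpret prob_space "gauss_prod I" by (rule prob_space_gauss_prod)
  define m where "m = (\<integral>x. f x \<partial>gauss_prod I)"
  have fi: "integrable (gauss_prod I) f"
    using fm C by (intro integrable_const_bound[of _ C]) auto
  have main: "(\<integral>x. exp (t * f x) \<partial>gauss_prod I) \<le> exp (t * m + t\<^sup>2 / (2 * (1 - l)))" if l: "0 < l" "l < 1" for l
  proof -
    \<comment> \<open>With this scale the factor \<open>1 - l\<close> in the dual inequality turns
      \<open>s * f\<close> into \<open>t * f\<close>.\<close>
    define s where "s = t / (1 - l)"
    have s: "0 \<le> s" "t = (1 - l) * s" using t l by (simp_all add: s_def)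
    let ?g = "\<lambda>x. s * f x - s\<^sup>2 / 2"
    have "l * ln (\<integral>x. exp ((1 - l) * ?g x) \<partial>gauss_prod I) + (1 - l) * ln (\<integral>x. exp (- l * (s * f x)) \<partial>gauss_prod I) \<le> 0"
    proof (rule dual_transportD[OF dual_transport_gauss_prod[OF l I], of _ _ "s * C + s\<^sup>2 / 2"])
      show "(\<lambda>x. s * f x) \<in> borel_measurable (gauss_prod I)" "?g \<in> borel_measurable (gauss_prod I)"
        using fm by simp_all
      have b: "\<bar>s * f x\<bar> \<le> s * C" for x using s(1) C[of x] by (simp add: abs_mult mult_left_mono)
      have p: "0 \<le> s\<^sup>2 / 2" by simp
      show "\<bar>s * f x\<bar> \<le> s * C + s\<^sup>2 / 2" for x using b[of x] p by linarith
      show "\<bar>?g x\<bar> \<le> s * C + s\<^sup>2 / 2" for x using b[of x] p by linarith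
      fix x y
      define d where "d = sqrt (sq_dist I x y)"
      have d2: "d\<^sup>2 = sq_dist I x y" by (simp add: d_def sq_dist_def sum_nonneg)
      have "f x - f y \<le> d" using f unfolding lipschitz_l2_def d_def by (meson abs_le_D1)
      then have "s * (f x - f y) \<le> s * d" using s(1) by (rule mult_left_mono)
      moreover have "0 \<le> (s - d)\<^sup>2" by simp
      then have "s * d \<le> s\<^sup>2 / 2 + d\<^sup>2 / 2" by (simp add: power2_diff)
      ultimately show "?g x \<le> s * f y + sq_dist I x y / 2" unfolding d2[symmetric]
        by (simp add: algebra_simps)
    qed
    moreover have "- l * s * m \<le> ln (\<integral>x. exp (- l * (s * f x)) \<partial>gauss_prod I)"
    proof -
      have i: "integrable (gauss_prod I) (\<lambda>x. exp (- l * (s * f x)))"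
        using s(1) l fm C by (intro integral_exp_bounds(1)[of _ "l * (s * C)"]) (auto simp: abs_mult intro!: mult_left_mono)
      \<comment> \<open>Jensen's inequality: the tangent of the exponential at the mean
        \<open>- l * s * m\<close> integrates to its value there.\<close>
      have "exp (- l * s * m) = (\<integral>x. exp (- l * s * m) * (1 + (- l * (s * f x) - (- l * s * m))) \<partial>gauss_prod I)"
        using fi by (simp add: prob_space m_def)
      also have "\<dots> \<le> (\<integral>x. exp (- l * (s * f x)) \<partial>gauss_prod I)"
      proof (intro integral_mono i)
        show "integrable (gauss_prod I) (\<lambda>x. exp (- l * s * m) * (1 + (- l * (s * f x) - (- l * s * m))))"
          using fi by simp
        fix x
        have "exp (- l * s * m) * (1 + (- l * (s * f x) - (- l * s * m))) \<le>
            exp (- l * s * m) * exp (- l * (s * f x) - (- l * s * m))"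
          by (intro mult_left_mono exp_ge_add_one_self) simp
        then show "exp (- l * s * m) * (1 + (- l * (s * f x) - (- l * s * m))) \<le> exp (- l * (s * f x))"
          by (simp add: exp_add[symmetric])
      qed
      finally have le: "exp (- l * s * m) \<le> (\<integral>x. exp (- l * (s * f x)) \<partial>gauss_prod I)" .
      show ?thesis by (subst ln_ge_iff[OF less_le_trans[OF exp_gt_zero le]]) (rule le)
    qed
    then have "(1 - l) * (- l * s * m) \<le> (1 - l) * ln (\<integral>x. exp (- l * (s * f x)) \<partial>gauss_prod I)"
      using l by (intro mult_left_mono) auto
    ultimately have "l * ln (\<integral>x. exp ((1 - l) * ?g x) \<partial>gauss_prod I) \<le> l * ((1 - l) * s * m)"
      by (simp add: algebra_simps)
    then have le: "ln (\<integral>x. exp ((1 - l) * ?g x) \<partial>gauss_prod I) \<le> t * m"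
      using l by (simp add: s(2))
    have "(\<integral>x. exp (t * f x) \<partial>gauss_prod I) =
        exp (t * s / 2) * (\<integral>x. exp ((1 - l) * ?g x) \<partial>gauss_prod I)"
      unfolding integral_mult_right_zero[symmetric]
      by (intro Bochner_Integration.integral_cong refl) (simp add: s(2) exp_add[symmetric] algebra_simps power2_eq_square)
    also have "\<dots> \<le> exp (t * s / 2) * exp (t * m)"
    proof (intro mult_left_mono)
      show "(\<integral>x. exp ((1 - l) * ?g x) \<partial>gauss_prod I) \<le> exp (t * m)"
      proof (cases "0 < (\<integral>x. exp ((1 - l) * ?g x) \<partial>gauss_prod I)")
        case True
        then show ?thesis using le by (metis exp_le_cancel_iff exp_ln)
      qed (smt (verit) exp_gt_zero)
    qed simp
    also have "\<dots> = exp (t * m + t\<^sup>2 / (2 * (1 - l)))"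
      by (simp add: exp_add[symmetric] s_def power2_eq_square add.commute mult.commute)
    finally show ?thesis .
  qed
  have "((\<lambda>l. exp (t * m + t\<^sup>2 / (2 * (1 - l)))) \<longlongrightarrow> exp (t * m + t\<^sup>2 / (2 * (1 - 0)))) (at_right 0)"
    by (intro tendsto_intros) auto
  moreover have "eventually (\<lambda>l. (\<integral>x. exp (t * f x) \<partial>gauss_prod I) \<le> exp (t * m + t\<^sup>2 / (2 * (1 - l)))) (at_right 0)"
    using main by (auto simp: eventually_at_right_field intro!: exI[of _ 1])
  ultimately show ?thesis
    unfolding m_def[symmetric] by (intro tendsto_lowerbound[of _ _ "at_right 0"]) auto
qed

text \<open>Chernoff's bound; for exponential moments of this form the best parameter is the
  deviation \<open>t\<close> itself.\<close>

lemma bounded_lipschitz_tail: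
  fixes f :: "('i \<Rightarrow> real) \<Rightarrow> real"
  assumes I: "finite I" and fm: "f \<in> borel_measurable (gauss_prod I)" and f: "lipschitz_l2 I f"
    and C: "\<And>x. \<bar>f x\<bar> \<le> C" and t: "0 \<le> t"
  shows "measure (gauss_prod I) {x \<in> space (gauss_prod I). (\<integral>x. f x \<partial>gauss_prod I) + t \<le> f x} \<le> exp (- t\<^sup>2 / 2)"
proof -
  interpret prob_space "gauss_prod I" by (rule prob_space_gauss_prod)
  define m where "m = (\<integral>x. f x \<partial>gauss_prod I)"
  have i: "integrable (gauss_prod I) (\<lambda>x. exp (t * f x))"
    using t fm C by (intro integral_exp_bounds(1)[of _ "t * C"]) (auto simp: abs_mult intro!: mult_left_mono)
  have "measure (gauss_prod I) {x \<in> space (gauss_prod I). m + t \<le> f x} \<le>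
      measure (gauss_prod I) {x \<in> space (gauss_prod I). exp (t * (m + t)) \<le> exp (t * f x)}"
    using t fm by (intro finite_measure_mono) (auto intro: mult_left_mono)
  also have "\<dots> \<le> (\<integral>x. exp (t * f x) \<partial>gauss_prod I) / exp (t * (m + t))"
    by (intro integral_Markov_inequality_measure[OF i, of "{}"]) auto
  also have "\<dots> \<le> exp (t * m + t\<^sup>2 / 2) / exp (t * (m + t))"
    using bounded_lipschitz_laplace[OF I fm f C t] by (intro divide_right_mono) (auto simp: m_def)
  also have "\<dots> = exp (- t\<^sup>2 / 2)"
    by (simp add: exp_diff[symmetric] algebra_simps power2_eq_square)
  finally show ?thesis by (simp add: m_def)
qed

text \<open>The difference exp x + exp(- x) - 2 is the square of exp(x / 2) - exp(- x / 2), whose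
  modulus is at least that of x. This inequality extracts a second moment from exponential
  moments.\<close>

lemma exp_plus_exp_uminus_ge: "2 + x\<^sup>2 \<le> exp x + exp (- x)" for x :: real
proof -
  have sinh: "2 * y \<le> exp y - exp (- y)" if "0 \<le> y" for y :: real
  proof -
    have "(\<lambda>y. exp y - exp (- y) - 2 * y) 0 \<le> (\<lambda>y. exp y - exp (- y) - 2 * y) y"
    proof (rule DERIV_nonneg_imp_nondecreasing[OF that])
      fix z :: real
      have "0 \<le> (exp (z / 2) - exp (- z / 2))\<^sup>2" by simp
      then have "0 \<le> exp z + exp (- z) - 2"
        by (simp add: power2_eq_square algebra_simps exp_add[symmetric])
      moreover have "((\<lambda>y. exp y - exp (- y) - 2 * y) has_real_derivative exp z + exp (- z) - 2) (at z)"
        by (auto intro!: derivative_eq_intros)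
      ultimately show "\<exists>d. ((\<lambda>y. exp y - exp (- y) - 2 * y) has_real_derivative d) (at z) \<and> 0 \<le> d" by blast
    qed
    then show ?thesis by simp
  qed
  have "\<bar>x\<bar> \<le> \<bar>exp (x / 2) - exp (- x / 2)\<bar>"
    using sinh[of "x / 2"] sinh[of "- x / 2"] by (cases "0 \<le> x") auto
  then have "x\<^sup>2 \<le> (exp (x / 2) - exp (- x / 2))\<^sup>2" by (simp add: abs_le_square_iff)
  then show ?thesis by (simp add: power2_eq_square algebra_simps exp_add[symmetric])
qed

text \<open>The two exponential moments of the centred function at \<open>t\<close> and
  \<open>- t\<close> add up to at least 2 + t^2 v, with v the variance, and to at most 2 exp(t^2 /
  2). With w = t^2 / 2 this gives v at most 1 + w for every small w.\<close>

lemma bounded_lipschitz_variance: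
  fixes f :: "('i \<Rightarrow> real) \<Rightarrow> real"
  assumes I: "finite I" and fm: "f \<in> borel_measurable (gauss_prod I)" and f: "lipschitz_l2 I f"
    and C: "\<And>x. \<bar>f x\<bar> \<le> C"
  shows "(\<integral>x. (f x)\<^sup>2 \<partial>gauss_prod I) \<le> 1 + (\<integral>x. f x \<partial>gauss_prod I)\<^sup>2"
proof -
  interpret prob_space "gauss_prod I" by (rule prob_space_gauss_prod)
  define m where "m = (\<integral>x. f x \<partial>gauss_prod I)"
  define v where "v = (\<integral>x. (f x - m)\<^sup>2 \<partial>gauss_prod I)"
  have fi: "integrable (gauss_prod I) f"
    using fm C by (intro integrable_const_bound[of _ C]) auto
  have fi2: "integrable (gauss_prod I) (\<lambda>x. (f x)\<^sup>2)"
  proof (rule integrable_const_bound[of _ "C\<^sup>2"])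
    have "(f x)\<^sup>2 \<le> C\<^sup>2" for x using C[of x] by (metis abs_ge_zero power2_abs power_mono)
    then show "AE x in gauss_prod I. norm ((f x)\<^sup>2) \<le> C\<^sup>2" by simp
  qed (use fm in simp)
  have v: "v = (\<integral>x. (f x)\<^sup>2 \<partial>gauss_prod I) - m\<^sup>2"
    using fi fi2 by (simp add: v_def power2_diff m_def[symmetric] prob_space) (simp add: m_def power2_eq_square)
  have le: "v \<le> 1 + w" if w: "0 < w" "w < 1" for w
  proof -
    define t where "t = sqrt (2 * w)"
    have t: "0 \<le> t" "t\<^sup>2 = 2 * w" using w by (simp_all add: t_def)
    have i: "integrable (gauss_prod I) (\<lambda>x. exp (t * f x))" "integrable (gauss_prod I) (\<lambda>x. exp (t * - f x))"
      using t fm C by (intro integral_exp_bounds(1)[of _ "t * C"]; auto simp: abs_mult intro!: mult_left_mono)+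
    have 1: "(\<integral>x. exp (t * f x) \<partial>gauss_prod I) * exp (- t * m) \<le> exp w"
    proof -
      have "(\<integral>x. exp (t * f x) \<partial>gauss_prod I) * exp (- t * m) \<le> exp (t * m + t\<^sup>2 / 2) * exp (- t * m)"
        using bounded_lipschitz_laplace[OF I fm f C t(1)] by (intro mult_right_mono) (auto simp: m_def)
      then show ?thesis by (simp add: exp_add[symmetric] t(2))
    qed
    have 2: "(\<integral>x. exp (t * - f x) \<partial>gauss_prod I) * exp (t * m) \<le> exp w"
    proof -
      have "(\<integral>x. exp (t * - f x) \<partial>gauss_prod I) * exp (t * m) \<le> exp (t * - m + t\<^sup>2 / 2) * exp (t * m)"
        using bounded_lipschitz_laplace[OF I _ lipschitz_l2_uminus[OF f], of C t] t(1) fm C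
        by (intro mult_right_mono) (auto simp: m_def)
      then show ?thesis by (simp add: exp_add[symmetric] t(2))
    qed
    have "2 + t\<^sup>2 * v = (\<integral>x. 2 + t\<^sup>2 * (f x - m)\<^sup>2 \<partial>gauss_prod I)"
      using fi fi2 by (simp add: v_def prob_space power2_diff)
    also have "\<dots> \<le> (\<integral>x. exp (t * f x) * exp (- t * m) + exp (t * - f x) * exp (t * m) \<partial>gauss_prod I)"
    proof (rule integral_mono)
      show "integrable (gauss_prod I) (\<lambda>x. 2 + t\<^sup>2 * (f x - m)\<^sup>2)"
        using fi fi2 by (simp add: power2_diff)
      show "integrable (gauss_prod I) (\<lambda>x. exp (t * f x) * exp (- t * m) + exp (t * - f x) * exp (t * m))"
        using i by (intro Bochner_Integration.integrable_add integrable_mult_left)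
      fix x
      show "2 + t\<^sup>2 * (f x - m)\<^sup>2 \<le> exp (t * f x) * exp (- t * m) + exp (t * - f x) * exp (t * m)"
        using exp_plus_exp_uminus_ge[of "t * (f x - m)"] unfolding power_mult_distrib
        by (simp add: exp_add[symmetric] algebra_simps)
    qed
    also have "\<dots> = (\<integral>x. exp (t * f x) \<partial>gauss_prod I) * exp (- t * m) + (\<integral>x. exp (t * - f x) \<partial>gauss_prod I) * exp (t * m)"
      using i by (simp add: Bochner_Integration.integral_add)
    also have "\<dots> \<le> 2 * exp w" using 1 2 by simp
    \<comment> \<open>The quadratic bound of the exponential on the unit interval; the term w^2
      becomes the error w after division by w.\<close>
    also have "\<dots> \<le> 2 * (1 + w + w\<^sup>2)" using exp_bound[of w] w by simp
    finally have "2 + t\<^sup>2 * v \<le> 2 * (1 + w + w\<^sup>2)" .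
    then have "w * v \<le> w * (1 + w)" unfolding t(2) by (simp add: power2_eq_square algebra_simps)
    then show ?thesis using w by simp
  qed
  have "v \<le> 1"
  proof (rule ccontr)
    assume v1: "\<not> v \<le> 1"
    \<comment> \<open>A first bound on \<open>v\<close> makes \<open>(v - 1) / 2\<close> smaller
      than 1, hence an admissible value of \<open>w\<close>, and that value is
      contradictory.\<close>
    have "v \<le> 1 + 1 / 2" using le[of "1/2"] by simp
    then have "v \<le> 1 + (v - 1) / 2" using v1 by (intro le) auto
    then show False using v1 by (simp add: field_simps)
  qed
  then show ?thesis using v by (simp add: m_def)
qed

section \<open>Gaussian moments\<close>

lemma std_normal_power_integrable: "integrable std_normal_distribution (\<lambda>s. s ^ k)"
  by (rule integrable_std_normal_distribution_moment)

definition nmoment :: "nat \<Rightarrow> real" where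
  "nmoment k = (\<integral>s. s ^ k \<partial>std_normal_distribution)"

lemma nmoment_simps [simp]: "nmoment 0 = 1" "nmoment (Suc 0) = 0" "nmoment 2 = 1" "nmoment 4 = 3"
proof -
  interpret prob_space std_normal_distribution by (rule prob_space_std_normal)
  show "nmoment 0 = 1" using prob_space by (simp add: nmoment_def)
  show "nmoment (Suc 0) = 0"
    using integral_std_normal_distribution_moment_odd[of 1] by (simp add: nmoment_def)
  show "nmoment 2 = 1"
    using std_normal_distribution_even_moments(1)[of 1] by (simp add: nmoment_def)
  show "nmoment 4 = 3"
    using std_normal_distribution_even_moments(1)[of 2] by (simp add: nmoment_def fact_numeral)
qed

lemma nmoment_Suc [simp]: "nmoment (Suc (Suc 0)) = 1" "nmoment (Suc (Suc (Suc (Suc 0)))) = 3"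
  using nmoment_simps(3,4) by (simp_all add: numeral_eq_Suc)

lemma gauss_prod_monomial:
  assumes "finite I"
  shows "integrable (gauss_prod I) (\<lambda>x. \<Prod>e\<in>I. x e ^ m e)"
    and "(\<integral>x. (\<Prod>e\<in>I. x e ^ m e) \<partial>gauss_prod I) = (\<Prod>e\<in>I. nmoment (m e))"
  using product_sigma_finite.product_integrable_prod[OF product_sigma_finite_std_normal assms, of "\<lambda>e s. s ^ m e"]
    product_sigma_finite.product_integral_prod[OF product_sigma_finite_std_normal assms, of "\<lambda>e s. s ^ m e"]
    std_normal_power_integrable
  by (simp_all add: gauss_prod_def nmoment_def)

text \<open>Written as a monomial over all of \<open>I\<close>, a product of coordinates is
  multiplied by adding exponents, and coinciding indices need no separate treatment.\<close>

lemma coordinate_as_monomial: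
  fixes x :: "'i \<Rightarrow> real"
  assumes "finite I" "a \<in> I"
  shows "x a = (\<Prod>e\<in>I. x e ^ of_bool (e = a))"
proof -
  have "(\<Prod>e\<in>I. x e ^ of_bool (e = a)) = (\<Prod>e\<in>I. if e = a then x a else 1)"
    by (intro prod.cong) auto
  then show ?thesis using assms by simp
qed

lemma gauss_prod_fourth_moment:
  assumes I: "finite I" and abcd: "a \<in> I" "b \<in> I" "c \<in> I" "d \<in> I"
  shows "integrable (gauss_prod I) (\<lambda>x. x a * x b * (x c * x d))"
    and "(\<integral>x. x a * x b * (x c * x d) \<partial>gauss_prod I) =
      (\<Prod>e\<in>I. nmoment (of_bool (e = a) + of_bool (e = b) + (of_bool (e = c) + of_bool (e = d))))"
proof -
  let ?m = "\<lambda>e. of_bool (e = a) + of_bool (e = b) + (of_bool (e = c) + of_bool (e = d)) :: nat"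
  have eq: "x a * x b * (x c * x d) = (\<Prod>e\<in>I. x e ^ ?m e)" for x :: "'a \<Rightarrow> real"
    unfolding power_add prod.distrib
    by (simp only: coordinate_as_monomial[OF I abcd(1), of x, symmetric]
        coordinate_as_monomial[OF I abcd(2), of x, symmetric]
        coordinate_as_monomial[OF I abcd(3), of x, symmetric]
        coordinate_as_monomial[OF I abcd(4), of x, symmetric])
  show "integrable (gauss_prod I) (\<lambda>x. x a * x b * (x c * x d))"
    unfolding eq by (rule gauss_prod_monomial(1)[OF I])
  show "(\<integral>x. x a * x b * (x c * x d) \<partial>gauss_prod I) = (\<Prod>e\<in>I. nmoment (?m e))"
    unfolding eq by (rule gauss_prod_monomial(2)[OF I])
qed

lemma gauss_prod_second_moment:
  assumes I: "finite I" and a: "a \<in> I"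
  shows "integrable (gauss_prod I) (\<lambda>x. (x a)\<^sup>2)" and "(\<integral>x. (x a)\<^sup>2 \<partial>gauss_prod I) = 1"
proof -
  have "(x a)\<^sup>2 = (\<Prod>e\<in>I. x e ^ (if e = a then 2 else 0))" for x :: "'a \<Rightarrow> real"
  proof -
    have "(\<Prod>e\<in>I. x e ^ (if e = a then 2 else 0)) = (\<Prod>e\<in>I. if e = a then (x a)\<^sup>2 else 1)"
      by (intro prod.cong) auto
    then show ?thesis using assms by simp
  qed
  moreover have "(\<Prod>e\<in>I. nmoment (if e = a then 2 else 0)) = 1" by (intro prod.neutral) auto
  ultimately show "integrable (gauss_prod I) (\<lambda>x. (x a)\<^sup>2)" "(\<integral>x. (x a)\<^sup>2 \<partial>gauss_prod I) = 1"
    using gauss_prod_monomial[OF I, of "\<lambda>e. if e = a then 2 else 0"] by simp_all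
qed

text \<open>\<open>\<iota>\<close> places the entry in row \<open>i\<close> and column
  \<open>j\<close> into the index set; being arbitrary, it also serves for the transposed array.
  With four distinct entries each exponent is 1 and the moment vanishes, two distinct entries have
  exponents 2 and 2, and a single entry gives the fourth moment 3.\<close>

lemma gauss_prod_gram_moment:
  assumes I: "finite I" and inI: "\<And>i j. i < s \<Longrightarrow> j < t \<Longrightarrow> \<iota> i j \<in> I"
    and inj: "\<And>i j i' j'. \<iota> i j = \<iota> i' j' \<longleftrightarrow> i = i' \<and> j = j'"
    and ij: "i < s" "i' < s" "j < t" "k < t"
  shows "(\<integral>x. x (\<iota> i j) * x (\<iota> i k) * (x (\<iota> i' j) * x (\<iota> i' k)) \<partial>gauss_prod I) =
    (if i = i' then (if j = k then 3 else 1) else (if j = k then 1 else 0))"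
proof -
  let ?m = "\<lambda>e. of_bool (e = \<iota> i j) + of_bool (e = \<iota> i k) + (of_bool (e = \<iota> i' j) + of_bool (e = \<iota> i' k)) :: nat"
  have eq: "(\<integral>x. x (\<iota> i j) * x (\<iota> i k) * (x (\<iota> i' j) * x (\<iota> i' k)) \<partial>gauss_prod I) = (\<Prod>e\<in>I. nmoment (?m e))"
    using ij by (intro gauss_prod_fourth_moment(2)[OF I]) (auto intro: inI)
  show ?thesis
  proof (cases "i = i'")
    case True
    show ?thesis
    proof (cases "j = k")
      case jk: True
      have "(\<Prod>e\<in>I. nmoment (?m e)) = (\<Prod>e\<in>I. if e = \<iota> i j then 3 else 1)"
        using True jk by (intro prod.cong) auto
      then show ?thesis using True jk I inI[OF ij(1,3)] unfolding eq by simp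
    next
      case jk: False
      have "(\<Prod>e\<in>I. nmoment (?m e)) = 1"
        using True jk by (intro prod.neutral) (auto simp: inj numeral_2_eq_2[symmetric])
      then show ?thesis using True jk unfolding eq by simp
    qed
  next
    case False
    show ?thesis
    proof (cases "j = k")
      case jk: True
      have "(\<Prod>e\<in>I. nmoment (?m e)) = 1"
        using False jk by (intro prod.neutral) (auto simp: inj numeral_2_eq_2[symmetric])
      then show ?thesis using False jk unfolding eq by simp
    next
      case jk: False
      have "nmoment (?m (\<iota> i j)) = 0" using False jk by (simp add: inj)
      then have "(\<Prod>e\<in>I. nmoment (?m e)) = 0"
        by (intro prod_zero[OF I] bexI[OF _ inI[OF ij(1,3)]])
      then show ?thesis unfolding eq by (simp only: False jk if_False)
    qed
  qed
qed

text \<open>Bounding the r largest eigenvalues of the Gram matrix through the Frobenius norm of its deviation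
  from its mean avoids the Gordon--Slepian bound on the operator norm. The result is weaker for
  large r, but only r below (nq - 1) / (4 (sqrt n + sqrt q)^2) matters.\<close>

definition gram_dev :: "nat \<Rightarrow> nat \<Rightarrow> (nat \<Rightarrow> nat \<Rightarrow> real) \<Rightarrow> real" where
  "gram_dev s t b = (\<Sum>j<t. \<Sum>k<t. ((\<Sum>i<s. b i j * b i k) - real s * of_bool (j = k))\<^sup>2)"

lemma gram_dev_nonneg [simp]: "0 \<le> gram_dev s t b"
  by (simp add: gram_dev_def sum_nonneg)

text \<open>The centred Gram entries have variance 2 s on the diagonal and s off it, and t^2 s + t s
  is the stated value.\<close>

lemma gauss_prod_gram_dev:
  assumes I: "finite I" and inI: "\<And>i j. i < s \<Longrightarrow> j < t \<Longrightarrow> \<iota> i j \<in> I"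
    and inj: "\<And>i j i' j'. \<iota> i j = \<iota> i' j' \<longleftrightarrow> i = i' \<and> j = j'"
  shows "integrable (gauss_prod I) (\<lambda>x. gram_dev s t (\<lambda>i j. x (\<iota> i j)))"
    and "(\<integral>x. gram_dev s t (\<lambda>i j. x (\<iota> i j)) \<partial>gauss_prod I) = real s * real t * (real t + 1)"
proof -
  interpret prob_space "gauss_prod I" by (rule prob_space_gauss_prod)
  let ?g = "\<lambda>x i i' j k. x (\<iota> i j) * x (\<iota> i k) * (x (\<iota> i' j) * x (\<iota> i' k))"
  \<comment> \<open>Expanding the square leaves a cross term on the diagonal only, where the Gram
    entry is a sum of squares.\<close>
  have sq: "((\<Sum>i<s. x (\<iota> i j) * x (\<iota> i k)) - real s * of_bool (j = k))\<^sup>2 =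
      (\<Sum>i<s. \<Sum>i'<s. ?g x i i' j k) - 2 * real s * of_bool (j = k) * (\<Sum>i<s. (x (\<iota> i j))\<^sup>2)
        + (real s)\<^sup>2 * of_bool (j = k)" for x j k
  proof -
    have S: "(\<Sum>i<s. x (\<iota> i j) * x (\<iota> i k))\<^sup>2 = (\<Sum>i<s. \<Sum>i'<s. ?g x i i' j k)"
      unfolding power2_eq_square[of "sum _ _"] sum_product ..
    show ?thesis
    proof (cases "j = k")
      case True
      then have "(\<Sum>i<s. x (\<iota> i j) * x (\<iota> i k)) = (\<Sum>i<s. (x (\<iota> i j))\<^sup>2)" by (simp add: power2_eq_square)
      then show ?thesis unfolding S[symmetric] using True by (simp add: power2_diff)
    next
      case False
      then show ?thesis unfolding S[symmetric] by simp
    qed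
  qed
  have gi: "integrable (gauss_prod I) (\<lambda>x. ?g x i i' j k)" if "i < s" "i' < s" "j < t" "k < t" for i i' j k
    using that by (intro gauss_prod_fourth_moment(1)[OF I]) (auto intro: inI)
  have ii: "integrable (gauss_prod I) (\<lambda>x. \<Sum>i<s. \<Sum>i'<s. ?g x i i' j k)" if "j < t" "k < t" for j k
    using that by (intro Bochner_Integration.integrable_sum gi) auto
  have i2: "integrable (gauss_prod I) (\<lambda>x. \<Sum>i<s. (x (\<iota> i j))\<^sup>2)" if "j < t" for j
    using that by (intro Bochner_Integration.integrable_sum gauss_prod_second_moment(1)[OF I] inI) auto
  have e2: "(\<integral>x. (\<Sum>i<s. (x (\<iota> i j))\<^sup>2) \<partial>gauss_prod I) = real s" if "j < t" for j
    using that by (subst Bochner_Integration.integral_sum)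
      (auto simp: gauss_prod_second_moment[OF I] inI)
  have "(\<integral>x. (\<Sum>i<s. \<Sum>i'<s. ?g x i i' j k) \<partial>gauss_prod I) =
      (\<Sum>i<s. \<Sum>i'<s. if i = i' then (if j = k then 3 else 1) else (if j = k then 1 else 0))" if "j < t" "k < t" for j k
    using that by (subst Bochner_Integration.integral_sum, (intro Bochner_Integration.integrable_sum gi; simp))
      (auto intro!: sum.cong simp: Bochner_Integration.integral_sum gi gauss_prod_gram_moment[OF I inI inj])
  also have "(\<Sum>i<s. \<Sum>i'<s. if i = i' then (if j = k then 3 else 1) else (if j = k then 1 else 0)) =
      (if j = k then (real s)\<^sup>2 + 2 * real s else real s)" for j k :: nat
  proof (cases "j = k")
    case True
    have "(\<Sum>i<s. \<Sum>i'<s. if i = i' then 3 else 1 :: real) = (\<Sum>i<s. \<Sum>i'<s. 1 + (if i = i' then 2 else 0))"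
      by (intro sum.cong) auto
    then show ?thesis using True by (simp add: sum.distrib power2_eq_square algebra_simps)
  qed simp
  finally have e4: "(\<integral>x. (\<Sum>i<s. \<Sum>i'<s. ?g x i i' j k) \<partial>gauss_prod I) =
      (if j = k then (real s)\<^sup>2 + 2 * real s else real s)" if "j < t" "k < t" for j k
    using that by simp
  let ?h = "\<lambda>x j k. ((\<Sum>i<s. x (\<iota> i j) * x (\<iota> i k)) - real s * of_bool (j = k))\<^sup>2"
  have hi: "integrable (gauss_prod I) (\<lambda>x. ?h x j k)" if "j < t" "k < t" for j k
    unfolding sq using that ii i2 by (intro Bochner_Integration.integrable_add Bochner_Integration.integrable_diff
        integrable_mult_right integrable_const) auto
  have he: "(\<integral>x. ?h x j k \<partial>gauss_prod I) = (if j = k then 2 * real s else real s)" if "j < t" "k < t" for j k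
    unfolding sq using that ii[OF that] i2[OF that(1)] e2[OF that(1)] e4[OF that]
    by (cases "j = k") (simp_all add: prob_space power2_eq_square)
  show "integrable (gauss_prod I) (\<lambda>x. gram_dev s t (\<lambda>i j. x (\<iota> i j)))"
    unfolding gram_dev_def by (intro Bochner_Integration.integrable_sum hi) auto
  have "(\<integral>x. gram_dev s t (\<lambda>i j. x (\<iota> i j)) \<partial>gauss_prod I) = (\<Sum>j<t. \<Sum>k<t. \<integral>x. ?h x j k \<partial>gauss_prod I)"
    unfolding gram_dev_def
    by (subst Bochner_Integration.integral_sum, (intro Bochner_Integration.integrable_sum hi; simp))
      (auto intro!: sum.cong Bochner_Integration.integral_sum hi)
  also have "\<dots> = (\<Sum>j<t. \<Sum>k<t. real s + (if j = k then real s else 0))"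
    by (intro sum.cong) (auto simp: he)
  also have "\<dots> = real s * real t * (real t + 1)"
    by (simp add: sum.distrib algebra_simps)
  finally show "(\<integral>x. gram_dev s t (\<lambda>i j. x (\<iota> i j)) \<partial>gauss_prod I) = real s * real t * (real t + 1)" .
qed

section \<open>Unbounded Lipschitz functions\<close>

lemma (in prob_space) integrable_of_square:
  fixes h :: "'a \<Rightarrow> real"
  assumes [measurable]: "h \<in> borel_measurable M" and h2: "integrable M (\<lambda>x. (h x)\<^sup>2)"
  shows "integrable M h" and "(\<integral>x. h x \<partial>M)\<^sup>2 \<le> (\<integral>x. (h x)\<^sup>2 \<partial>M)"
proof -
  have b: "\<bar>h x\<bar> \<le> 1 + (h x)\<^sup>2" for x
  proof -
    have "0 \<le> (\<bar>h x\<bar> - 1)\<^sup>2" by simp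
    then have "2 * \<bar>h x\<bar> \<le> 1 + (h x)\<^sup>2" by (simp add: power2_diff)
    then show ?thesis using abs_ge_zero[of "h x"] by linarith
  qed
  have "integrable M (\<lambda>x. 1 + (h x)\<^sup>2)" using h2 by simp
  then show h: "integrable M h"
    by (rule Bochner_Integration.integrable_bound) (use b in \<open>auto intro!: AE_I2 order.trans[OF b abs_ge_self]\<close>)
  define m where "m = (\<integral>x. h x \<partial>M)"
  have "0 \<le> (\<integral>x. (h x - m)\<^sup>2 \<partial>M)" by (intro integral_nonneg_AE) auto
  also have "\<dots> = (\<integral>x. (h x)\<^sup>2 \<partial>M) - m\<^sup>2"
    using h h2 by (simp add: power2_diff prob_space m_def[symmetric]) (simp add: m_def power2_eq_square)
  finally show "(\<integral>x. h x \<partial>M)\<^sup>2 \<le> (\<integral>x. (h x)\<^sup>2 \<partial>M)" by (simp add: m_def)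
qed

lemma lipschitz_l2_integrable:
  fixes f :: "('i::countable \<Rightarrow> real) \<Rightarrow> real"
  assumes I: "finite I" and f: "lipschitz_l2 I f"
  shows "integrable (gauss_prod I) (\<lambda>x. (f x)\<^sup>2)" and "integrable (gauss_prod I) f"
proof -
  interpret prob_space "gauss_prod I" by (rule prob_space_gauss_prod)
  have [measurable]: "f \<in> borel_measurable (gauss_prod I)" by (rule lipschitz_l2_measurable[OF I f])
  let ?z = "\<lambda>_. 0 :: real"
  have b: "(f x)\<^sup>2 \<le> 2 * (f ?z)\<^sup>2 + 2 * (\<Sum>i\<in>I. (x i)\<^sup>2)" for x
  proof -
    have "\<bar>f x - f ?z\<bar> \<le> sqrt (sq_dist I x ?z)" using f by (simp add: lipschitz_l2_def)
    then have "\<bar>f x - f ?z\<bar>\<^sup>2 \<le> (sqrt (sq_dist I x ?z))\<^sup>2" by (intro power_mono) auto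
    then have "(f x - f ?z)\<^sup>2 \<le> (\<Sum>i\<in>I. (x i)\<^sup>2)" by (simp add: sq_dist_def sum_nonneg)
    \<comment> \<open>For a = f x and b = f 0, the difference 2 (a - b)^2 + 2 b^2 - a^2 is the
      square (a - 2 b)^2.\<close>
    moreover have "0 \<le> (f x - 2 * f ?z)\<^sup>2" by simp
    ultimately show ?thesis by (simp add: power2_eq_square algebra_simps)
  qed
  have "integrable (gauss_prod I) (\<lambda>x. 2 * (f ?z)\<^sup>2 + 2 * (\<Sum>i\<in>I. (x i)\<^sup>2))"
    by (intro Bochner_Integration.integrable_add integrable_mult_right Bochner_Integration.integrable_sum
        gauss_prod_second_moment(1)[OF I] integrable_const)
  then show "integrable (gauss_prod I) (\<lambda>x. (f x)\<^sup>2)"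
    by (rule Bochner_Integration.integrable_bound) (auto intro!: AE_I2 order.trans[OF b abs_ge_self])
  then show "integrable (gauss_prod I) f" by (rule integrable_of_square(1)[rotated]) measurable
qed

text \<open>Truncation at the levels - k and k. It is 1-Lipschitz, so composition preserves
  \<open>lipschitz_l2\<close>, and it is dominated by the identity in modulus, so expectations
  converge.\<close>

definition clip :: "nat \<Rightarrow> real \<Rightarrow> real" where
  "clip k y = max (- real k) (min (real k) y)"

lemma clip_bounds: "\<bar>clip k y\<bar> \<le> real k" "\<bar>clip k y\<bar> \<le> \<bar>y\<bar>"
  by (auto simp: clip_def)

lemma clip_lipschitz: "\<bar>clip k y - clip k z\<bar> \<le> \<bar>y - z\<bar>"
  by (auto simp: clip_def max_def min_def)

lemma clip_tendsto: "(\<lambda>k. clip k y) \<longlonglongrightarrow> y"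
proof (rule tendsto_eventually)
  obtain N where "\<bar>y\<bar> \<le> real N" using real_arch_simple by blast
  then show "eventually (\<lambda>k. clip k y = y) sequentially"
    by (intro eventually_sequentiallyI[of N]) (auto simp: clip_def)
qed

lemma clip_measurable [measurable]: "clip k \<in> borel_measurable borel"
  unfolding clip_def[abs_def] by measurable

lemma lipschitz_l2_clip: "lipschitz_l2 I f \<Longrightarrow> lipschitz_l2 I (\<lambda>x. clip k (f x))"
  unfolding lipschitz_l2_def using clip_lipschitz order.trans by blast

lemma clip_integral_tendsto:
  fixes f :: "'a \<Rightarrow> real"
  assumes f: "integrable M f"
  shows "(\<lambda>k. \<integral>x. clip k (f x) \<partial>M) \<longlonglongrightarrow> (\<integral>x. f x \<partial>M)"
proof (rule integral_dominated_convergence[where w = "\<lambda>x. \<bar>f x\<bar>"])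
  show "f \<in> borel_measurable M" using f by simp
  then show "(\<lambda>x. clip k (f x)) \<in> borel_measurable M" for k by measurable
qed (use f clip_tendsto clip_bounds(2) in auto)

text \<open>The bounded case applies to the truncations of \<open>f\<close>. Their means differ from
  the mean of \<open>f\<close>, so the deviation is adjusted for each \<open>k\<close> and tends to
  \<open>t\<close>.\<close>

theorem gaussian_concentration:
  fixes f :: "('i::countable \<Rightarrow> real) \<Rightarrow> real"
  assumes I: "finite I" and f: "lipschitz_l2 I f" and t: "0 \<le> t"
  shows "measure (gauss_prod I) {x \<in> space (gauss_prod I). (\<integral>x. f x \<partial>gauss_prod I) + t \<le> f x} \<le> exp (- t\<^sup>2 / 2)"
proof -
  interpret prob_space "gauss_prod I" by (rule prob_space_gauss_prod)
  have [measurable]: "f \<in> borel_measurable (gauss_prod I)" by (rule lipschitz_l2_measurable[OF I f])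
  define m where "m = (\<integral>x. f x \<partial>gauss_prod I)"
  define mk where "mk k = (\<integral>x. clip k (f x) \<partial>gauss_prod I)" for k
  have mk: "mk \<longlonglongrightarrow> m"
    unfolding mk_def m_def by (rule clip_integral_tendsto[OF lipschitz_l2_integrable(2)[OF I f]])
  \<comment> \<open>From this level on, truncation does not destroy the event:
    \<open>m + t \<le> f x\<close> still implies \<open>m + t \<le> clip k (f x)\<close>.\<close>
  obtain N where N: "\<bar>m + t\<bar> \<le> real N" using real_arch_simple by blast
  \<comment> \<open>The deviation as seen from the mean of the truncated function. If the difference
    is negative, the value 0 makes the claimed bound equal to 1.\<close>
  define s where "s k = max 0 (m + t - mk k)" for k
  have "(\<lambda>k. exp (- (s k)\<^sup>2 / 2)) \<longlonglongrightarrow> exp (- (max 0 (m + t - m))\<^sup>2 / 2)"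
    unfolding s_def by (intro tendsto_intros mk) simp
  then have lim: "(\<lambda>k. exp (- (s k)\<^sup>2 / 2)) \<longlonglongrightarrow> exp (- t\<^sup>2 / 2)" using t by simp
  have "prob {x \<in> space (gauss_prod I). m + t \<le> f x} \<le> exp (- (s k)\<^sup>2 / 2)" if k: "k \<ge> N" for k
  proof (cases "m + t - mk k \<ge> 0")
    case True
    have "prob {x \<in> space (gauss_prod I). m + t \<le> f x} \<le>
        prob {x \<in> space (gauss_prod I). mk k + s k \<le> clip k (f x)}"
      using N k True by (intro finite_measure_mono) (auto simp: s_def clip_def)
    also have "\<dots> \<le> exp (- (s k)\<^sup>2 / 2)"
      unfolding mk_def
      by (intro bounded_lipschitz_tail[OF I _ lipschitz_l2_clip[OF f], of _ "real k"])
        (auto simp: s_def clip_bounds)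
    finally show ?thesis .
  next
    case False
    then have "s k = 0" by (simp add: s_def)
    then show ?thesis by simp
  qed
  then have "eventually (\<lambda>k. prob {x \<in> space (gauss_prod I). m + t \<le> f x} \<le> exp (- (s k)\<^sup>2 / 2)) sequentially"
    by (auto simp: eventually_sequentially)
  then show ?thesis
    unfolding m_def[symmetric] by (intro tendsto_lowerbound[OF lim]) auto
qed

theorem gaussian_variance:
  fixes f :: "('i::countable \<Rightarrow> real) \<Rightarrow> real"
  assumes I: "finite I" and f: "lipschitz_l2 I f"
  shows "(\<integral>x. (f x)\<^sup>2 \<partial>gauss_prod I) \<le> 1 + (\<integral>x. f x \<partial>gauss_prod I)\<^sup>2"
proof -
  interpret prob_space "gauss_prod I" by (rule prob_space_gauss_prod)
  have [measurable]: "f \<in> borel_measurable (gauss_prod I)" by (rule lipschitz_l2_measurable[OF I f])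
  have 1: "(\<lambda>k. \<integral>x. (clip k (f x))\<^sup>2 \<partial>gauss_prod I) \<longlonglongrightarrow> (\<integral>x. (f x)\<^sup>2 \<partial>gauss_prod I)"
  proof (rule integral_dominated_convergence[where w = "\<lambda>x. (f x)\<^sup>2"])
    show "integrable (gauss_prod I) (\<lambda>x. (f x)\<^sup>2)" by (rule lipschitz_l2_integrable(1)[OF I f])
    show "AE x in gauss_prod I. (\<lambda>k. (clip k (f x))\<^sup>2) \<longlonglongrightarrow> (f x)\<^sup>2"
      by (intro AE_I2 tendsto_intros clip_tendsto)
    show "AE x in gauss_prod I. norm ((clip k (f x))\<^sup>2) \<le> (f x)\<^sup>2" for k
      using clip_bounds(2) by (intro AE_I2) (simp add: abs_le_square_iff)
  qed measurable
  have 2: "(\<lambda>k. 1 + (\<integral>x. clip k (f x) \<partial>gauss_prod I)\<^sup>2) \<longlonglongrightarrow> 1 + (\<integral>x. f x \<partial>gauss_prod I)\<^sup>2"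
    by (intro tendsto_intros clip_integral_tendsto lipschitz_l2_integrable(2)[OF I f])
  show ?thesis
  proof (rule LIMSEQ_le[OF 1 2], intro exI allI impI)
    fix k
    show "(\<integral>x. (clip k (f x))\<^sup>2 \<partial>gauss_prod I) \<le> 1 + (\<integral>x. clip k (f x) \<partial>gauss_prod I)\<^sup>2"
      by (intro bounded_lipschitz_variance[OF I _ lipschitz_l2_clip[OF f], of _ "real k"])
        (auto simp: clip_bounds)
  qed
qed

section \<open>Rotation invariance\<close>

text \<open>Levy's uniqueness theorem for a signed weight: if the weighted characteristic function
  of \<open>X\<close> is \<open>w\<close> times the standard normal one, then the weighted law is
  \<open>w\<close> times the standard normal law. In the application the weight collects indicators
  and phases of the other coordinates.\<close>

lemma std_normal_law_weighted:
  fixes X W :: "'a \<Rightarrow> real"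
  assumes "prob_space M" and [measurable]: "X \<in> borel_measurable M" "W \<in> borel_measurable M"
    and W: "\<And>\<omega>. \<bar>W \<omega>\<bar> \<le> 1"
    and X1: "\<And>s. (\<integral>\<omega>. cos (s * X \<omega>) \<partial>M) = exp (- s\<^sup>2 / 2)" "\<And>s. (\<integral>\<omega>. sin (s * X \<omega>) \<partial>M) = 0"
    and XW: "\<And>s. (\<integral>\<omega>. W \<omega> * cos (s * X \<omega>) \<partial>M) = w * exp (- s\<^sup>2 / 2)"
      "\<And>s. (\<integral>\<omega>. W \<omega> * sin (s * X \<omega>) \<partial>M) = 0"
    and [measurable]: "A \<in> sets borel"
  shows "(\<integral>\<omega>. W \<omega> * indicator A (X \<omega>) \<partial>M) = w * measure std_normal_distribution A"
proof -
  interpret prob_space M by fact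
  have bi: "integrable M (\<lambda>\<omega>. h \<omega>)" if [measurable]: "h \<in> borel_measurable M" and "\<And>\<omega>. \<bar>h \<omega>\<bar> \<le> 1" for h :: "'a \<Rightarrow> real"
    using that by (intro integrable_const_bound[of _ 1]) auto
  have Wb: "\<bar>W \<omega> * c\<bar> \<le> 1" if "\<bar>c\<bar> \<le> 1" for \<omega> c
    using W[of \<omega>] that by (simp add: abs_mult mult_le_one)
  text \<open>As W may change sign, the measures with densities proportional to 2 and 2 + W are compared.\<close>
  have law: "(\<integral>\<omega>. (2 + V \<omega>) * indicator A (X \<omega>) \<partial>M) = (2 + v) * measure std_normal_distribution A"
    if [measurable]: "V \<in> borel_measurable M" and V: "\<And>\<omega>. \<bar>V \<omega>\<bar> \<le> 1"
      and VX: "\<And>s. (\<integral>\<omega>. V \<omega> * cos (s * X \<omega>) \<partial>M) = v * exp (- s\<^sup>2 / 2)"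
        "\<And>s. (\<integral>\<omega>. V \<omega> * sin (s * X \<omega>) \<partial>M) = 0" for V v
  proof -
    have Vb: "\<bar>V \<omega> * c\<bar> \<le> 1" if "\<bar>c\<bar> \<le> 1" for \<omega> c
      using V[of \<omega>] that by (simp add: abs_mult mult_le_one)
    have Vc: "\<bar>V \<omega> * cos y\<bar> \<le> 1" "\<bar>V \<omega> * sin y\<bar> \<le> 1" for \<omega> y by (rule Vb; simp)+
    have Vi: "integrable M V" using V by (intro bi) auto
    have Ev: "(\<integral>\<omega>. V \<omega> \<partial>M) = v" using VX(1)[of 0] by simp
    have "\<bar>v\<bar> \<le> 1"
    proof -
      have "\<bar>v\<bar> \<le> (\<integral>\<omega>. \<bar>V \<omega>\<bar> \<partial>M)" unfolding Ev[symmetric] by (rule integral_abs_bound)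
      also have "\<dots> \<le> (\<integral>\<omega>. 1 \<partial>M)" using V Vi by (intro integral_mono) auto
      finally show ?thesis by (simp add: prob_space)
    qed
    then have v: "2 + v > 0" by linarith
    have V2: "0 \<le> 2 + V \<omega>" for \<omega> using V[of \<omega>] by linarith
    define D where "D \<omega> = (2 + V \<omega>) / (2 + v)" for \<omega>
    have D: "0 \<le> D \<omega>" for \<omega> using V2[of \<omega>] v by (simp add: D_def)
    have [measurable]: "D \<in> borel_measurable M" unfolding D_def[abs_def] by measurable
    let ?N = "density M (\<lambda>\<omega>. ennreal (D \<omega>))"
    have Di: "integrable M D" using Vi by (simp add: D_def[abs_def])
    have ED: "(\<integral>\<omega>. D \<omega> \<partial>M) = 1" using Vi v by (simp add: D_def[abs_def] Ev prob_space)
    have N: "prob_space ?N"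
      by (rule prob_spaceI) (simp add: emeasure_density nn_integral_eq_integral[OF Di] D ED)
    have NI: "(\<integral>\<omega>. h \<omega> \<partial>?N) = (\<integral>\<omega>. (2 + V \<omega>) * h \<omega> \<partial>M) / (2 + v)"
      if [measurable]: "h \<in> borel_measurable M" for h :: "'a \<Rightarrow> real"
      using D by (subst integral_density) (auto simp: D_def)
    have Nc: "(\<integral>\<omega>. cos (s * X \<omega>) \<partial>?N) = exp (- s\<^sup>2 / 2)" for s
    proof -
      have "(\<integral>\<omega>. (2 + V \<omega>) * cos (s * X \<omega>) \<partial>M) = (\<integral>\<omega>. 2 * cos (s * X \<omega>) + V \<omega> * cos (s * X \<omega>) \<partial>M)"
        by (simp add: algebra_simps)
      also have "\<dots> = (2 + v) * exp (- s\<^sup>2 / 2)"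
        by (subst Bochner_Integration.integral_add)
          (auto intro!: bi Vc simp: X1 VX ring_distribs)
      finally show ?thesis using v by (subst NI) auto
    qed
    have Ns: "(\<integral>\<omega>. sin (s * X \<omega>) \<partial>?N) = 0" for s
    proof -
      have "(\<integral>\<omega>. (2 + V \<omega>) * sin (s * X \<omega>) \<partial>M) = (\<integral>\<omega>. 2 * sin (s * X \<omega>) + V \<omega> * sin (s * X \<omega>) \<partial>M)"
        by (simp add: algebra_simps)
      also have "\<dots> = 0"
        by (subst Bochner_Integration.integral_add) (auto intro!: bi Vc simp: X1 VX)
      finally show ?thesis by (subst NI) auto
    qed
    interpret N: prob_space ?N by (rule N)
    have rd: "real_distribution (distr ?N borel X)"
      by (intro real_distribution.intro N.prob_space_distr) (auto intro: real_distribution_axioms.intro)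
    have euler: "iexp y = complex_of_real (cos y) + \<i> * complex_of_real (sin y)" for y
      by (simp only: exp_Euler cos_of_real sin_of_real)
    have "char (distr ?N borel X) = char std_normal_distribution"
    proof
      fix s
      have "char (distr ?N borel X) s = (\<integral>\<omega>. iexp (s * X \<omega>) \<partial>?N)"
        unfolding char_def by (subst integral_distr) auto
      also have "\<dots> = (\<integral>\<omega>. complex_of_real (cos (s * X \<omega>)) + \<i> * complex_of_real (sin (s * X \<omega>)) \<partial>?N)"
        by (simp only: euler)
      also have "\<dots> = (\<integral>\<omega>. complex_of_real (cos (s * X \<omega>)) \<partial>?N) + (\<integral>\<omega>. \<i> * complex_of_real (sin (s * X \<omega>)) \<partial>?N)"
        by (intro Bochner_Integration.integral_add integrable_mult_right N.integrable_const_bound[of _ 1]) (auto simp: norm_mult)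
      also have "\<dots> = complex_of_real (exp (- s\<^sup>2 / 2))"
        by (simp add: Nc Ns)
      finally show "char (distr ?N borel X) s = char std_normal_distribution s"
        by (simp add: char_std_normal_distribution)
    qed
    then have "distr ?N borel X = std_normal_distribution"
      by (intro Levy_uniqueness rd real_dist_normal_dist)
    then have "measure std_normal_distribution A = measure (distr ?N borel X) A" by simp
    also have "\<dots> = (\<integral>x. indicator A x \<partial>distr ?N borel X)" by simp
    also have "\<dots> = (\<integral>\<omega>. indicator A (X \<omega>) \<partial>?N)" by (subst integral_distr) auto
    also have "\<dots> = (\<integral>\<omega>. (2 + V \<omega>) * indicator A (X \<omega>) \<partial>M) / (2 + v)" by (rule NI) measurable
    finally show ?thesis using v by simp
  qed
  have iA: "integrable M (\<lambda>\<omega>. indicator A (X \<omega>) :: real)" "integrable M (\<lambda>\<omega>. W \<omega> * indicator A (X \<omega>))"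
    using Wb by (auto intro!: bi simp: indicator_def)
  \<comment> \<open>The case of weight \<open>W\<close> minus the case of weight 0 leaves the
    contribution of \<open>W\<close> alone.\<close>
  have "(\<integral>\<omega>. 2 * indicator A (X \<omega>) \<partial>M) + (\<integral>\<omega>. W \<omega> * indicator A (X \<omega>) \<partial>M) = (2 + w) * measure std_normal_distribution A"
    using law[of W w] W XW iA by (subst Bochner_Integration.integral_add[symmetric]) (auto simp: algebra_simps)
  moreover have "(\<integral>\<omega>. 2 * indicator A (X \<omega>) \<partial>M) = 2 * measure std_normal_distribution A"
    using law[of "\<lambda>_. 0" 0] by simp
  ultimately show ?thesis by (simp add: algebra_simps)
qed

text \<open>Multivariate uniqueness from the univariate one: the exponential factors are replaced by
  indicators one coordinate at a time. When coordinate \<open>k\<close> is treated, the weights are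
  the indicators already present times the cosine or the sine of the remaining phase.\<close>

lemma gauss_prod_characterisation:
  fixes X :: "'i \<Rightarrow> 'a \<Rightarrow> real"
  assumes "prob_space M" and I: "finite I" and Xm: "\<And>i. i \<in> I \<Longrightarrow> X i \<in> borel_measurable M"
    and cos: "\<And>t. (\<integral>\<omega>. cos (\<Sum>i\<in>I. t i * X i \<omega>) \<partial>M) = exp (- (\<Sum>i\<in>I. (t i)\<^sup>2) / 2)"
    and sin: "\<And>t. (\<integral>\<omega>. sin (\<Sum>i\<in>I. t i * X i \<omega>) \<partial>M) = 0"
  shows "distr M (PiM I (\<lambda>_. borel)) (\<lambda>\<omega>. \<lambda>i\<in>I. X i \<omega>) = gauss_prod I"
proof -
  interpret prob_space M by fact
  let ?m = "measure std_normal_distribution"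
  have main: "(\<integral>\<omega>. (\<Prod>j\<in>J. indicator (A j) (X j \<omega>)) * cos (\<Sum>i\<in>I - J. t i * X i \<omega>) \<partial>M) =
        (\<Prod>j\<in>J. ?m (A j)) * exp (- (\<Sum>i\<in>I - J. (t i)\<^sup>2) / 2) \<and>
      (\<integral>\<omega>. (\<Prod>j\<in>J. indicator (A j) (X j \<omega>)) * sin (\<Sum>i\<in>I - J. t i * X i \<omega>) \<partial>M) = 0"
    if "J \<subseteq> I" and A: "\<And>j. A j \<in> sets borel" for J t and A :: "'i \<Rightarrow> real set"
    using finite_subset[OF \<open>J \<subseteq> I\<close> I] \<open>J \<subseteq> I\<close>
  proof (induction J arbitrary: t rule: finite_induct)
    case empty
    then show ?case using cos[of t] sin[of t] by simp
  next
    case (insert k J)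
    define P where "P \<omega> = (\<Prod>j\<in>J. indicator (A j) (X j \<omega>) :: real)" for \<omega>
    define \<theta> where "\<theta> \<omega> = (\<Sum>i\<in>I - insert k J. t i * X i \<omega>)" for \<omega>
    define c where "c = (\<Prod>j\<in>J. ?m (A j)) * exp (- (\<Sum>i\<in>I - insert k J. (t i)\<^sup>2) / 2)"
    have kI: "k \<in> I" "J \<subseteq> I" using insert.prems by auto
    have [measurable]: "X k \<in> borel_measurable M" by (rule Xm[OF kI(1)])
    have "(\<lambda>\<omega>. indicator (A j) (X j \<omega>) :: real) \<in> borel_measurable M" if "j \<in> J" for j
      using measurable_compose[OF Xm borel_measurable_indicator[OF A]] that kI by blast
    then have [measurable]: "P \<in> borel_measurable M"
      unfolding P_def[abs_def] by (intro borel_measurable_prod)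
    have [measurable]: "\<theta> \<in> borel_measurable M"
      unfolding \<theta>_def[abs_def] by (intro borel_measurable_sum borel_measurable_times borel_measurable_const Xm) auto
    have P1: "\<bar>P \<omega>\<bar> \<le> 1" for \<omega>
      unfolding P_def by (auto simp: abs_prod indicator_def intro!: prod_le_1)
    have Pb: "\<bar>P \<omega> * r\<bar> \<le> 1" if "\<bar>r\<bar> \<le> 1" for \<omega> r
      using P1[of \<omega>] that by (simp add: abs_mult mult_le_one)
    have IJ: "I - J = insert k (I - insert k J)" using kI insert.hyps by auto
    have ih: "(\<integral>\<omega>. P \<omega> * cos (\<theta> \<omega> + s * X k \<omega>) \<partial>M) = c * exp (- s\<^sup>2 / 2)"
      "(\<integral>\<omega>. P \<omega> * sin (\<theta> \<omega> + s * X k \<omega>) \<partial>M) = 0" for s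
    proof -
      have e: "(\<Sum>i\<in>I - J. (t(k := s)) i * X i \<omega>) = \<theta> \<omega> + s * X k \<omega>" for \<omega>
        unfolding IJ \<theta>_def using I by (simp add: add.commute)
      have e2: "(\<Sum>i\<in>I - J. ((t(k := s)) i)\<^sup>2) = (\<Sum>i\<in>I - insert k J. (t i)\<^sup>2) + s\<^sup>2"
        unfolding IJ using I by (simp add: add.commute)
      have e3: "exp (- (S + s\<^sup>2) / 2) = exp (- S / 2) * exp (- s\<^sup>2 / 2)" for S :: real
        by (simp add: exp_add[symmetric] field_simps)
      show "(\<integral>\<omega>. P \<omega> * cos (\<theta> \<omega> + s * X k \<omega>) \<partial>M) = c * exp (- s\<^sup>2 / 2)"
        "(\<integral>\<omega>. P \<omega> * sin (\<theta> \<omega> + s * X k \<omega>) \<partial>M) = 0"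
        using insert.IH[OF kI(2), of "t(k := s)"] unfolding e e2 e3 P_def[symmetric]
        by (auto simp: c_def)
    qed
    have bi: "integrable M h" if [measurable]: "h \<in> borel_measurable M" and "\<And>\<omega>. \<bar>h \<omega>\<bar> \<le> 1" for h :: "'a \<Rightarrow> real"
      using that by (intro integrable_const_bound[of _ 1]) auto
    have ci: "integrable M (\<lambda>\<omega>. P \<omega> * cos (\<theta> \<omega> + s * X k \<omega>))" for s
      by (rule bi) (use Pb in \<open>simp_all add: abs_cos_le_one\<close>)
    have si: "integrable M (\<lambda>\<omega>. P \<omega> * sin (\<theta> \<omega> + s * X k \<omega>))" for s
      by (rule bi) (use Pb in \<open>simp_all add: abs_sin_le_one\<close>)
    \<comment> \<open>Product-to-sum formulas express each weighted integral through the induction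
      hypothesis at the coefficients \<open>s\<close> and \<open>- s\<close> of
      \<open>X k\<close>.\<close>
    have cc: "P \<omega> * cos (\<theta> \<omega>) * cos (s * X k \<omega>) =
        (P \<omega> * cos (\<theta> \<omega> + s * X k \<omega>) + P \<omega> * cos (\<theta> \<omega> + - s * X k \<omega>)) / 2"
      and cs: "P \<omega> * cos (\<theta> \<omega>) * sin (s * X k \<omega>) =
        (P \<omega> * sin (\<theta> \<omega> + s * X k \<omega>) - P \<omega> * sin (\<theta> \<omega> + - s * X k \<omega>)) / 2"
      and sc: "P \<omega> * sin (\<theta> \<omega>) * cos (s * X k \<omega>) =
        (P \<omega> * sin (\<theta> \<omega> + s * X k \<omega>) + P \<omega> * sin (\<theta> \<omega> + - s * X k \<omega>)) / 2"
      and ss: "P \<omega> * sin (\<theta> \<omega>) * sin (s * X k \<omega>) =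
        (P \<omega> * cos (\<theta> \<omega> + - s * X k \<omega>) - P \<omega> * cos (\<theta> \<omega> + s * X k \<omega>)) / 2" for \<omega> s
      by (simp_all add: cos_add sin_add cos_diff sin_diff algebra_simps)
    have X0: "(\<integral>\<omega>. cos (s * X k \<omega>) \<partial>M) = exp (- s\<^sup>2 / 2)" "(\<integral>\<omega>. sin (s * X k \<omega>) \<partial>M) = 0" for s
    proof -
      have "(\<Sum>i\<in>I. (if i = k then s else 0) * X i \<omega>) = s * X k \<omega>" for \<omega>
        using I kI by (simp add: if_distrib[of "\<lambda>z. z * _"] cong: if_cong)
      moreover have "(\<Sum>i\<in>I. (if i = k then s else 0)\<^sup>2) = s\<^sup>2"
        using I kI by (simp add: if_distrib[of "\<lambda>z. z\<^sup>2"] cong: if_cong)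
      ultimately show "(\<integral>\<omega>. cos (s * X k \<omega>) \<partial>M) = exp (- s\<^sup>2 / 2)" "(\<integral>\<omega>. sin (s * X k \<omega>) \<partial>M) = 0"
        using cos[of "\<lambda>i. if i = k then s else 0"] sin[of "\<lambda>i. if i = k then s else 0"] by simp_all
    qed
    have 1: "(\<integral>\<omega>. P \<omega> * cos (\<theta> \<omega>) * indicator (A k) (X k \<omega>) \<partial>M) = c * ?m (A k)"
    proof (rule std_normal_law_weighted[OF \<open>prob_space M\<close> _ _ _ X0])
      show "(\<integral>\<omega>. P \<omega> * cos (\<theta> \<omega>) * cos (s * X k \<omega>) \<partial>M) = c * exp (- s\<^sup>2 / 2)" for s
        unfolding cc using ci[of s] ci[of "- s"] by (simp only: integral_divide_zero Bochner_Integration.integral_add ih) simp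
      show "(\<integral>\<omega>. P \<omega> * cos (\<theta> \<omega>) * sin (s * X k \<omega>) \<partial>M) = 0" for s
        unfolding cs using si[of s] si[of "- s"] by (simp only: integral_divide_zero Bochner_Integration.integral_diff ih) simp
      show "\<bar>P \<omega> * cos (\<theta> \<omega>)\<bar> \<le> 1" for \<omega> by (rule Pb) simp
    qed (use A in auto)
    have 2: "(\<integral>\<omega>. P \<omega> * sin (\<theta> \<omega>) * indicator (A k) (X k \<omega>) \<partial>M) = 0 * ?m (A k)"
    proof (rule std_normal_law_weighted[OF \<open>prob_space M\<close> _ _ _ X0])
      show "(\<integral>\<omega>. P \<omega> * sin (\<theta> \<omega>) * cos (s * X k \<omega>) \<partial>M) = 0 * exp (- s\<^sup>2 / 2)" for s
        unfolding sc using si[of s] si[of "- s"] by (simp only: integral_divide_zero Bochner_Integration.integral_add ih) simp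
      show "(\<integral>\<omega>. P \<omega> * sin (\<theta> \<omega>) * sin (s * X k \<omega>) \<partial>M) = 0" for s
        unfolding ss using ci[of s] ci[of "- s"] by (simp only: integral_divide_zero Bochner_Integration.integral_diff ih) simp
      show "\<bar>P \<omega> * sin (\<theta> \<omega>)\<bar> \<le> 1" for \<omega> by (rule Pb) simp
    qed (use A in auto)
    have Pk: "(\<Prod>j\<in>insert k J. indicator (A j) (X j \<omega>)) * r = P \<omega> * r * indicator (A k) (X k \<omega>)" for \<omega> and r :: real
      using insert.hyps by (simp add: P_def)
    show ?case
      unfolding Pk \<theta>_def[symmetric] 1 2 using insert.hyps by (simp add: c_def)
  qed
  have "gauss_prod I = distr M (PiM I (\<lambda>_. borel)) (\<lambda>\<omega>. \<lambda>i\<in>I. X i \<omega>)"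
    unfolding gauss_prod_def
  proof (rule product_sigma_finite.PiM_eqI[OF product_sigma_finite_std_normal I, symmetric])
    show "sets (distr M (PiM I (\<lambda>_. borel)) (\<lambda>\<omega>. \<lambda>i\<in>I. X i \<omega>)) = sets (PiM I (\<lambda>_. std_normal_distribution))"
      using sets_gauss_prod[of I] by (simp add: gauss_prod_def)
    fix A :: "'i \<Rightarrow> real set"
    assume "\<And>i. i \<in> I \<Longrightarrow> A i \<in> sets std_normal_distribution"
    then have A: "\<And>i. i \<in> I \<Longrightarrow> A i \<in> sets borel" by simp
    \<comment> \<open>\<open>main\<close> asks for Borel sets at all indices, so the sets outside
      \<open>I\<close> are given the default value {}.\<close>
    define B where "B i = (if i \<in> I then A i else {})" for i
    have B: "B i \<in> sets borel" for i using A by (simp add: B_def)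
    have [measurable]: "(\<lambda>\<omega>. \<lambda>i\<in>I. X i \<omega>) \<in> measurable M (PiM I (\<lambda>_. borel))"
      by (rule measurable_restrict) (rule Xm)
    have PA: "PiE I A \<in> sets (PiM I (\<lambda>_. borel))"
      using A by (intro sets_PiM_I_finite I)
    have ind: "indicator ((\<lambda>\<omega>. \<lambda>i\<in>I. X i \<omega>) -` PiE I A \<inter> space M) \<omega> = (\<Prod>j\<in>I. indicator (B j) (X j \<omega>) :: real)"
      if "\<omega> \<in> space M" for \<omega>
    proof (cases "\<forall>i\<in>I. X i \<omega> \<in> A i")
      case True
      then have "\<omega> \<in> (\<lambda>\<omega>. \<lambda>i\<in>I. X i \<omega>) -` PiE I A \<inter> space M" using that by auto
      moreover have "(\<Prod>j\<in>I. indicator (B j) (X j \<omega>) :: real) = 1"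
        using True by (intro prod.neutral) (simp add: B_def)
      ultimately show ?thesis by simp
    next
      case False
      then obtain i where i: "i \<in> I" "X i \<omega> \<notin> A i" by blast
      then have "\<omega> \<notin> (\<lambda>\<omega>. \<lambda>i\<in>I. X i \<omega>) -` PiE I A \<inter> space M" by (auto simp: PiE_iff)
      moreover have "(\<Prod>j\<in>I. indicator (B j) (X j \<omega>) :: real) = 0"
        using i by (intro prod_zero[OF I] bexI[of _ i]) (simp_all add: B_def)
      ultimately show ?thesis by simp
    qed
    have "measure (distr M (PiM I (\<lambda>_. borel)) (\<lambda>\<omega>. \<lambda>i\<in>I. X i \<omega>)) (PiE I A) =
        prob ((\<lambda>\<omega>. \<lambda>i\<in>I. X i \<omega>) -` PiE I A \<inter> space M)"
      by (rule measure_distr[OF _ PA]) measurable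
    also have "\<dots> = (\<integral>\<omega>. indicator ((\<lambda>\<omega>. \<lambda>i\<in>I. X i \<omega>) -` PiE I A \<inter> space M) \<omega> \<partial>M)"
      by (simp add: Int_absorb2)
    also have "\<dots> = (\<integral>\<omega>. (\<Prod>j\<in>I. indicator (B j) (X j \<omega>)) \<partial>M)"
      by (intro Bochner_Integration.integral_cong refl ind)
    also have "\<dots> = (\<Prod>i\<in>I. ?m (A i))"
      using main[of I B "\<lambda>_. 0"] B by (simp add: B_def cong: prod.cong)
    finally have "measure (distr M (PiM I (\<lambda>_. borel)) (\<lambda>\<omega>. \<lambda>i\<in>I. X i \<omega>)) (PiE I A) = (\<Prod>i\<in>I. ?m (A i))" .
    moreover have "emeasure std_normal_distribution S = ennreal (?m S)" for S
      using prob_space_std_normal by (intro finite_measure.emeasure_eq_measure) (simp add: prob_space.finite_measure)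
    moreover have "finite_measure (distr M (PiM I (\<lambda>_. borel)) (\<lambda>\<omega>. \<lambda>i\<in>I. X i \<omega>))"
      by (intro finite_measure_distr) measurable
    ultimately show "emeasure (distr M (PiM I (\<lambda>_. borel)) (\<lambda>\<omega>. \<lambda>i\<in>I. X i \<omega>)) (PiE I A) =
        (\<Prod>i\<in>I. emeasure std_normal_distribution (A i))"
      by (simp add: finite_measure.emeasure_eq_measure prod_ennreal)
  qed
  then show ?thesis ..
qed

section \<open>Transposition, and the Ky Fan norm bounded through the Gram matrix\<close>

lemma ky_fan2_transpose:
  assumes "r \<le> n" "r \<le> q"
  shows "ky_fan2 r (fmat q n b) = ky_fan2 r (fmat n q (\<lambda>i j. b j i))"
proof -
  have le: "ky_fan2 r (fmat q n b) \<le> ky_fan2 r (fmat n q (\<lambda>i j. b j i))" if rn: "r \<le> n" "r \<le> q" for q n b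
  proof (rule power2_le_imp_le)
    obtain v where v: "orthonormal n r v" "(ky_fan2 r (fmat q n b))\<^sup>2 = (\<Sum>j<r. form q n b (v j) (v j))"
      using ky_fan2_attained[OF rn(1)] by blast
    have "(ky_fan2 r (fmat q n b))\<^sup>2 = (\<Sum>j<r. \<Sum>l<q. (\<Sum>i<n. v j i * b l i)\<^sup>2)"
      unfolding v(2) form_def ip_self by (simp add: ip_def mult.commute)
    also have "\<dots> \<le> (ky_fan2 r (fmat n q (\<lambda>i j. b j i)))\<^sup>2"
      by (rule ky_fan2_ge_left[OF v(1) rn(2)])
    finally show "(ky_fan2 r (fmat q n b))\<^sup>2 \<le> (ky_fan2 r (fmat n q (\<lambda>i j. b j i)))\<^sup>2" .
  qed simp
  show ?thesis
    using le[OF assms, of b] le[OF assms(2,1), of "\<lambda>i j. b j i"] by simp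
qed

text \<open>Let \<open>P\<close> be the projection onto the optimal family and \<open>D\<close> the
  deviation of the Gram matrix from \<open>q\<close> times the identity. The squared norm is the
  trace of \<open>P\<close> times the Gram matrix, which is r q plus the Frobenius inner product of
  \<open>P\<close> and \<open>D\<close>; Cauchy-Schwarz applies, the squared Frobenius norm of
  \<open>P\<close> being \<open>r\<close>.\<close>

lemma ky_fan2_sq_le_gram:
  assumes r: "r \<le> n"
  shows "(ky_fan2 r (fmat q n b))\<^sup>2 \<le> real r * real q + sqrt (real r * gram_dev q n b)"
proof -
  obtain v where v: "orthonormal n r v" "(ky_fan2 r (fmat q n b))\<^sup>2 = (\<Sum>j<r. form q n b (v j) (v j))"
    using ky_fan2_attained[OF r] by blast
  define D where "D l k = (\<Sum>i<q. b i l * b i k) - real q * of_bool (l = k)" for l k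
  define P where "P l k = (\<Sum>j<r. v j l * v j k)" for l k
  have form: "form q n b a a = real q * ip n a a + (\<Sum>l<n. \<Sum>k<n. a l * a k * D l k)" for a
  proof -
    have "form q n b a a = (\<Sum>i<q. \<Sum>l<n. \<Sum>k<n. (b i l * a l) * (b i k * a k))"
      unfolding form_def ip_def sum_product ..
    also have "\<dots> = (\<Sum>l<n. \<Sum>i<q. \<Sum>k<n. (b i l * a l) * (b i k * a k))" by (rule sum.swap)
    also have "\<dots> = (\<Sum>l<n. \<Sum>k<n. \<Sum>i<q. (b i l * a l) * (b i k * a k))"
      by (intro sum.cong refl sum.swap)
    also have "\<dots> = (\<Sum>l<n. \<Sum>k<n. a l * a k * (D l k + real q * of_bool (l = k)))"
      by (intro sum.cong refl) (simp add: D_def sum_distrib_left mult_ac)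
    also have "\<dots> = (\<Sum>l<n. \<Sum>k<n. a l * a k * D l k) + (\<Sum>l<n. \<Sum>k<n. a l * a k * (real q * of_bool (l = k)))"
      by (simp add: distrib_left sum.distrib)
    also have "(\<Sum>l<n. \<Sum>k<n. a l * a k * (real q * of_bool (l = k))) = real q * ip n a a"
      by (simp add: ip_def sum_distrib_left of_bool_def if_distrib mult_ac cong: if_cong)
    finally show ?thesis by simp
  qed
  have PP: "(\<Sum>l<n. \<Sum>k<n. (P l k)\<^sup>2) = real r"
  proof -
    have "(\<Sum>l<n. \<Sum>k<n. (P l k)\<^sup>2) = (\<Sum>l<n. \<Sum>k<n. \<Sum>j<r. \<Sum>j'<r. (v j l * v j' l) * (v j k * v j' k))"
      unfolding P_def power2_eq_square sum_product
      by (rule sum.cong[OF refl], rule sum.cong[OF refl], rule sum.cong[OF refl], rule sum.cong[OF refl])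
        (simp add: mult_ac)
    also have "\<dots> = (\<Sum>j<r. \<Sum>j'<r. \<Sum>l<n. \<Sum>k<n. (v j l * v j' l) * (v j k * v j' k))"
    proof -
      have "(\<Sum>l<n. \<Sum>k<n. \<Sum>j<r. \<Sum>j'<r. (v j l * v j' l) * (v j k * v j' k)) =
          (\<Sum>l<n. \<Sum>j<r. \<Sum>j'<r. \<Sum>k<n. (v j l * v j' l) * (v j k * v j' k))"
        by (rule sum.cong[OF refl], rule trans[OF sum.swap], rule sum.cong[OF refl], rule sum.swap)
      also have "\<dots> = (\<Sum>j<r. \<Sum>j'<r. \<Sum>l<n. \<Sum>k<n. (v j l * v j' l) * (v j k * v j' k))"
        by (rule trans[OF sum.swap], rule sum.cong[OF refl], rule sum.swap)
      finally show ?thesis .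
    qed
    also have "\<dots> = (\<Sum>j<r. \<Sum>j'<r. ip n (v j) (v j') * ip n (v j) (v j'))"
      unfolding ip_def sum_product ..
    also have "\<dots> = (\<Sum>j<r. \<Sum>j'<r. if j' = j then 1 else 0)"
      using orthonormalD[OF v(1)] by (intro sum.cong refl) auto
    also have "\<dots> = real r" by simp
    finally show ?thesis .
  qed
  have "(\<Sum>j<r. form q n b (v j) (v j)) = real r * real q + (\<Sum>j<r. \<Sum>l<n. \<Sum>k<n. v j l * v j k * D l k)"
    using orthonormalD[OF v(1)] by (simp add: form sum.distrib)
  also have "(\<Sum>j<r. \<Sum>l<n. \<Sum>k<n. v j l * v j k * D l k) = (\<Sum>l<n. \<Sum>k<n. P l k * D l k)"
    unfolding P_def sum_distrib_right
    by (rule trans[OF sum.swap], rule sum.cong[OF refl], rule sum.swap)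
  also have "(\<Sum>l<n. \<Sum>k<n. P l k * D l k) = (\<Sum>x\<in>{..<n} \<times> {..<n}. case_prod P x * case_prod D x)"
    by (simp add: sum.cartesian_product split_def)
  also have "\<dots> \<le> sqrt ((\<Sum>x\<in>{..<n} \<times> {..<n}. (case_prod P x)\<^sup>2) * (\<Sum>x\<in>{..<n} \<times> {..<n}. (case_prod D x)\<^sup>2))"
    by (rule real_le_rsqrt[OF Cauchy_Schwarz_ineq_sum])
  also have "(\<Sum>x\<in>{..<n} \<times> {..<n}. (case_prod P x)\<^sup>2) = (\<Sum>l<n. \<Sum>k<n. (P l k)\<^sup>2)"
    by (simp add: sum.cartesian_product split_def)
  also have "(\<Sum>x\<in>{..<n} \<times> {..<n}. (case_prod D x)\<^sup>2) = gram_dev q n b"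
    by (simp add: gram_dev_def D_def sum.cartesian_product split_def)
  finally show ?thesis unfolding v(2) PP by simp
qed

section \<open>Orthonormal images of Gaussian arrays\<close>

lemma gauss_prod_linear_form:
  assumes I: "finite I"
  shows "(\<integral>x. cos (\<Sum>i\<in>I. c i * x i) \<partial>gauss_prod I) = exp (- (\<Sum>i\<in>I. (c i)\<^sup>2) / 2)"
    and "(\<integral>x. sin (\<Sum>i\<in>I. c i * x i) \<partial>gauss_prod I) = 0"
proof -
  interpret prob_space "gauss_prod I" by (rule prob_space_gauss_prod)
  interpret S: prob_space std_normal_distribution by (rule prob_space_std_normal)
  let ?L = "\<lambda>x. \<Sum>i\<in>I. c i * x i"
  have [measurable]: "?L \<in> borel_measurable (gauss_prod I)"
  proof (intro borel_measurable_sum borel_measurable_times borel_measurable_const)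
    fix i assume "i \<in> I"
    then show "(\<lambda>x. x i) \<in> borel_measurable (gauss_prod I)"
      by (subst measurable_cong_sets[OF sets_gauss_prod refl]) (rule measurable_component_singleton)
  qed
  have "(\<integral>x. (\<Prod>i\<in>I. iexp (c i * x i)) \<partial>gauss_prod I) = (\<Prod>i\<in>I. \<integral>s. iexp (c i * s) \<partial>std_normal_distribution)"
    unfolding gauss_prod_def
    by (rule product_sigma_finite.product_integral_prod[OF product_sigma_finite_std_normal I, of "\<lambda>i s. iexp (c i * s)"])
      (rule S.integrable_const_bound[of _ 1]; simp)
  also have "\<dots> = (\<Prod>i\<in>I. complex_of_real (exp (- (c i)\<^sup>2 / 2)))"
    using char_std_normal_distribution unfolding char_def fun_eq_iff by simp
  also have "\<dots> = complex_of_real (exp (- (\<Sum>i\<in>I. (c i)\<^sup>2) / 2))"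
    using I by (simp add: exp_sum[symmetric] sum_negf sum_divide_distrib flip: of_real_prod)
  also have "(\<integral>x. (\<Prod>i\<in>I. iexp (c i * x i)) \<partial>gauss_prod I) = (\<integral>x. iexp (?L x) \<partial>gauss_prod I)"
    using I by (simp add: exp_sum sum_distrib_left)
  also have "\<dots> = (\<integral>x. complex_of_real (cos (?L x)) + \<i> * complex_of_real (sin (?L x)) \<partial>gauss_prod I)"
    by (simp only: exp_Euler cos_of_real sin_of_real)
  also have "\<dots> = (\<integral>x. complex_of_real (cos (?L x)) \<partial>gauss_prod I) + (\<integral>x. \<i> * complex_of_real (sin (?L x)) \<partial>gauss_prod I)"
    by (intro Bochner_Integration.integral_add integrable_mult_right integrable_const_bound[of _ 1]) (auto simp del: of_real_sum)
  also have "\<dots> = complex_of_real (\<integral>x. cos (?L x) \<partial>gauss_prod I) + \<i> * complex_of_real (\<integral>x. sin (?L x) \<partial>gauss_prod I)"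
    by (simp del: of_real_sum)
  finally have eq: "complex_of_real (\<integral>x. cos (?L x) \<partial>gauss_prod I) + \<i> * complex_of_real (\<integral>x. sin (?L x) \<partial>gauss_prod I) =
      complex_of_real (exp (- (\<Sum>i\<in>I. (c i)\<^sup>2) / 2))" .
  show "(\<integral>x. cos (?L x) \<partial>gauss_prod I) = exp (- (\<Sum>i\<in>I. (c i)\<^sup>2) / 2)"
    using arg_cong[OF eq, of Re] by simp
  show "(\<integral>x. sin (?L x) \<partial>gauss_prod I) = 0"
    using arg_cong[OF eq, of Im] by simp
qed

text \<open>By the characterisation it suffices to look at linear forms. The form with coefficients
  \<open>t\<close> in the new coordinates has coefficients \<open>c t\<close> in the old ones, and
  orthonormality of \<open>e\<close> preserves their square sum, on which alone the characteristic
  function depends.\<close>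

lemma gauss_prod_rotation:
  fixes e :: "nat \<Rightarrow> nat \<Rightarrow> real" and m n k :: nat
  assumes e: "orthonormal m k e"
  shows "distr (gauss_prod ({..<m} \<times> {..<n})) (PiM ({..<k} \<times> {..<n}) (\<lambda>_. borel))
      (\<lambda>x. \<lambda>(a, l)\<in>{..<k} \<times> {..<n}. \<Sum>i<m. e a i * x (i, l)) = gauss_prod ({..<k} \<times> {..<n})"
proof -
  let ?I = "{..<m} \<times> {..<n}" and ?J = "{..<k} \<times> {..<n}"
  let ?X = "\<lambda>(a, l) x. \<Sum>i<m. e a i * x (i, l)"
  have fin: "finite ?I" "finite ?J" by auto
  define c where "c t = (\<lambda>(i, l). \<Sum>a<k. t (a, l) * e a i)" for t :: "nat \<times> nat \<Rightarrow> real"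
  have lin: "(\<Sum>p\<in>?J. t p * ?X p x) = (\<Sum>q\<in>?I. c t q * x q)" for t x
  proof -
    have "(\<Sum>p\<in>?J. t p * ?X p x) = (\<Sum>a<k. \<Sum>l<n. \<Sum>i<m. t (a, l) * e a i * x (i, l))"
      unfolding sum.cartesian_product[symmetric, of _ "{..<n}"]
      by (subst sum.cartesian_product) (simp add: split_def sum_distrib_left mult.assoc)
    also have "\<dots> = (\<Sum>a<k. \<Sum>i<m. \<Sum>l<n. t (a, l) * e a i * x (i, l))"
      by (intro sum.cong refl sum.swap)
    also have "\<dots> = (\<Sum>i<m. \<Sum>a<k. \<Sum>l<n. t (a, l) * e a i * x (i, l))" by (rule sum.swap)
    also have "\<dots> = (\<Sum>i<m. \<Sum>l<n. \<Sum>a<k. t (a, l) * e a i * x (i, l))"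
      by (intro sum.cong refl sum.swap)
    also have "\<dots> = (\<Sum>q\<in>?I. c t q * x q)"
    proof -
      have "(\<Sum>q\<in>?I. c t q * x q) = (\<Sum>i<m. \<Sum>l<n. c t (i, l) * x (i, l))"
        by (subst sum.cartesian_product) (simp add: split_def)
      then show ?thesis by (simp add: c_def sum_distrib_right)
    qed
    finally show ?thesis .
  qed
  have norm: "(\<Sum>q\<in>?I. (c t q)\<^sup>2) = (\<Sum>p\<in>?J. (t p)\<^sup>2)" for t
  proof -
    have "(\<Sum>i<m. (\<Sum>a<k. t (a, l) * e a i)\<^sup>2) = (\<Sum>a<k. (t (a, l))\<^sup>2)" for l
    proof -
      let ?u = "\<lambda>i. \<Sum>a<k. t (a, l) * e a i"
      have "ip m ?u ?u = (\<Sum>a<k. ip m (e a) ?u * ip m (e a) ?u)"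
        by (rule ip_fixed[OF fixed_by_comb[OF e, of "\<lambda>a. t (a, l)"]])
      also have "\<dots> = (\<Sum>a<k. (t (a, l))\<^sup>2)"
        using ip_comb[OF e, of _ "\<lambda>a. t (a, l)"] by (intro sum.cong refl) (simp add: power2_eq_square)
      finally show ?thesis by (simp only: ip_self)
    qed
    then have "(\<Sum>l<n. \<Sum>i<m. (\<Sum>a<k. t (a, l) * e a i)\<^sup>2) = (\<Sum>l<n. \<Sum>a<k. (t (a, l))\<^sup>2)" by simp
    then have "(\<Sum>i<m. \<Sum>l<n. (\<Sum>a<k. t (a, l) * e a i)\<^sup>2) = (\<Sum>a<k. \<Sum>l<n. (t (a, l))\<^sup>2)"
      by (simp only: sum.swap[of _ "{..<n}"])
    then show ?thesis by (simp add: sum.cartesian_product split_def c_def)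
  qed
  have meas: "?X p \<in> borel_measurable (gauss_prod ?I)" if "p \<in> ?J" for p
  proof -
    have "(\<lambda>x. x (i, l)) \<in> borel_measurable (gauss_prod ?I)" if "i < m" "l < n" for i l
      using that by (subst measurable_cong_sets[OF sets_gauss_prod refl]) (intro measurable_component_singleton; simp)
    then show ?thesis using that
      by (auto intro!: borel_measurable_sum borel_measurable_times)
  qed
  have "distr (gauss_prod ?I) (PiM ?J (\<lambda>_. borel)) (\<lambda>x. \<lambda>p\<in>?J. ?X p x) = gauss_prod ?J"
    by (rule gauss_prod_characterisation[OF prob_space_gauss_prod fin(2) meas])
      (simp_all only: lin gauss_prod_linear_form[OF fin(1)] norm)
  then show ?thesis by (simp add: split_def restrict_def)
qed

lemma gaussian_matrix_law:
  assumes "prob_space M" and E: "gaussian_matrix M m n E" and "0 < m" "0 < n"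
  shows "distr M (PiM ({..<m} \<times> {..<n}) (\<lambda>_. borel)) (\<lambda>\<omega>. \<lambda>ij\<in>{..<m} \<times> {..<n}. E \<omega> $$ ij) =
    gauss_prod ({..<m} \<times> {..<n})"
    and "ij \<in> {..<m} \<times> {..<n} \<Longrightarrow> (\<lambda>\<omega>. E \<omega> $$ ij) \<in> borel_measurable M"
proof -
  interpret prob_space M by fact
  let ?I = "{..<m} \<times> {..<n}"
  have D: "distributed M lborel (\<lambda>\<omega>. E \<omega> $$ ij) std_normal_density" if "ij \<in> ?I" for ij
    using E that unfolding gaussian_matrix_def by blast
  then show rv: "(\<lambda>\<omega>. E \<omega> $$ ij) \<in> borel_measurable M" if "ij \<in> ?I" for ij
    using that distributed_measurable[OF D] by simp
  \<comment> \<open>The criterion that turns independence into a product law is used for a non-empty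
    index set.\<close>
  have "?I \<noteq> {}" using assms by auto
  then have "distr M (PiM ?I (\<lambda>_. borel)) (\<lambda>\<omega>. \<lambda>ij\<in>?I. E \<omega> $$ ij) = PiM ?I (\<lambda>ij. distr M borel (\<lambda>\<omega>. E \<omega> $$ ij))"
    using E by (subst indep_vars_iff_distr_eq_PiM'[symmetric]) (auto simp: gaussian_matrix_def intro: rv)
  also have "\<dots> = gauss_prod ?I"
    unfolding gauss_prod_def
  proof (rule PiM_cong[OF refl])
    fix ij assume "ij \<in> ?I"
    have "distr M borel (\<lambda>\<omega>. E \<omega> $$ ij) = distr M lborel (\<lambda>\<omega>. E \<omega> $$ ij)"
      by (rule distr_cong) simp_all
    also have "\<dots> = std_normal_distribution"
      by (rule distributed_distr_eq_density[OF D[OF \<open>ij \<in> ?I\<close>]])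
    finally show "distr M borel (\<lambda>\<omega>. E \<omega> $$ ij) = std_normal_distribution" .
  qed
  finally show "distr M (PiM ?I (\<lambda>_. borel)) (\<lambda>\<omega>. \<lambda>ij\<in>?I. E \<omega> $$ ij) = gauss_prod ?I" .
qed

lemma gaussian_matrix_rotation:
  assumes "prob_space M" and E: "gaussian_matrix M m n E" and mn: "0 < m" "0 < n" and e: "orthonormal m k e"
  defines "Z \<equiv> \<lambda>\<omega>. \<lambda>(a, l)\<in>{..<k} \<times> {..<n}. \<Sum>i<m. e a i * E \<omega> $$ (i, l)"
  shows "Z \<in> measurable M (PiM ({..<k} \<times> {..<n}) (\<lambda>_. borel))"
    and "distr M (PiM ({..<k} \<times> {..<n}) (\<lambda>_. borel)) Z = gauss_prod ({..<k} \<times> {..<n})"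
proof -
  let ?I = "{..<m} \<times> {..<n}" and ?J = "{..<k} \<times> {..<n}"
  let ?X = "\<lambda>\<omega>. \<lambda>ij\<in>?I. E \<omega> $$ ij"
  let ?R = "\<lambda>x. \<lambda>(a, l)\<in>?J. \<Sum>i<m. e a i * x (i, l)"
  have Xm: "?X \<in> measurable M (PiM ?I (\<lambda>_. borel))"
    by (rule measurable_restrict) (rule gaussian_matrix_law(2)[OF assms(1) E mn])
  have Rm: "?R \<in> measurable (PiM ?I (\<lambda>_. borel)) (PiM ?J (\<lambda>_. borel :: real measure))"
    unfolding split_def
  proof (rule measurable_restrict, intro borel_measurable_sum borel_measurable_times borel_measurable_const)
    fix p i assume "p \<in> ?J" "i \<in> {..<m}"
    then show "(\<lambda>x. x (i, snd p)) \<in> borel_measurable (PiM ?I (\<lambda>_. borel))"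
      by (intro measurable_component_singleton) auto
  qed
  have Z: "Z = (\<lambda>\<omega>. ?R (?X \<omega>))" unfolding Z_def by (auto simp: fun_eq_iff restrict_def)
  show "Z \<in> measurable M (PiM ?J (\<lambda>_. borel))"
    unfolding Z by (rule measurable_compose[OF Xm Rm])
  have "distr M (PiM ?J (\<lambda>_. borel)) Z = distr (distr M (PiM ?I (\<lambda>_. borel)) ?X) (PiM ?J (\<lambda>_. borel)) ?R"
    unfolding Z by (subst distr_distr[OF Rm Xm]) (simp add: o_def)
  also have "\<dots> = gauss_prod ?J"
    unfolding gaussian_matrix_law(1)[OF assms(1) E mn] by (rule gauss_prod_rotation[OF e])
  finally show "distr M (PiM ?J (\<lambda>_. borel)) Z = gauss_prod ?J" .
qed

section \<open>Expected Ky Fan norms\<close>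

abbreviation idx :: "nat \<Rightarrow> nat \<Rightarrow> (nat \<times> nat) set" where
  "idx q n \<equiv> {..<q} \<times> {..<n}"

definition sample_ky_fan2 :: "nat \<Rightarrow> nat \<Rightarrow> nat \<Rightarrow> (nat \<times> nat \<Rightarrow> real) \<Rightarrow> real" where
  "sample_ky_fan2 q n r x = ky_fan2 r (fmat q n (\<lambda>i l. x (i, l)))"

lemma gauss_space_eq: "gauss_space q n = gauss_prod (idx q n)"
  by (simp add: gauss_space_def gauss_prod_def)

lemma mat_eq_fmat: "mat q n x = fmat q n (\<lambda>i l. x (i, l))"
  by (simp add: fmat_def)

lemma S_gauss_eq: "S_gauss q n r = (\<integral>x. sample_ky_fan2 q n r x \<partial>gauss_prod (idx q n))"
  by (simp add: S_gauss_def gauss_space_eq mat_eq_fmat sample_ky_fan2_def)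

lemma sample_ky_fan2_nonneg [simp]: "0 \<le> sample_ky_fan2 q n r x"
  by (simp add: sample_ky_fan2_def)

lemma S_gauss_nonneg: "0 \<le> S_gauss q n r"
  unfolding S_gauss_eq by (intro integral_nonneg_AE) simp

lemma S_gauss_0 [simp]: "S_gauss q n 0 = 0"
  by (simp add: S_gauss_def)

lemma frob_norm_sample: "(frob_norm (fmat q n (\<lambda>i l. x (i, l))))\<^sup>2 = (\<Sum>p\<in>idx q n. (x p)\<^sup>2)"
  by (simp add: frob_norm_sq ip_self sum.cartesian_product split_def)

lemma lipschitz_sample_ky_fan2:
  assumes "r \<le> n"
  shows "lipschitz_l2 (idx q n) (sample_ky_fan2 q n r)"
proof -
  have le: "sample_ky_fan2 q n r x - sample_ky_fan2 q n r y \<le> sqrt (sq_dist (idx q n) x y)" for x y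
    using ky_fan2_lipschitz[OF assms, of q "\<lambda>i l. x (i, l)" "\<lambda>i l. y (i, l)"]
    by (simp add: sample_ky_fan2_def frob_norm_fmat sq_dist_def sum.cartesian_product split_def)
  have "sq_dist (idx q n) x y = sq_dist (idx q n) y x" for x y
    by (simp add: sq_dist_def power2_commute)
  then show ?thesis
    unfolding lipschitz_l2_def abs_le_iff using le by (metis minus_diff_eq)
qed

lemma integrable_sum_squares:
  assumes "finite I" "J \<subseteq> I"
  shows "integrable (gauss_prod I) (\<lambda>x. \<Sum>p\<in>J. (x p)\<^sup>2)"
    and "(\<integral>x. (\<Sum>p\<in>J. (x p)\<^sup>2) \<partial>gauss_prod I) = real (card J)"
  using assms gauss_prod_second_moment[OF assms(1)]
  by (auto intro!: Bochner_Integration.integrable_sum simp: subset_iff)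

text \<open>The variance bound gives that the second moment of the norm is at most 1 + S^2, and the
  second moment is at least the number of entries whose squares the norm dominates.\<close>

lemma S_gauss_ge:
  assumes r: "r \<le> n" and J: "J \<subseteq> idx q n"
    and le: "\<And>x. (\<Sum>p\<in>J. (x p)\<^sup>2) \<le> (sample_ky_fan2 q n r x)\<^sup>2"
  shows "real (card J) - 1 \<le> (S_gauss q n r)\<^sup>2"
proof -
  have fin: "finite (idx q n)" by simp
  note lip = lipschitz_sample_ky_fan2[OF r, of q]
  have "real (card J) = (\<integral>x. (\<Sum>p\<in>J. (x p)\<^sup>2) \<partial>gauss_prod (idx q n))"
    by (rule integrable_sum_squares(2)[OF fin J, symmetric])
  also have "\<dots> \<le> (\<integral>x. (sample_ky_fan2 q n r x)\<^sup>2 \<partial>gauss_prod (idx q n))"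
    by (intro integral_mono integrable_sum_squares(1)[OF fin J] lipschitz_l2_integrable(1)[OF fin lip] le)
  also have "\<dots> \<le> 1 + (S_gauss q n r)\<^sup>2"
    unfolding S_gauss_eq by (rule gaussian_variance[OF fin lip])
  finally show ?thesis by simp
qed

lemma sample_ky_fan2_full: "(sample_ky_fan2 q n (min n q) x)\<^sup>2 = (\<Sum>p\<in>idx q n. (x p)\<^sup>2)"
  unfolding sample_ky_fan2_def ky_fan2_full by (rule frob_norm_sample)

lemma S_gauss_full_lower: "real n * real q - 1 \<le> (S_gauss q n (min n q))\<^sup>2"
  using S_gauss_ge[of "min n q" n "idx q n" q] by (simp add: sample_ky_fan2_full mult.commute)

lemma S_gauss_sq_le:
  assumes "r \<le> n"
  shows "(S_gauss q n r)\<^sup>2 \<le> (\<integral>x. (sample_ky_fan2 q n r x)\<^sup>2 \<partial>gauss_prod (idx q n))"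
proof -
  have fin: "finite (idx q n)" by simp
  note lip = lipschitz_sample_ky_fan2[OF assms, of q]
  show ?thesis unfolding S_gauss_eq
    by (rule prob_space.integrable_of_square(2)[OF prob_space_gauss_prod lipschitz_l2_measurable[OF fin lip]
        lipschitz_l2_integrable(1)[OF fin lip]])
qed

lemma S_gauss_full_upper: "(S_gauss q n (min n q))\<^sup>2 \<le> real n * real q"
  using S_gauss_sq_le[of "min n q" n q] integrable_sum_squares(2)[of "idx q n" "idx q n"]
  by (simp add: sample_ky_fan2_full mult.commute)

text \<open>Jensen's inequality twice, for the square and for the square root of the Gram deviation.
  The Gram matrix is taken on the shorter side, after transposition if \<open>q < n\<close>, so that
  its order, which enters through the fluctuation, is \<open>min n q\<close>.\<close>

lemma S_gauss_upper:
  assumes "r \<le> n" "r \<le> q"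
  shows "(S_gauss q n r)\<^sup>2 \<le> real r * real (max n q) + sqrt (real r * (real n * real q * (real (min n q) + 1)))"
proof -
  let ?G = "gauss_prod (idx q n)"
  interpret prob_space ?G by (rule prob_space_gauss_prod)
  have fin: "finite (idx q n)" by simp
  note lip = lipschitz_sample_ky_fan2[OF assms(1), of q]
  have main: "(S_gauss q n r)\<^sup>2 \<le> real r * real s + sqrt (real r * (real s * real t * (real t + 1)))"
    if inI: "\<And>i j. i < s \<Longrightarrow> j < t \<Longrightarrow> \<iota> i j \<in> idx q n"
      and inj: "\<And>i j i' j'. \<iota> i j = \<iota> i' j' \<longleftrightarrow> i = i' \<and> j = j'"
      and le: "\<And>x. (sample_ky_fan2 q n r x)\<^sup>2 \<le> real r * real s + sqrt (real r * gram_dev s t (\<lambda>i j. x (\<iota> i j)))"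
    for s t and \<iota> :: "nat \<Rightarrow> nat \<Rightarrow> nat \<times> nat"
  proof -
    let ?D = "\<lambda>x. gram_dev s t (\<lambda>i j. x (\<iota> i j))"
    note D = gauss_prod_gram_dev[OF fin inI inj]
    let ?h = "\<lambda>x. sqrt (real r * ?D x)"
    have h2: "(?h x)\<^sup>2 = real r * ?D x" for x by simp
    have hm: "?h \<in> borel_measurable ?G" using borel_measurable_integrable[OF D(1)] by simp
    have h2i: "integrable ?G (\<lambda>x. (?h x)\<^sup>2)" unfolding h2 using D(1) by simp
    have "(\<integral>x. ?h x \<partial>?G)\<^sup>2 \<le> (\<integral>x. (?h x)\<^sup>2 \<partial>?G)" by (rule integrable_of_square(2)[OF hm h2i])
    also have "\<dots> = real r * (real s * real t * (real t + 1))" unfolding h2 using D by simp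
    finally have "(\<integral>x. ?h x \<partial>?G) \<le> sqrt (real r * (real s * real t * (real t + 1)))" by (rule real_le_rsqrt)
    moreover have "(\<integral>x. (sample_ky_fan2 q n r x)\<^sup>2 \<partial>?G) \<le> (\<integral>x. real r * real s + ?h x \<partial>?G)"
      using integrable_of_square(1)[OF hm h2i]
      by (intro integral_mono lipschitz_l2_integrable(1)[OF fin lip] le Bochner_Integration.integrable_add integrable_const)
    moreover have "(\<integral>x. real r * real s + ?h x \<partial>?G) = real r * real s + (\<integral>x. ?h x \<partial>?G)"
      using integrable_of_square(1)[OF hm h2i] by (subst Bochner_Integration.integral_add) (auto simp: prob_space)
    ultimately show ?thesis using S_gauss_sq_le[OF assms(1), of q] by linarith
  qed
  show ?thesis
  proof (cases "n \<le> q")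
    case True
    have "(S_gauss q n r)\<^sup>2 \<le> real r * real q + sqrt (real r * (real q * real n * (real n + 1)))"
      by (rule main[of q n Pair]) (auto simp: sample_ky_fan2_def intro: ky_fan2_sq_le_gram[OF assms(1)])
    then show ?thesis using True by (simp add: max_def min_def mult_ac)
  next
    case False
    have "(S_gauss q n r)\<^sup>2 \<le> real r * real n + sqrt (real r * (real n * real q * (real q + 1)))"
    proof (rule main[of n q "\<lambda>i j. (j, i)"])
      show "(sample_ky_fan2 q n r x)\<^sup>2 \<le> real r * real n + sqrt (real r * gram_dev n q (\<lambda>i j. x (j, i)))" for x
        unfolding sample_ky_fan2_def ky_fan2_transpose[OF assms] by (rule ky_fan2_sq_le_gram[OF assms(2)])
    qed auto
    then show ?thesis using False by (simp add: max_def min_def mult_ac)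
  qed
qed

lemma sample_ky_fan2_upper_tail:
  assumes "r \<le> n" "0 \<le> t"
  shows "measure (gauss_prod (idx q n)) {x \<in> space (gauss_prod (idx q n)). S_gauss q n r + t \<le> sample_ky_fan2 q n r x}
    \<le> exp (- t\<^sup>2 / 2)"
  unfolding S_gauss_eq by (rule gaussian_concentration[OF _ lipschitz_sample_ky_fan2[OF assms(1)] assms(2)]) simp

lemma sample_ky_fan2_lower_tail:
  assumes "r \<le> n" "0 \<le> t"
  shows "measure (gauss_prod (idx q n)) {x \<in> space (gauss_prod (idx q n)). sample_ky_fan2 q n r x \<le> S_gauss q n r - t}
    \<le> exp (- t\<^sup>2 / 2)"
proof -
  have "measure (gauss_prod (idx q n)) {x \<in> space (gauss_prod (idx q n)).
      (\<integral>x. - sample_ky_fan2 q n r x \<partial>gauss_prod (idx q n)) + t \<le> - sample_ky_fan2 q n r x} \<le> exp (- t\<^sup>2 / 2)"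
    by (rule gaussian_concentration[OF _ lipschitz_l2_uminus[OF lipschitz_sample_ky_fan2[OF assms(1)]] assms(2)]) simp
  moreover have "(- S_gauss q n r + t \<le> - sample_ky_fan2 q n r x) = (sample_ky_fan2 q n r x \<le> S_gauss q n r - t)" for x
    by linarith
  ultimately show ?thesis by (simp add: S_gauss_eq)
qed

text \<open>Reduction to one variable. With u and w the roots of the larger and the smaller
  dimension and p = u w, put x = u / (u + w), which is at least 1/2. Smallness of r means that sqrt
  r (u + w) is at most \<kappa> p; multiplied by x and by 1 - x, it bounds both terms of
  \<open>S_gauss_upper\<close> by a polynomial in x times nq. The constant \<open>c\<close> absorbs
  the ratio of \<open>min n q + 1\<close> to \<open>min n q\<close>.\<close>

lemma S_gauss_upper_scaled:
  fixes n q r :: nat and \<kappa> c :: real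
  assumes r: "1 \<le> r" "r \<le> n" "r \<le> q" and k: "0 < \<kappa>" and c: "0 \<le> c"
    and small: "real r * (sqrt (real n) + sqrt (real q))\<^sup>2 \<le> \<kappa>\<^sup>2 * (real n * real q)"
    and ac: "real (min n q) + 1 \<le> c\<^sup>2 * real (min n q)"
  obtains x where "1 / 2 \<le> x" "x \<le> 1"
    "real r * real (max n q) \<le> (\<kappa> * x)\<^sup>2 * (real n * real q)"
    "(S_gauss q n r)\<^sup>2 \<le> (\<kappa>\<^sup>2 * x\<^sup>2 + \<kappa> * c * (1 - x)) * (real n * real q)"
proof -
  define u where "u = sqrt (real (max n q))"
  define w where "w = sqrt (real (min n q))"
  define \<rho> where "\<rho> = sqrt (real r)"
  define p where "p = u * w"
  have pos: "0 < w" "w \<le> u" "0 < \<rho>" "0 < u"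
    using r by (auto simp: u_def w_def \<rho>_def)
  have uw: "sqrt (real n) + sqrt (real q) = u + w"
    by (auto simp: u_def w_def max_def min_def)
  have nq: "real n * real q = p\<^sup>2"
    by (auto simp: p_def u_def w_def max_def min_def power_mult_distrib)
  have "(\<rho> * (u + w))\<^sup>2 \<le> (\<kappa> * p)\<^sup>2"
    using small by (simp add: uw nq power_mult_distrib \<rho>_def)
  then have le: "\<rho> * (u + w) \<le> \<kappa> * p"
    by (rule power2_le_imp_le) (use k pos in \<open>simp add: p_def\<close>)
  define x where "x = u / (u + w)"
  have x: "1 / 2 \<le> x" "x \<le> 1" using pos by (simp_all add: x_def field_simps)
  have 1: "\<rho> * u \<le> \<kappa> * p * x"
    using mult_right_mono[OF le, of x] pos by (simp add: x_def)
  have "1 - x = w / (u + w)" using pos by (simp add: x_def field_simps)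
  then have 2: "\<rho> * w \<le> \<kappa> * p * (1 - x)"
    using mult_right_mono[OF le, of "1 - x"] x pos by simp
  have rM: "real r * real (max n q) = (\<rho> * u)\<^sup>2" by (simp add: \<rho>_def u_def power_mult_distrib)
  have e1: "(\<rho> * u)\<^sup>2 \<le> (\<kappa> * p * x)\<^sup>2" using 1 pos by (intro power_mono) auto
  have "sqrt (real r * (real n * real q * (real (min n q) + 1))) \<le> sqrt (real r * (real n * real q * (c\<^sup>2 * real (min n q))))"
    using ac by (intro real_sqrt_le_mono mult_left_mono) auto
  also have "real r * (real n * real q * (c\<^sup>2 * real (min n q))) = (p * c * (\<rho> * w))\<^sup>2"
    by (simp add: nq \<rho>_def w_def power_mult_distrib)
  also have "sqrt ((p * c * (\<rho> * w))\<^sup>2) = p * c * (\<rho> * w)"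
    using pos c by (simp add: p_def)
  also have "\<dots> \<le> p * c * (\<kappa> * p * (1 - x))"
    using 2 pos c by (intro mult_left_mono) (auto simp: p_def)
  finally have "(S_gauss q n r)\<^sup>2 \<le> (\<kappa> * p * x)\<^sup>2 + p * c * (\<kappa> * p * (1 - x))"
    using S_gauss_upper[OF r(2,3)] e1 rM by linarith
  then have "(S_gauss q n r)\<^sup>2 \<le> (\<kappa>\<^sup>2 * x\<^sup>2 + \<kappa> * c * (1 - x)) * (real n * real q)"
    by (simp add: nq power_mult_distrib power2_eq_square algebra_simps)
  moreover have "real r * real (max n q) \<le> (\<kappa> * x)\<^sup>2 * (real n * real q)"
    using e1 by (simp add: rM nq power_mult_distrib mult_ac)
  ultimately show thesis using that x by blast
qed

text \<open>As (sqrt n + sqrt q)^2 is at least the larger dimension, a positive rank below the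
  threshold forces the smaller dimension above 1 / K. This provides the margins in the numerical
  estimates.\<close>

lemma sqrt_sum_sq_lower:
  assumes "1 \<le> r" "0 < n" "0 < q"
    and "real r * (sqrt (real n) + sqrt (real q))\<^sup>2 < K * (real n * real q)" "0 \<le> K"
  shows "1 < K * real (min n q)"
proof -
  have le: "sqrt (real (max n q)) \<le> sqrt (real n) + sqrt (real q)" by (auto simp: max_def)
  have "real (max n q) = (sqrt (real (max n q)))\<^sup>2" by simp
  also have "\<dots> \<le> (sqrt (real n) + sqrt (real q))\<^sup>2" using le by (intro power_mono) auto
  also have "\<dots> \<le> real r * (sqrt (real n) + sqrt (real q))\<^sup>2" using assms(1) by (simp add: mult_le_cancel_right1)
  also have "\<dots> < K * (real n * real q)" by (rule assms(4))
  also have "\<dots> = K * real (min n q) * real (max n q)" by (auto simp: max_def min_def)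
  finally show ?thesis using assms by (simp add: mult_less_cancel_right1)
qed

text \<open>The chord of the square function over the interval from 1/2 to 1; it makes the numerical
  estimates linear in \<open>x\<close>.\<close>

lemma convex_bound: "1 / 2 \<le> x \<Longrightarrow> x \<le> 1 \<Longrightarrow> x\<^sup>2 \<le> (3 * x - 1) / 2" for x :: real
proof -
  assume "1 / 2 \<le> x" "x \<le> 1"
  then have "0 \<le> (2 * x - 1) * (1 - x)" by (intro mult_nonneg_nonneg) auto
  then show ?thesis by (simp add: power2_eq_square algebra_simps)
qed

text \<open>The estimate for negative penalties, where no fluctuation has to be absorbed. The factor
  1/2 is the largest value of (1 - K) / 4 for K between -1 and 0. A positive rank forces both
  dimensions to be at least 3, so 14/25 of nq stays below nq - 1.\<close>

lemma S_gauss_small: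
  assumes r: "r \<le> n" "r \<le> q" and pos: "0 < n" "0 < q"
    and lt: "real r * (sqrt (real n) + sqrt (real q))\<^sup>2 < (real n * real q - 1) / 2"
  shows "(S_gauss q n r)\<^sup>2 < real n * real q - 1"
proof (cases "r = 0")
  case True
  then show ?thesis using lt by simp
next
  case False
  then have r1: "1 \<le> r" by simp
  have a: "2 < real (min n q)"
    using sqrt_sum_sq_lower[of r n q "1 / 2"] r1 pos lt by simp
  then have "2 < min n q" by (metis of_nat_less_iff of_nat_numeral)
  then have "3 \<le> min n q" by simp
  then have a3: "3 \<le> real (min n q)" by (metis of_nat_le_iff of_nat_numeral)
  have P: "9 \<le> real n * real q"
    using mult_mono[of 3 "real n" 3 "real q"] a3 by (simp add: min_def split: if_splits)
  define \<kappa> where "\<kappa> = sqrt (1 / 2 :: real)"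
  have k: "0 < \<kappa>" "\<kappa>\<^sup>2 = 1 / 2" by (simp_all add: \<kappa>_def)
  \<comment> \<open>A rational upper bound of the square root of 1/2.\<close>
  have k': "\<kappa> \<le> 442 / 625" unfolding \<kappa>_def by (rule real_le_lsqrt) (simp_all add: power2_eq_square)
  \<comment> \<open>The square of 2887/2500 exceeds 4/3, which bounds (R + 1) / R for R at least
    3.\<close>
  obtain x where x: "1 / 2 \<le> x" "x \<le> 1"
    "(S_gauss q n r)\<^sup>2 \<le> (\<kappa>\<^sup>2 * x\<^sup>2 + \<kappa> * (2887 / 2500) * (1 - x)) * (real n * real q)"
    using S_gauss_upper_scaled[OF r1 r k(1), of "2887 / 2500"] lt a3 unfolding k(2) by (auto simp: power2_eq_square)
  have "\<kappa> * (2887 / 2500) * (1 - x) \<le> 8167 / 10000 * (1 - x)"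
    using k' x by (intro mult_right_mono) auto
  then have "\<kappa>\<^sup>2 * x\<^sup>2 + \<kappa> * (2887 / 2500) * (1 - x) \<le> 14 / 25"
    using convex_bound[OF x(1,2)] x(1,2) unfolding k(2) by (simp add: field_simps)
  then have "(\<kappa>\<^sup>2 * x\<^sup>2 + \<kappa> * (2887 / 2500) * (1 - x)) * (real n * real q) \<le> 14 / 25 * (real n * real q)"
    by (intro mult_right_mono) auto
  with x(3) have "(S_gauss q n r)\<^sup>2 \<le> 14 / 25 * (real n * real q)" by (rule order.trans)
  then show ?thesis using P by (simp add: field_simps)
qed

text \<open>The estimate for non-negative penalties. The root is the deviation allowed at rank
  \<open>r\<close> on the good event, without its factor \<alpha>; the factor 3/10 bounds \<alpha> /
  (1 - K).\<close>

lemma S_gauss_perturbed_small: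
  assumes r: "1 \<le> r" "r \<le> n" "r \<le> q" and pos: "0 < n" "0 < q"
    and lt: "real r * (sqrt (real n) + sqrt (real q))\<^sup>2 < (real n * real q - 1) / 4"
  shows "(S_gauss q n r + 3 / 10 * sqrt (real r * real (max n q) - 1))\<^sup>2 < (real n * real q - 1) / 2"
proof -
  have a: "4 < real (min n q)"
    using sqrt_sum_sq_lower[of r n q "1 / 4"] r(1) pos lt by simp
  then have "4 < min n q" by (metis of_nat_less_iff of_nat_numeral)
  then have "5 \<le> min n q" by simp
  then have a5: "5 \<le> real (min n q)" by (metis of_nat_le_iff of_nat_numeral)
  have P: "25 \<le> real n * real q"
    using mult_mono[of 5 "real n" 5 "real q"] a5 by (simp add: min_def split: if_splits)
  define p where "p = sqrt (real n * real q)"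
  have p: "p\<^sup>2 = real n * real q" "0 \<le> p" by (simp_all add: p_def)
  \<comment> \<open>The square of 137/125 exceeds 6/5, which bounds (R + 1) / R for R at least
    5.\<close>
  obtain x where x: "1 / 2 \<le> x" "x \<le> 1"
    "real r * real (max n q) \<le> (1 / 2 * x)\<^sup>2 * (real n * real q)"
    "(S_gauss q n r)\<^sup>2 \<le> ((1 / 2)\<^sup>2 * x\<^sup>2 + 1 / 2 * (137 / 125) * (1 - x)) * (real n * real q)"
    using S_gauss_upper_scaled[OF r, of "1 / 2" "137 / 125"] lt a5 by (auto simp: power2_eq_square)
  define S where "S = S_gauss q n r"
  define l where "l = sqrt (real r * real (max n q) - 1)"
  note xx = convex_bound[OF x(1,2)]
  have S2: "S\<^sup>2 \<le> (x\<^sup>2 / 4 + 137 / 250 * (1 - x)) * p\<^sup>2"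
    using x(4) unfolding S_def p by (simp add: power2_eq_square)
  also have "\<dots> \<le> 5329 / 15625 * p\<^sup>2"
    using xx x(1,2) by (intro mult_right_mono) (auto simp: field_simps)
  also have "\<dots> = (73 / 125 * p)\<^sup>2" by (simp add: power_mult_distrib power_divide)
  finally have "S\<^sup>2 \<le> (73 / 125 * p)\<^sup>2" .
  then have S1: "S \<le> 73 / 125 * p" by (rule power2_le_imp_le) (use p(2) in simp)
  have l: "l \<le> x / 2 * p"
  proof (unfold l_def, rule real_le_lsqrt)
    have "(x / 2 * p)\<^sup>2 = (1 / 2 * x)\<^sup>2 * (real n * real q)" by (simp add: power_mult_distrib power_divide p)
    then show "real r * real (max n q) - 1 \<le> (x / 2 * p)\<^sup>2" using x(3) by linarith
  qed (use x p in simp)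
  have l0: "0 \<le> l"
  proof -
    have "1 * 1 \<le> real r * real (max n q)" using r pos by (intro mult_mono) auto
    then show ?thesis by (simp add: l_def)
  qed
  have Sl: "S * l \<le> (73 / 250 * x) * p\<^sup>2"
  proof -
    have "S * l \<le> (73 / 125 * p) * (x / 2 * p)" using p(2) l0 by (intro mult_mono S1 l) auto
    then show ?thesis by (simp add: power2_eq_square mult_ac)
  qed
  have ll: "l\<^sup>2 \<le> (x\<^sup>2 / 4) * p\<^sup>2"
    using power_mono[OF l l0, of 2] by (simp add: power_mult_distrib power_divide)
  have "(S + 3 / 10 * l)\<^sup>2 = S\<^sup>2 + 3 / 5 * (S * l) + 9 / 100 * l\<^sup>2"
    by (simp add: power2_eq_square algebra_simps)
  also have "\<dots> \<le> (x\<^sup>2 / 4 + 137 / 250 * (1 - x) + 3 / 5 * (73 / 250 * x) + 9 / 100 * (x\<^sup>2 / 4)) * p\<^sup>2"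
    using S2 Sl ll by (simp add: algebra_simps)
  \<comment> \<open>After the chord bound the coefficient is linear in \<open>x\<close>, with values
    below 9/20 at both ends 1/2 and 1. The distance of 9/20 from 1/2 pays for the - 1 in the claim,
    since nq is at least 25.\<close>
  also have "\<dots> \<le> 9 / 20 * p\<^sup>2"
    using xx x(1,2) by (intro mult_right_mono) (auto simp: field_simps)
  finally show ?thesis using P unfolding S_def l_def p by (simp add: field_simps)
qed

lemma geometric_sum_le:
  fixes x :: real
  assumes "0 \<le> x" "x < 1"
  shows "(\<Sum>r = 1..R. x ^ r) \<le> x / (1 - x)"
proof -
  have "(\<Sum>r = 1..R. x ^ r) = x * (\<Sum>r<R. x ^ r)"
    unfolding sum_distrib_left power_Suc[symmetric]
    by (rule sum.reindex_bij_witness[of _ Suc "\<lambda>k. k - 1"]) auto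
  also have "\<dots> = x * ((1 - x ^ R) / (1 - x))" using assms by (simp add: sum_gp_strict)
  also have "\<dots> \<le> x * (1 / (1 - x))"
    using assms by (intro mult_left_mono divide_right_mono) auto
  finally show ?thesis by simp
qed

section \<open>The selected rank\<close>

text \<open>Specialisation of \<open>low_rank_fit_norms\<close> to pure noise, with \<sigma> pulled
  out of the norms. The second equation gives the loss, the true signal being 0.\<close>

lemma rotated_criterion:
  assumes X: "X \<in> carrier_mat m p" and fit: "low_rank_fit X Y r A"
    and Y: "Y = \<sigma> \<cdot>\<^sub>m E" and E: "E \<in> carrier_mat m n" and r: "r \<le> n"
    and e: "orthonormal m (mat_rank X) e"
      "\<And>i. i < mat_rank X \<Longrightarrow> in_span m p (\<lambda>j i. X $$ (i, j)) (e i)"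
      "\<And>j. j < p \<Longrightarrow> fixed_by m (mat_rank X) e (\<lambda>i. X $$ (i, j))"
    and Z: "\<And>a l. a < mat_rank X \<Longrightarrow> l < n \<Longrightarrow> Z (a, l) = (\<Sum>i<m. e a i * E $$ (i, l))"
  shows "(frob_norm (Y - X * A))\<^sup>2 = (frob_norm Y)\<^sup>2 - \<sigma>\<^sup>2 * (sample_ky_fan2 (mat_rank X) n r Z)\<^sup>2"
    and "(frob_norm (X * A))\<^sup>2 = \<sigma>\<^sup>2 * (sample_ky_fan2 (mat_rank X) n r Z)\<^sup>2"
proof -
  let ?q = "mat_rank X"
  have Xf: "fmat m p (\<lambda>i j. X $$ (i, j)) = X" by (rule fmat_cases[OF X, symmetric])
  have Yf: "fmat m n (\<lambda>i l. \<sigma> * E $$ (i, l)) = Y"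
    unfolding Y using E by (intro eq_matI) auto
  let ?C = "\<lambda>a l. \<Sum>i<m. e a i * (\<sigma> * E $$ (i, l))"
  have "fmat ?q n ?C = fmat ?q n (\<lambda>a l. \<sigma> * Z (a, l))"
    by (rule fmat_eqI) (simp add: Z sum_distrib_left mult_ac)
  then have C: "(ky_fan2 r (fmat ?q n ?C))\<^sup>2 = \<sigma>\<^sup>2 * (sample_ky_fan2 ?q n r Z)\<^sup>2"
    using ky_fan2_scale[OF r, of ?q \<sigma> "\<lambda>a l. Z (a, l)"] by (simp add: sample_ky_fan2_def)
  note * = low_rank_fit_norms[OF e r, of "\<lambda>i l. \<sigma> * E $$ (i, l)" A, unfolded Xf Yf, OF _ _ fit]
  show "(frob_norm (Y - X * A))\<^sup>2 = (frob_norm Y)\<^sup>2 - \<sigma>\<^sup>2 * (sample_ky_fan2 ?q n r Z)\<^sup>2"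
    "(frob_norm (X * A))\<^sup>2 = \<sigma>\<^sup>2 * (sample_ky_fan2 ?q n r Z)\<^sup>2"
    using * unfolding C by simp_all
qed

lemma rhat_inequality:
  assumes X: "X \<in> carrier_mat m p" and sel: "rank_selection K \<sigma> X M Y Ahat rhat (min n (mat_rank X))"
    and \<omega>: "\<omega> \<in> space M" and s: "0 < \<sigma>"
    and Y: "Y \<omega> = \<sigma> \<cdot>\<^sub>m E" and E: "E \<in> carrier_mat m n" and r: "r \<le> min n (mat_rank X)"
    and e: "orthonormal m (mat_rank X) e"
      "\<And>i. i < mat_rank X \<Longrightarrow> in_span m p (\<lambda>j i. X $$ (i, j)) (e i)"
      "\<And>j. j < p \<Longrightarrow> fixed_by m (mat_rank X) e (\<lambda>i. X $$ (i, j))"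
    and Z: "\<And>a l. a < mat_rank X \<Longrightarrow> l < n \<Longrightarrow> Z (a, l) = (\<Sum>i<m. e a i * E $$ (i, l))"
  defines "N \<equiv> \<lambda>r. sample_ky_fan2 (mat_rank X) n r Z" and "S \<equiv> \<lambda>r. S_gauss (mat_rank X) n r"
  shows "rhat \<omega> \<le> min n (mat_rank X)"
    and "(N r)\<^sup>2 - K * (S r)\<^sup>2 \<le> (N (rhat \<omega>))\<^sup>2 - K * (S (rhat \<omega>))\<^sup>2"
proof -
  let ?R = "min n (mat_rank X)"
  have am: "is_arg_min (crit K \<sigma> X (Y \<omega>) (\<lambda>r. Ahat r \<omega>)) (\<lambda>r. r \<le> ?R) (rhat \<omega>)"
    using sel \<omega> unfolding rank_selection_def by blast
  then show rh: "rhat \<omega> \<le> ?R" by (simp add: is_arg_min_def)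
  have c: "crit K \<sigma> X (Y \<omega>) (\<lambda>r. Ahat r \<omega>) k =
      (frob_norm (Y \<omega>))\<^sup>2 - \<sigma>\<^sup>2 * ((N k)\<^sup>2 - K * (S k)\<^sup>2)" if "k \<le> ?R" for k
  proof -
    have "low_rank_fit X (Y \<omega>) k (Ahat k \<omega>)"
      using sel \<omega> that unfolding rank_selection_def by blast
    from rotated_criterion(1)[OF X this Y E _ e Z] that have
      "(frob_norm (Y \<omega> - X * Ahat k \<omega>))\<^sup>2 = (frob_norm (Y \<omega>))\<^sup>2 - \<sigma>\<^sup>2 * (N k)\<^sup>2" by (simp add: N_def)
    moreover have "dim_col (Y \<omega>) = n" using E by (simp add: Y)
    ultimately show ?thesis by (simp add: crit_def pen_def S_def algebra_simps)
  qed
  have "crit K \<sigma> X (Y \<omega>) (\<lambda>r. Ahat r \<omega>) (rhat \<omega>) \<le> crit K \<sigma> X (Y \<omega>) (\<lambda>r. Ahat r \<omega>) r"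
    using am r by (simp add: is_arg_min_linorder)
  then have "\<sigma>\<^sup>2 * ((N r)\<^sup>2 - K * (S r)\<^sup>2) \<le> \<sigma>\<^sup>2 * ((N (rhat \<omega>))\<^sup>2 - K * (S (rhat \<omega>))\<^sup>2)"
    unfolding c[OF rh] c[OF r] by linarith
  then show "(N r)\<^sup>2 - K * (S r)\<^sup>2 \<le> (N (rhat \<omega>))\<^sup>2 - K * (S (rhat \<omega>))\<^sup>2"
    using s by (simp add: mult_le_cancel_left_pos)
qed

text \<open>Holds at every sample point: with \<open>- K > 0\<close>, the full rank beats a small
  one strictly through the expected norms and at least weakly through the sampled ones. The
  hypothesis \<open>-1 \<le> K\<close> keeps (1 - K) / 4 at most 1/2, as
  \<open>S_gauss_small\<close> demands.\<close>

lemma selected_rank_large_negative: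
  fixes n q r :: nat
  assumes K: "-1 \<le> K" "K < 0" and pos: "0 < n" "0 < q" and r: "r \<le> min n q"
    and ineq: "(sample_ky_fan2 q n (min n q) Z)\<^sup>2 - K * (S_gauss q n (min n q))\<^sup>2 \<le>
      (sample_ky_fan2 q n r Z)\<^sup>2 - K * (S_gauss q n r)\<^sup>2"
  shows "(1 - K) / 4 * ((real n * real q - 1) / (sqrt (real n) + sqrt (real q))\<^sup>2) \<le> real r"
proof (rule ccontr)
  let ?D = "(sqrt (real n) + sqrt (real q))\<^sup>2"
  have "0 < sqrt (real n) + sqrt (real q)" using pos by (simp add: add_pos_pos)
  then have D: "0 < ?D" by (rule zero_less_power)
  assume "\<not> ?thesis"
  then have "real r * ?D < (1 - K) / 4 * (real n * real q - 1)"
    using D by (simp add: field_simps)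
  also have "1 \<le> real n * real q" using pos mult_mono[of 1 "real n" 1 "real q"] by simp
  then have "(1 - K) / 4 * (real n * real q - 1) \<le> 1 / 2 * (real n * real q - 1)"
    using K by (intro mult_right_mono) auto
  finally have "(S_gauss q n r)\<^sup>2 < real n * real q - 1"
    using r pos by (intro S_gauss_small) auto
  then have "(S_gauss q n r)\<^sup>2 < (S_gauss q n (min n q))\<^sup>2"
    using S_gauss_full_lower[of n q] by linarith
  then have "- K * (S_gauss q n r)\<^sup>2 < - K * (S_gauss q n (min n q))\<^sup>2"
    using K by (intro mult_strict_left_mono) auto
  moreover have "(sample_ky_fan2 q n r Z)\<^sup>2 \<le> (sample_ky_fan2 q n (min n q) Z)\<^sup>2"
    unfolding sample_ky_fan2_def by (intro power_mono ky_fan2_mono r) simp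
  ultimately show False using ineq by simp
qed

text \<open>On the good event the full rank attains at least (1 - K)(nq - 1) / 2 in the maximisation
  of N^2 - K S^2. Rank 0 attains 0. A small positive rank attains at most (1 - K) times the square
  bounded in \<open>S_gauss_perturbed_small\<close>, which is strictly less.\<close>

lemma selected_rank_large_good_event:
  fixes n q r :: nat
  assumes K: "0 \<le> K" "K < 1" and al: "\<alpha> = 1 - sqrt ((1 + K) / 2)"
    and pos: "0 < n" "0 < q" and r: "r \<le> min n q" and nq: "1 < real n * real q"
    and ineq: "(sample_ky_fan2 q n (min n q) Z)\<^sup>2 - K * (S_gauss q n (min n q))\<^sup>2 \<le>
      (sample_ky_fan2 q n r Z)\<^sup>2 - K * (S_gauss q n r)\<^sup>2"
    and up: "1 \<le> r \<Longrightarrow> r < min n q \<Longrightarrow>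
      sample_ky_fan2 q n r Z \<le> S_gauss q n r + \<alpha> * sqrt (real r * real (max n q) - 1)"
    and lo: "S_gauss q n (min n q) - \<alpha> * sqrt (real n * real q - 1) \<le> sample_ky_fan2 q n (min n q) Z"
  shows "(1 - K) / 4 * ((real n * real q - 1) / (sqrt (real n) + sqrt (real q))\<^sup>2) \<le> real r"
proof (rule ccontr)
  let ?D = "(sqrt (real n) + sqrt (real q))\<^sup>2" and ?P = "real n * real q"
  have "0 < sqrt (real n) + sqrt (real q)" using pos by (simp add: add_pos_pos)
  then have D: "0 < ?D" by (rule zero_less_power)
  assume "\<not> ?thesis"
  then have "real r * ?D < (1 - K) / 4 * (?P - 1)"
    using D by (simp add: field_simps)
  also have "(1 - K) / 4 * (?P - 1) \<le> 1 / 4 * (?P - 1)"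
    using K nq by (intro mult_right_mono) auto
  finally have small4: "real r * ?D < (?P - 1) / 4" by simp
  define s where "s = sqrt ((1 + K) / 2)"
  have s2: "s\<^sup>2 = (1 + K) / 2" using K by (simp add: s_def)
  \<comment> \<open>For \<open>K \<ge> 0\<close> the root is at least that of 1/2, about
    0.707.\<close>
  have s7: "7 / 10 \<le> s" unfolding s_def by (rule real_le_rsqrt) (use K in \<open>simp add: power2_eq_square\<close>)
  have s1: "s < 1" unfolding s_def using K by (simp add: real_sqrt_lt_1_iff)
  have Ks: "1 - K = 2 * (1 - s) * (1 + s)" using s2 by (simp add: power2_eq_square algebra_simps)
  have al': "\<alpha> = 1 - s" by (simp add: al s_def)
  have al0: "0 < \<alpha>" "\<alpha> \<le> 1" using s1 s7 by (simp_all add: al')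
  \<comment> \<open>The quotient \<alpha> / (1 - K) is 1 / (2 (1 + s)), which is below 3/10 once
    \<open>s\<close> is at least 7/10.\<close>
  have a1: "\<alpha> \<le> 3 / 10 * (1 - K)"
  proof -
    have "(1 - s) * 1 \<le> (1 - s) * (3 / 5 * (1 + s))" using s7 s1 by (intro mult_left_mono) auto
    then show ?thesis unfolding Ks al' by (simp add: algebra_simps)
  qed
  \<comment> \<open>The quotient \<alpha>^2 / (1 - K) is (1 - s) / (2 (1 + s)), which is below
    9/100. This is the square of 3/10, chosen so that the upper bound for small ranks becomes a
    perfect square.\<close>
  have a2: "\<alpha>\<^sup>2 \<le> 9 / 100 * (1 - K)"
  proof -
    have "(1 - s) * (1 - s) \<le> (1 - s) * (9 / 50 * (1 + s))" using s7 s1 by (intro mult_left_mono) auto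
    then show ?thesis unfolding Ks al' power2_eq_square by (simp add: algebra_simps)
  qed
  define L where "L = sqrt (?P - 1)"
  have L: "0 < L" "L\<^sup>2 = ?P - 1" using nq by (simp_all add: L_def)
  define T where "T = S_gauss q n (min n q)"
  have TL: "L \<le> T" unfolding L_def T_def
    using S_gauss_full_lower[of n q] by (intro real_le_lsqrt S_gauss_nonneg) (simp_all add: mult.commute)
  have "0 \<le> T - \<alpha> * L" using TL mult_right_mono[OF al0(2), of L] L(1) by linarith
  then have "(T - \<alpha> * L)\<^sup>2 \<le> (sample_ky_fan2 q n (min n q) Z)\<^sup>2"
    using lo unfolding T_def L_def by (intro power_mono) auto
  \<comment> \<open>The expression grows with \<open>T\<close> for \<open>T \<ge> L\<close>: its
    excess over the value at \<open>T = L\<close> has the factors \<open>T - L\<close> and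
    \<open>(1 - K) * (T + L) - 2 * \<alpha> * L\<close>. At \<open>T = L\<close> the choice of
    \<alpha> gives the left-hand side.\<close>
  moreover have "(1 - K) / 2 * L\<^sup>2 \<le> (T - \<alpha> * L)\<^sup>2 - K * T\<^sup>2"
  proof -
    have "2 * \<alpha> * L \<le> 2 * (1 - K) * L" using a1 al0 K L(1) by (intro mult_right_mono) auto
    also have "2 * (1 - K) * L = (1 - K) * (2 * L)" by simp
    also have "\<dots> \<le> (1 - K) * (T + L)" using TL K by (intro mult_left_mono) auto
    finally have "0 \<le> (T - L) * ((1 - K) * (T + L) - 2 * \<alpha> * L)"
      using TL by (intro mult_nonneg_nonneg) auto
    also have "\<dots> = ((T - \<alpha> * L)\<^sup>2 - K * T\<^sup>2) - ((1 - \<alpha>)\<^sup>2 - K) * L\<^sup>2"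
      by (simp add: power2_eq_square algebra_simps)
    also have "(1 - \<alpha>)\<^sup>2 - K = (1 - K) / 2" unfolding al' using s2 by (simp add: field_simps)
    finally show ?thesis by simp
  qed
  ultimately have main: "(1 - K) / 2 * L\<^sup>2 \<le> (sample_ky_fan2 q n r Z)\<^sup>2 - K * (S_gauss q n r)\<^sup>2"
    using ineq unfolding T_def by linarith
  have Lpos: "0 < (1 - K) / 2 * L\<^sup>2"
    using K zero_less_power[OF L(1), of 2] by (intro mult_pos_pos) auto
  consider "r = 0" | "1 \<le> r" "r < min n q" | "1 \<le> r" "r = min n q" using r by linarith
  then show False
  proof cases
    case 1
    then show False using main Lpos by (simp add: sample_ky_fan2_def)
  next
    case 2
    define l where "l = sqrt (real r * real (max n q) - 1)"
    have "1 * 1 \<le> real r * real (max n q)" using 2 pos by (intro mult_mono) auto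
    then have l0: "0 \<le> l" by (simp add: l_def)
    define S where "S = S_gauss q n r"
    have S0: "0 \<le> S" by (simp add: S_def S_gauss_nonneg)
    have "(sample_ky_fan2 q n r Z)\<^sup>2 \<le> (S + \<alpha> * l)\<^sup>2"
      using up[OF 2] unfolding S_def l_def by (intro power_mono) auto
    then have "(1 - K) / 2 * L\<^sup>2 \<le> (1 - K) * S\<^sup>2 + \<alpha> * (2 * (l * S)) + \<alpha>\<^sup>2 * l\<^sup>2"
      using main unfolding S_def[symmetric] by (simp add: power2_eq_square algebra_simps)
    also have "\<dots> \<le> (1 - K) * S\<^sup>2 + 3 / 10 * (1 - K) * (2 * (l * S)) + 9 / 100 * (1 - K) * l\<^sup>2"
      using a1 a2 l0 S0 by (intro add_mono mult_right_mono) auto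
    \<comment> \<open>The coefficients from \<open>a1\<close> and \<open>a2\<close> complete the
      square.\<close>
    also have "\<dots> = (1 - K) * (S + 3 / 10 * l)\<^sup>2"
      by (simp add: power2_eq_square field_simps)
    also have "\<dots> < (1 - K) * ((?P - 1) / 2)"
      using S_gauss_perturbed_small[of r n q] 2 pos small4 K
      unfolding S_def l_def by (intro mult_strict_left_mono) auto
    finally show False unfolding L(2) by simp
  next
    case 3
    \<comment> \<open>The full rank lies above the threshold by itself: its product with
      \<open>?D\<close> is at least nq.\<close>
    have "real (max n q) \<le> ?D"
    proof -
      have "real (max n q) = (sqrt (real (max n q)))\<^sup>2" by simp
      also have "\<dots> \<le> ?D" by (intro power_mono) (auto simp: max_def)
      finally show ?thesis .
    qed
    then have "real (min n q) * real (max n q) \<le> real r * ?D" using 3 by (intro mult_mono) auto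
    moreover have "real (min n q) * real (max n q) = ?P" by (auto simp: min_def max_def)
    ultimately show False using small4 nq by (simp add: field_simps)
  qed
qed

text \<open>As min n q * max n q = n q, the deviation of the full norm contributes the last term of the
  geometric series.\<close>

lemma bad_event_probability:
  fixes n q :: nat and \<alpha> :: real
  assumes al: "0 < \<alpha>" and pos: "0 < n" "0 < q"
  defines "G \<equiv> gauss_prod (idx q n)"
  defines "B \<equiv> {x \<in> space G. \<exists>r\<in>{1..<min n q}.
        S_gauss q n r + \<alpha> * sqrt (real r * real (max n q) - 1) \<le> sample_ky_fan2 q n r x} \<union>
      {x \<in> space G. sample_ky_fan2 q n (min n q) x \<le> S_gauss q n (min n q) - \<alpha> * sqrt (real n * real q - 1)}"
  shows "B \<in> sets G"
    and "measure G B \<le> exp (\<alpha>\<^sup>2 / 2) * (exp (- (\<alpha>\<^sup>2 * real (max n q) / 2)) /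
      (1 - exp (- (\<alpha>\<^sup>2 * real (max n q) / 2))))"
proof -
  interpret prob_space G unfolding G_def by (rule prob_space_gauss_prod)
  let ?R = "min n q" and ?M = "real (max n q)"
  let ?t = "\<lambda>r. \<alpha> * sqrt (real r * ?M - 1)"
  define U where "U r = {x \<in> space G. S_gauss q n r + ?t r \<le> sample_ky_fan2 q n r x}" for r
  define V where "V = {x \<in> space G. sample_ky_fan2 q n ?R x \<le> S_gauss q n ?R - ?t ?R}"
  have RM: "real ?R * ?M = real n * real q" by (auto simp: min_def max_def)
  have B: "B = (\<Union>r\<in>{1..<?R}. U r) \<union> V" by (auto simp: B_def U_def V_def RM)
  have m: "sample_ky_fan2 q n r \<in> borel_measurable G" if "r \<le> ?R" for r
    unfolding G_def using that by (intro lipschitz_l2_measurable lipschitz_sample_ky_fan2) auto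
  have Um: "U r \<in> sets G" if "r \<le> ?R" for r
    using m[OF that] unfolding U_def by simp
  have Vm: "V \<in> sets G" using m[of ?R] unfolding V_def by simp
  show "B \<in> sets G" unfolding B using Um Vm by auto
  define x where "x = exp (- (\<alpha>\<^sup>2 * ?M / 2))"
  have x: "0 \<le> x" "x < 1" using al pos by (simp_all add: x_def)
  have t0: "0 \<le> real r * ?M - 1" if "1 \<le> r" for r
  proof -
    have "1 * 1 \<le> real r * ?M" using that pos by (intro mult_mono) auto
    then show ?thesis by simp
  qed
  \<comment> \<open>The deviation for rank \<open>r\<close> is chosen for this identity: the - 1
    under its root produces the factor \<open>exp (\<alpha>\<^sup>2 / 2)\<close>, and the rest is a
    power of \<open>x\<close>.\<close>
  have ex: "exp (- (?t r)\<^sup>2 / 2) = exp (\<alpha>\<^sup>2 / 2) * x ^ r" if "1 \<le> r" for r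
    using t0[OF that] by (simp add: x_def power_mult_distrib exp_add[symmetric] exp_of_nat_mult[symmetric] field_simps)
  have Up: "prob (U r) \<le> exp (\<alpha>\<^sup>2 / 2) * x ^ r" if "1 \<le> r" "r \<le> ?R" for r
    using sample_ky_fan2_upper_tail[of r n "?t r" q] al t0[OF that(1)] that
    unfolding U_def G_def ex[OF that(1), symmetric] by simp
  have R1: "1 \<le> ?R" using pos by simp
  have Vp: "prob V \<le> exp (\<alpha>\<^sup>2 / 2) * x ^ ?R"
    using sample_ky_fan2_lower_tail[of ?R n "?t ?R" q] al t0[OF R1]
    unfolding V_def G_def ex[OF R1, symmetric] by simp
  have "measure G B \<le> prob (\<Union>r\<in>{1..<?R}. U r) + prob V"
    unfolding B using Um Vm by (intro measure_Un_le) auto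
  also have "prob (\<Union>r\<in>{1..<?R}. U r) \<le> (\<Sum>r\<in>{1..<?R}. prob (U r))"
    using Um by (intro finite_measure_subadditive_finite) auto
  also have "\<dots> \<le> (\<Sum>r\<in>{1..<?R}. exp (\<alpha>\<^sup>2 / 2) * x ^ r)"
    by (intro sum_mono Up) auto
  also have "(\<Sum>r\<in>{1..<?R}. exp (\<alpha>\<^sup>2 / 2) * x ^ r) + prob V \<le>
      (\<Sum>r\<in>{1..<?R}. exp (\<alpha>\<^sup>2 / 2) * x ^ r) + exp (\<alpha>\<^sup>2 / 2) * x ^ ?R"
    using Vp by simp
  also have "\<dots> = exp (\<alpha>\<^sup>2 / 2) * (\<Sum>r = 1..?R. x ^ r)"
    unfolding sum.last_plus[OF R1] distrib_left sum_distrib_left by simp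
  also have "\<dots> \<le> exp (\<alpha>\<^sup>2 / 2) * (x / (1 - x))"
    by (intro mult_left_mono geometric_sum_le x) simp
  finally show "measure G B \<le> exp (\<alpha>\<^sup>2 / 2) * (exp (- (\<alpha>\<^sup>2 * ?M / 2)) / (1 - exp (- (\<alpha>\<^sup>2 * ?M / 2))))"
    by (simp add: x_def)
qed

text \<open>The coordinates of the noise in a basis of the column space have the law of a standard
  Gaussian \<open>q\<close> x \<open>n\<close> array. The preimage of the bad event under these
  coordinates therefore has the probability estimated before, and outside it the deterministic
  comparison applies.\<close>

theorem selected_rank_lower_bound:
  fixes M :: "'w measure"
  assumes K: "-1 \<le> K" "K < 1" and al: "\<alpha> = 1 - sqrt ((1 + K) / 2)" "0 < \<alpha>"
    and M: "prob_space M" and mnp: "0 < m" "0 < n" and X: "X \<in> carrier_mat m p"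
    and s: "0 < \<sigma>" and E: "gaussian_matrix M m n E"
    and sel: "rank_selection K \<sigma> X M (\<lambda>\<omega>. X * 0\<^sub>m p n + \<sigma> \<cdot>\<^sub>m E \<omega>) Ahat rhat (min n (mat_rank X))"
  defines "q \<equiv> mat_rank X"
  shows "1 - exp (\<alpha>\<^sup>2 / 2) * (exp (- (\<alpha>\<^sup>2 * real (max n q) / 2)) / (1 - exp (- (\<alpha>\<^sup>2 * real (max n q) / 2))))
    \<le> measure M {\<omega>\<in>space M. (1 - K) / 4 * ((real n * real q - 1) / (sqrt (real n) + sqrt (real q))\<^sup>2) \<le> real (rhat \<omega>)}"
proof -
  interpret prob_space M by fact
  let ?R0 = "(1 - K) / 4 * ((real n * real q - 1) / (sqrt (real n) + sqrt (real q))\<^sup>2)"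
  let ?bound = "exp (\<alpha>\<^sup>2 / 2) * (exp (- (\<alpha>\<^sup>2 * real (max n q) / 2)) / (1 - exp (- (\<alpha>\<^sup>2 * real (max n q) / 2))))"
  have rm: "rhat \<in> measurable M (count_space UNIV)" using sel by (simp add: rank_selection_def)
  have bound0: "0 \<le> ?bound" using al(2) mnp by (intro mult_nonneg_nonneg divide_nonneg_nonneg) auto
  have ev: "{\<omega>\<in>space M. ?R0 \<le> real (rhat \<omega>)} \<in> sets M" using rm by measurable
  show ?thesis
  proof (cases "1 < real n * real q")
    case False
    \<comment> \<open>With nq at most 1 the threshold is not positive, and the event is the whole
      space.\<close>
    then have "?R0 \<le> 0" using K by (intro mult_nonneg_nonpos divide_nonpos_nonneg) auto
    then have "{\<omega>\<in>space M. ?R0 \<le> real (rhat \<omega>)} = space M"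
      using of_nat_0_le_iff order.trans by blast
    then show ?thesis using bound0 by (simp add: prob_space)
  next
    case nq: True
    then have q0: "0 < q" by (cases "q = 0") auto
    obtain e where e: "orthonormal m q e"
      "\<And>i. i < q \<Longrightarrow> in_span m p (\<lambda>j i. X $$ (i, j)) (e i)"
      "\<And>j. j < p \<Longrightarrow> fixed_by m q e (\<lambda>i. X $$ (i, j))"
      using column_basis[of m p "\<lambda>i j. X $$ (i, j)"] unfolding fmat_cases[OF X, symmetric] q_def[symmetric] by blast
    define Z where "Z \<omega> = (\<lambda>(a, l)\<in>idx q n. \<Sum>i<m. e a i * E \<omega> $$ (i, l))" for \<omega>
    have Zm: "Z \<in> measurable M (PiM (idx q n) (\<lambda>_. borel))"
      and Zd: "distr M (PiM (idx q n) (\<lambda>_. borel)) Z = gauss_prod (idx q n)"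
      using gaussian_matrix_rotation[OF M E mnp e(1)] unfolding Z_def[abs_def] by blast+
    have Zi: "Z \<omega> (a, l) = (\<Sum>i<m. e a i * E \<omega> $$ (i, l))" if "a < q" "l < n" for \<omega> a l
      using that by (simp add: Z_def)
    have Ec: "E \<omega> \<in> carrier_mat m n" if "\<omega> \<in> space M" for \<omega>
      using E that by (simp add: gaussian_matrix_def)
    have Yc: "X * 0\<^sub>m p n + \<sigma> \<cdot>\<^sub>m E \<omega> = \<sigma> \<cdot>\<^sub>m E \<omega>" if "\<omega> \<in> space M" for \<omega>
      using Ec[OF that] X by simp
    have ineq: "rhat \<omega> \<le> min n q"
      "(sample_ky_fan2 q n (min n q) (Z \<omega>))\<^sup>2 - K * (S_gauss q n (min n q))\<^sup>2 \<le>
        (sample_ky_fan2 q n (rhat \<omega>) (Z \<omega>))\<^sup>2 - K * (S_gauss q n (rhat \<omega>))\<^sup>2" if "\<omega> \<in> space M" for \<omega>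
      using rhat_inequality[OF X sel that s Yc[OF that] Ec[OF that] order_refl e[unfolded q_def] Zi[unfolded q_def]]
      unfolding q_def by blast+
    show ?thesis
    proof (cases "K < 0")
      case True
      have "?R0 \<le> real (rhat \<omega>)" if "\<omega> \<in> space M" for \<omega>
        by (rule selected_rank_large_negative[OF K(1) True mnp(2) q0 ineq[OF that]])
      then have "{\<omega>\<in>space M. ?R0 \<le> real (rhat \<omega>)} = space M" by auto
      then show ?thesis using bound0 by (simp add: prob_space)
    next
      case False
      then have K0: "0 \<le> K" by simp
      let ?G = "gauss_prod (idx q n)"
      define B where "B = {x \<in> space ?G. \<exists>r\<in>{1..<min n q}.
            S_gauss q n r + \<alpha> * sqrt (real r * real (max n q) - 1) \<le> sample_ky_fan2 q n r x} \<union>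
          {x \<in> space ?G. sample_ky_fan2 q n (min n q) x \<le> S_gauss q n (min n q) - \<alpha> * sqrt (real n * real q - 1)}"
      note bad = bad_event_probability[OF al(2) mnp(2) q0, folded B_def]
      have Bm: "B \<in> sets (PiM (idx q n) (\<lambda>_. borel))" using bad(1) by (simp add: sets_gauss_prod)
      have ZG: "Z \<omega> \<in> space ?G" if "\<omega> \<in> space M" for \<omega>
        by (auto simp: space_gauss_prod Z_def)
      let ?C = "Z -` B \<inter> space M"
      have C: "?C \<in> sets M" by (rule measurable_sets[OF Zm Bm])
      have "prob ?C = measure ?G B"
        unfolding Zd[symmetric] by (rule measure_distr[OF Zm Bm, symmetric])
      then have Cb: "prob ?C \<le> ?bound" using bad(2) by simp
      have "space M - ?C \<subseteq> {\<omega>\<in>space M. ?R0 \<le> real (rhat \<omega>)}"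
      proof
        fix \<omega> assume w: "\<omega> \<in> space M - ?C"
        then have ws: "\<omega> \<in> space M" and nB: "Z \<omega> \<notin> B" by auto
        have "?R0 \<le> real (rhat \<omega>)"
        proof (rule selected_rank_large_good_event[OF K0 K(2) al(1) mnp(2) q0 ineq(1)[OF ws] nq ineq(2)[OF ws]])
          show "sample_ky_fan2 q n (rhat \<omega>) (Z \<omega>) \<le> S_gauss q n (rhat \<omega>) + \<alpha> * sqrt (real (rhat \<omega>) * real (max n q) - 1)"
            if "1 \<le> rhat \<omega>" "rhat \<omega> < min n q"
          proof (rule ccontr)
            assume "\<not> ?thesis"
            then have "Z \<omega> \<in> B" unfolding B_def using that ZG[OF ws]
              by (intro UnI1 CollectI conjI bexI[of _ "rhat \<omega>"]) auto
            then show False using nB by simp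
          qed
          show "S_gauss q n (min n q) - \<alpha> * sqrt (real n * real q - 1) \<le> sample_ky_fan2 q n (min n q) (Z \<omega>)"
          proof (rule ccontr)
            assume "\<not> ?thesis"
            then have "Z \<omega> \<in> B" unfolding B_def using ZG[OF ws]
              by (intro UnI2 CollectI conjI) auto
            then show False using nB by simp
          qed
        qed
        then show "\<omega> \<in> {\<omega>\<in>space M. ?R0 \<le> real (rhat \<omega>)}" using ws by simp
      qed
      then have "prob (space M - ?C) \<le> prob {\<omega>\<in>space M. ?R0 \<le> real (rhat \<omega>)}"
        by (rule finite_measure_mono[OF _ ev])
      then show ?thesis using Cb prob_compl[OF C] by linarith
    qed
  qed
qed

section \<open>Failure of the risk bound for the identity design\<close>

lemma mat_rank_one: "mat_rank (1\<^sub>m k) = k"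
proof -
  have "mat_rank (fmat k k (\<lambda>i j. of_bool (i = j))) = k"
  proof (rule rank_eq_orthonormal_dim)
    let ?e = "\<lambda>j i. of_bool (i = j) :: real"
    show on: "orthonormal k k ?e" by (rule orthonormal_delta) simp
    show "in_span k k ?e (?e i)" if "i < k" for i using that by (rule in_span_base)
    show "fixed_by k k ?e (?e j)" for j by (rule fixed_by_basis[OF on])
  qed
  then show ?thesis by (simp add: one_fmat)
qed

text \<open>With a single response column only the ranks 0 and 1 compete. The minimisers
  \<open>Ahat\<close> and \<open>rhat\<close> are arbitrary, since the loss is determined by the
  selected rank: it is 0 at rank 0 and \<open>N \<omega>\<close> at rank 1. Both sides of the risk
  bound then reduce to the mean \<open>k\<close> of \<open>N\<close> and to constants.\<close>

lemma identity_design_risk_bound: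
  fixes n k :: nat and X A :: "real mat"
  assumes n1: "n = 1" and k0: "0 < k" and c: "0 < c" and X: "X = 1\<^sub>m k" and A: "A = 0\<^sub>m k n"
    and sel: "rank_selection K 1 X (gauss_space k n) (\<lambda>\<omega>. X * A + 1 \<cdot>\<^sub>m mat k n \<omega>) Ahat rhat (min n (mat_rank X))"
    and risk: "risk_bound c K 1 X A (gauss_space k n) Ahat rhat (min n (mat_rank X))"
  shows "real k * (1 - max K 0) \<le> c"
proof -
  define Y where Y: "Y \<omega> = X * A + 1 \<cdot>\<^sub>m mat k n \<omega>" for \<omega>
  \<comment> \<open>The bound of the squared expected norm by \<open>k\<close> may be multiplied
    only by a non-negative factor, so a negative \<open>K\<close> is replaced by 0.\<close>
  define K' where "K' = max K 0"
  have K': "0 \<le> K'" "K \<le> K'" by (auto simp: K'_def)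
  let ?G = "gauss_space k n" and ?q = "mat_rank X"
  have q: "?q = k" unfolding X by (rule mat_rank_one)
  have mk: "min n ?q = n" using k0 by (simp add: q n1)
  have Xc: "X \<in> carrier_mat k k" by (simp add: X)
  note sel = sel[folded Y[abs_def]]
  interpret prob_space ?G unfolding gauss_space_eq by (rule prob_space_gauss_prod)
  let ?e = "\<lambda>j i. of_bool (i = j) :: real"
  have XI: "X $$ (i, j) = ?e j i" if "i < k" "j < k" for i j using that by (simp add: X one_mat_def)
  have on: "orthonormal k ?q ?e" unfolding q by (rule orthonormal_delta) simp
  have sp: "in_span k k (\<lambda>j i. X $$ (i, j)) (?e i)" if "i < ?q" for i
    unfolding in_span_def using that XI unfolding q
    by (intro exI[of _ "\<lambda>j. of_bool (j = i)"]) simp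
  have fx: "fixed_by k ?q ?e (\<lambda>i. X $$ (i, j))" for j
    using on unfolding q by (rule fixed_by_basis)
  have Z: "\<omega> (a, l) = (\<Sum>i<k. ?e a i * mat k n \<omega> $$ (i, l))" if "a < ?q" "l < n" for a l and \<omega> :: "nat \<times> nat \<Rightarrow> real"
    using that unfolding q by simp
  have Ec: "mat k n \<omega> \<in> carrier_mat k n" for \<omega> :: "nat \<times> nat \<Rightarrow> real" by simp
  have XA: "X * A = 0\<^sub>m k n" by (simp add: X A)
  have Yw: "Y \<omega> = 1 \<cdot>\<^sub>m mat k n \<omega>" for \<omega> unfolding Y XA by simp
  define N where "N \<omega> = (\<Sum>p\<in>idx k n. (\<omega> p)\<^sup>2)" for \<omega> :: "nat \<times> nat \<Rightarrow> real"
  have s1: "(sample_ky_fan2 ?q n n \<omega>)\<^sup>2 = N \<omega>" for \<omega>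
  proof -
    have "(sample_ky_fan2 ?q n n \<omega>)\<^sup>2 = (\<Sum>p\<in>idx ?q n. (\<omega> p)\<^sup>2)"
      using sample_ky_fan2_full[of ?q n \<omega>] by (simp only: mk)
    then show ?thesis by (simp only: N_def q)
  qed
  have s0: "(sample_ky_fan2 ?q n 0 \<omega>)\<^sup>2 = 0" for \<omega> by (simp add: sample_ky_fan2_def)
  have fit: "low_rank_fit X (Y \<omega>) r (Ahat r \<omega>)" if "\<omega> \<in> space ?G" "r \<le> n" for r \<omega>
    using sel that unfolding rank_selection_def mk by blast
  have Xh: "X * Ahat r \<omega> \<in> carrier_mat k n" if "\<omega> \<in> space ?G" "r \<le> n" for r \<omega>
  proof -
    have "dim_col (Y \<omega>) = n" by (simp add: Yw)
    then have "Ahat r \<omega> \<in> carrier_mat k n"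
      using fit[OF that] Xc by (simp add: low_rank_fit_def is_arg_min_def)
    then show ?thesis using Xc by (rule mult_carrier_mat[rotated])
  qed
  have norm: "(frob_norm (X * Ahat r \<omega> - X * A))\<^sup>2 = (sample_ky_fan2 ?q n r \<omega>)\<^sup>2"
    "(frob_norm (X * A - X * Ahat r \<omega>))\<^sup>2 = (sample_ky_fan2 ?q n r \<omega>)\<^sup>2"
    if w: "\<omega> \<in> space ?G" "r \<le> n" for r \<omega>
  proof -
    have d: "dim_row (X * Ahat r \<omega>) = k" "dim_col (X * Ahat r \<omega>) = n" using Xh[OF w] by auto
    have e: "frob_norm (X * Ahat r \<omega> - X * A) = frob_norm (X * Ahat r \<omega>)"
      "frob_norm (X * A - X * Ahat r \<omega>) = frob_norm (X * Ahat r \<omega>)"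
      unfolding XA frob_norm_def minus_mat_def by (simp_all add: d del: index_mult_mat)
    have "(frob_norm (X * Ahat r \<omega>))\<^sup>2 = 1\<^sup>2 * (sample_ky_fan2 ?q n r \<omega>)\<^sup>2"
      by (rule rotated_criterion(2)[OF Xc fit[OF w] Yw Ec w(2) on sp fx Z])
    then show "(frob_norm (X * Ahat r \<omega> - X * A))\<^sup>2 = (sample_ky_fan2 ?q n r \<omega>)\<^sup>2"
      "(frob_norm (X * A - X * Ahat r \<omega>))\<^sup>2 = (sample_ky_fan2 ?q n r \<omega>)\<^sup>2"
      unfolding e by simp_all
  qed
  have rh: "rhat \<omega> \<le> n" and N0: "rhat \<omega> = 0 \<Longrightarrow> N \<omega> \<le> K' * real k" if w: "\<omega> \<in> space ?G" for \<omega>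
  proof -
    have nm: "n \<le> min n ?q" unfolding mk ..
    have one: "0 < (1 :: real)" by simp
    note * = rhat_inequality[of X k k K 1 ?G Y Ahat rhat n \<omega> "mat k n \<omega>" n ?e \<omega>]
    have rn: "rhat \<omega> \<le> min n ?q"
      by (rule *(1)[OF Xc sel w one Yw Ec nm on]; (rule sp fx Z)?; assumption?)
    show "rhat \<omega> \<le> n" using rn unfolding mk .
    assume r0: "rhat \<omega> = 0"
    have "(sample_ky_fan2 ?q n n \<omega>)\<^sup>2 - K * (S_gauss ?q n n)\<^sup>2 \<le>
        (sample_ky_fan2 ?q n (rhat \<omega>) \<omega>)\<^sup>2 - K * (S_gauss ?q n (rhat \<omega>))\<^sup>2"
      by (rule *(2)[OF Xc sel w one Yw Ec nm on]; (rule sp fx Z)?; assumption?)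
    then have "N \<omega> - K * (S_gauss ?q n n)\<^sup>2 \<le> 0" unfolding r0 s1 s0 S_gauss_0 by simp
    moreover have "K * (S_gauss ?q n n)\<^sup>2 \<le> K' * (S_gauss ?q n n)\<^sup>2" using K'(2) by (intro mult_right_mono) auto
    moreover have "K' * (S_gauss ?q n n)\<^sup>2 \<le> K' * real k"
      using S_gauss_full_upper[of ?q n] K'(1) unfolding mk by (intro mult_left_mono) (simp_all add: q n1)
    ultimately show "N \<omega> \<le> K' * real k" by linarith
  qed
  have Ni: "integrable ?G N" and NE: "(\<integral>\<omega>. N \<omega> \<partial>?G) = real k"
    using integrable_sum_squares[of "idx k n" "idx k n"] unfolding gauss_space_eq N_def[abs_def]
    by (simp_all add: n1)
  have rm: "rhat \<in> measurable ?G (count_space UNIV)" using sel by (simp add: rank_selection_def)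
  have loss: "(frob_norm (X * Ahat (rhat \<omega>) \<omega> - X * A))\<^sup>2 = (if rhat \<omega> = 0 then 0 else N \<omega>)"
    if w: "\<omega> \<in> space ?G" for \<omega>
  proof (cases "rhat \<omega> = 0")
    case True
    then show ?thesis using norm(1)[OF w rh[OF w]] s0 by simp
  next
    case False
    then have "rhat \<omega> = n" using rh[OF w] by (simp add: n1)
    then show ?thesis using norm(1)[OF w rh[OF w]] s1 False by simp
  qed
  have Nn: "0 \<le> N \<omega>" for \<omega> by (simp add: N_def sum_nonneg)
  have li: "integrable ?G (\<lambda>\<omega>. if rhat \<omega> = 0 then 0 else N \<omega>)"
  proof (rule Bochner_Integration.integrable_bound[OF Ni])
    show "(\<lambda>\<omega>. if rhat \<omega> = 0 then 0 else N \<omega>) \<in> borel_measurable ?G"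
      using rm borel_measurable_integrable[OF Ni] by measurable
  qed (use Nn in auto)
  have ci: "integrable ?G (\<lambda>\<omega>. N \<omega> - K' * real k)" using Ni by simp
  have "real k - K' * real k = (\<integral>\<omega>. N \<omega> - K' * real k \<partial>?G)"
    using Ni by (simp add: NE prob_space)
  \<comment> \<open>Pointwise: at rank 0 the left integrand is at most 0 by \<open>N0\<close>, and
    otherwise the loss is \<open>N \<omega>\<close> itself. No estimate of the probability of
    selecting rank 0 is needed.\<close>
  also have "\<dots> \<le> (\<integral>\<omega>. (if rhat \<omega> = 0 then 0 else N \<omega>) \<partial>?G)"
  proof (rule integral_mono[OF ci li])
    fix \<omega> assume w: "\<omega> \<in> space ?G"
    have "0 \<le> K' * real k" using K'(1) by simp
    then show "N \<omega> - K' * real k \<le> (if rhat \<omega> = 0 then 0 else N \<omega>)" using N0[OF w] by simp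
  qed
  also have "\<dots> = (\<integral>\<omega>. (frob_norm (X * Ahat (rhat \<omega>) \<omega> - X * A))\<^sup>2 \<partial>?G)"
    by (intro Bochner_Integration.integral_cong refl loss[symmetric])
  also have "\<dots> \<le> c * (MIN r\<in>{0..min n ?q}.
      (\<integral>\<omega>. (frob_norm (X * A - X * Ahat r \<omega>))\<^sup>2 \<partial>?G) + pen K ?q (dim_col A) r * 1\<^sup>2 + 1\<^sup>2)"
    using risk unfolding risk_bound_def .
  also have "\<dots> \<le> c * 1"
  proof (intro mult_left_mono)
    have "(\<integral>\<omega>. (frob_norm (X * A - X * Ahat 0 \<omega>))\<^sup>2 \<partial>?G) = (\<integral>\<omega>. 0 \<partial>?G)"
      by (intro Bochner_Integration.integral_cong refl) (simp only: norm(2) s0 zero_le)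
    then have "(\<integral>\<omega>. (frob_norm (X * A - X * Ahat 0 \<omega>))\<^sup>2 \<partial>?G) + pen K ?q (dim_col A) 0 * 1\<^sup>2 + 1\<^sup>2 = 1"
      by (simp add: pen_def)
    then show "(MIN r\<in>{0..min n ?q}.
      (\<integral>\<omega>. (frob_norm (X * A - X * Ahat r \<omega>))\<^sup>2 \<partial>?G) + pen K ?q (dim_col A) r * 1\<^sup>2 + 1\<^sup>2) \<le> 1"
      by (intro Min_le[THEN order.trans[OF _ eq_refl]]) (auto intro!: image_eqI[of _ _ 0])
  qed (use c in simp)
  finally show ?thesis by (simp add: K'_def algebra_simps)
qed

(* Second part: for every candidate constant c there is an instance (m, n, p, X, A, \<sigma>) on which
   the bound fails for every measurable choice of the possibly non-unique minimizers. The noise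
   is realised on its canonical space, so a function of \<omega> is the same as a function of Y. *)
theorem proposition1:
  fixes K \<alpha> :: real
  assumes "-1 \<le> K" and "K < 1"
    and "\<alpha> = 1 - sqrt ((1 + K) / 2)"
  shows
    "\<alpha> > 0 \<and>
     (\<forall>(M :: 'w measure) m n p q X A \<sigma> E Y Ahat rhat.
        prob_space M \<and> m > 0 \<and> n > 0 \<and> p > 0 \<and>
        X \<in> carrier_mat m p \<and> X \<noteq> 0\<^sub>m m p \<and> q = mat_rank X \<and>
        \<sigma> > 0 \<and> gaussian_matrix M m n E \<and> Y = (\<lambda>\<omega>. X * A + \<sigma> \<cdot>\<^sub>m E \<omega>) \<and>
        A = 0\<^sub>m p n \<and> rank_selection K \<sigma> X M Y Ahat rhat (min n q)
        \<longrightarrow>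
        measure M {\<omega>\<in>space M. real (rhat \<omega>)
            \<ge> (1 - K) / 4 * ((real n * real q - 1) / (sqrt (real n) + sqrt (real q))\<^sup>2)}
          \<ge> 1 - exp (\<alpha>\<^sup>2 / 2) *
              (exp (- (\<alpha>\<^sup>2 * real (max n q) / 2)) /
               (1 - exp (- (\<alpha>\<^sup>2 * real (max n q) / 2))))) \<and>
     \<not> (\<exists>c>0. \<forall>m n p q X A \<sigma>.
          m > 0 \<and> n > 0 \<and> p > 0 \<and>
          X \<in> carrier_mat m p \<and> X \<noteq> 0\<^sub>m m p \<and> q = mat_rank X \<and>
          A \<in> carrier_mat p n \<and> \<sigma> > 0
          \<longrightarrow>
          (\<exists>Ahat rhat.
             (\<forall>r\<le>min n q. random_matrix (gauss_space m n) p n (Ahat r)) \<and>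
             rank_selection K \<sigma> X (gauss_space m n) (\<lambda>\<omega>. X * A + \<sigma> \<cdot>\<^sub>m mat m n \<omega>)
               Ahat rhat (min n q) \<and>
             risk_bound c K \<sigma> X A (gauss_space m n) Ahat rhat (min n q)))"
proof (intro conjI)
  show al: "\<alpha> > 0"
  proof -
    have "sqrt ((1 + K) / 2) < 1" using assms(1,2) by (simp add: real_sqrt_lt_1_iff)
    then show ?thesis using assms(3) by simp
  qed
  show "\<forall>(M :: 'w measure) m n p q X A \<sigma> E Y Ahat rhat.
        prob_space M \<and> m > 0 \<and> n > 0 \<and> p > 0 \<and>
        X \<in> carrier_mat m p \<and> X \<noteq> 0\<^sub>m m p \<and> q = mat_rank X \<and>
        \<sigma> > 0 \<and> gaussian_matrix M m n E \<and> Y = (\<lambda>\<omega>. X * A + \<sigma> \<cdot>\<^sub>m E \<omega>) \<and>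
        A = 0\<^sub>m p n \<and> rank_selection K \<sigma> X M Y Ahat rhat (min n q)
        \<longrightarrow>
        measure M {\<omega>\<in>space M. real (rhat \<omega>)
            \<ge> (1 - K) / 4 * ((real n * real q - 1) / (sqrt (real n) + sqrt (real q))\<^sup>2)}
          \<ge> 1 - exp (\<alpha>\<^sup>2 / 2) *
              (exp (- (\<alpha>\<^sup>2 * real (max n q) / 2)) /
               (1 - exp (- (\<alpha>\<^sup>2 * real (max n q) / 2))))"
  proof (intro allI impI, elim conjE)
    fix M :: "'w measure" and m n p q X A \<sigma> E Y Ahat rhat
    assume h: "prob_space M" "m > 0" "n > 0" "X \<in> carrier_mat m p" and q: "q = mat_rank X"
      and s: "\<sigma> > 0" "gaussian_matrix M m n E" and YA: "Y = (\<lambda>\<omega>. X * A + \<sigma> \<cdot>\<^sub>m E \<omega>)" "A = 0\<^sub>m p n"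
      and sel: "rank_selection K \<sigma> X M Y Ahat rhat (min n q)"
    show "measure M {\<omega>\<in>space M. real (rhat \<omega>)
            \<ge> (1 - K) / 4 * ((real n * real q - 1) / (sqrt (real n) + sqrt (real q))\<^sup>2)}
          \<ge> 1 - exp (\<alpha>\<^sup>2 / 2) *
              (exp (- (\<alpha>\<^sup>2 * real (max n q) / 2)) /
               (1 - exp (- (\<alpha>\<^sup>2 * real (max n q) / 2))))"
      unfolding q
      by (rule selected_rank_lower_bound[OF assms al h s sel[unfolded YA q]])
  qed
  show "\<not> (\<exists>c>0. \<forall>m n p q X A \<sigma>.
          m > 0 \<and> n > 0 \<and> p > 0 \<and>
          X \<in> carrier_mat m p \<and> X \<noteq> 0\<^sub>m m p \<and> q = mat_rank X \<and>
          A \<in> carrier_mat p n \<and> \<sigma> > 0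
          \<longrightarrow>
          (\<exists>Ahat rhat.
             (\<forall>r\<le>min n q. random_matrix (gauss_space m n) p n (Ahat r)) \<and>
             rank_selection K \<sigma> X (gauss_space m n) (\<lambda>\<omega>. X * A + \<sigma> \<cdot>\<^sub>m mat m n \<omega>)
               Ahat rhat (min n q) \<and>
             risk_bound c K \<sigma> X A (gauss_space m n) Ahat rhat (min n q)))"
  proof (intro notI, elim exE conjE)
    fix c :: real
    assume c: "c > 0" and all: "\<forall>m n p q X A \<sigma>.
          m > 0 \<and> n > 0 \<and> p > 0 \<and>
          X \<in> carrier_mat m p \<and> X \<noteq> 0\<^sub>m m p \<and> q = mat_rank X \<and>
          A \<in> carrier_mat p n \<and> \<sigma> > 0
          \<longrightarrow>
          (\<exists>Ahat rhat.
             (\<forall>r\<le>min n q. random_matrix (gauss_space m n) p n (Ahat r)) \<and>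
             rank_selection K \<sigma> X (gauss_space m n) (\<lambda>\<omega>. X * A + \<sigma> \<cdot>\<^sub>m mat m n \<omega>)
               Ahat rhat (min n q) \<and>
             risk_bound c K \<sigma> X A (gauss_space m n) Ahat rhat (min n q))"
    have K': "0 < 1 - max K 0" using assms(2) by simp
    \<comment> \<open>The dimension at which the necessary condition
      \<open>real k * (1 - max K 0) \<le> c\<close> fails; \<open>K < 1\<close> makes the factor
      positive.\<close>
    obtain k :: nat where k: "c / (1 - max K 0) < real k" using reals_Archimedean2 by blast
    have "0 \<le> c / (1 - max K 0)" using c K' by simp
    then have k0: "0 < k" using k by simp
    define n :: nat where n: "n = 1"
    define X :: "real mat" where X: "X = 1\<^sub>m k"
    define A :: "real mat" where A: "A = 0\<^sub>m k n"
    have "X $$ (0, 0) \<noteq> (0\<^sub>m k k :: real mat) $$ (0, 0)" using k0 by (simp add: X)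
    then have "X \<noteq> 0\<^sub>m k k" by auto
    moreover have "X \<in> carrier_mat k k" "A \<in> carrier_mat k n" by (simp_all add: X A)
    ultimately obtain Ahat rhat where
      "rank_selection K 1 X (gauss_space k n) (\<lambda>\<omega>. X * A + 1 \<cdot>\<^sub>m mat k n \<omega>) Ahat rhat (min n (mat_rank X))"
      "risk_bound c K 1 X A (gauss_space k n) Ahat rhat (min n (mat_rank X))"
      using all[rule_format, of k n k X "mat_rank X" A 1] k0 n by fastforce
    from identity_design_risk_bound[OF n k0 c X A this] have "real k * (1 - max K 0) \<le> c" .
    then show False using k K' by (simp add: field_simps)
  qed
qed

end
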